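(* Let $K$ be the function field of a smooth, projective, irreducible curve defined over $\overline{\mathbb{Q}}$. Let $q=p^{r}$ ($r\ge1$) be a power of the prime number $p$. Let $f\in K[x]$ be a polynomial of the form $f(x)=x^q+t$ where $t\notin\overline{\mathbb{Q}}$. Then for any non-periodic $\beta\in K$, the pair $(f,\beta)$ is eventually stable over $K$.
   Context: $f^n$ denotes the $n$-th iterate of $f$. A point $\beta$ is periodic for $f$ if $f^n(\beta)=\beta$ for some $n\ge1$, and non-periodic otherwise. The pair $(f,\beta)$ is eventually stable over $K$ if the number of irreducible factors over $K$ of $f^n(x)-\beta$ is bounded uniformly in $n$. *)

theory Defs
  imports
    "HOL-Algebra.Algebraic_Closure_Type"
    "HOL-Analysis.Cartesian_Space"
    "HOL-Library.Poly_Mapping"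
begin

type_synonym Qbar = "rat alg_closure"

section \<open>Multivariate polynomials\<close>

text \<open>
  A polynomial with variables indexed by \<open>'v\<close> maps monomials, i.e. finitely supported exponent
  functions, to coefficients; its ring structure is the one of \<^theory>\<open>HOL-Library.Poly_Mapping\<close>.
\<close>

type_synonym ('v, 'k) mpoly = "('v \<Rightarrow>\<^sub>0 nat) \<Rightarrow>\<^sub>0 'k"

text \<open>Evaluation at \<open>x\<close> after mapping the coefficients along \<open>\<iota>\<close>.\<close>

definition mpeval :: "('k::zero \<Rightarrow> 'a::comm_semiring_1) \<Rightarrow> ('v \<Rightarrow> 'a) \<Rightarrow> ('v, 'k) mpoly \<Rightarrow> 'a" where
  "mpeval \<iota> x P =
     (\<Sum>m\<in>Poly_Mapping.keys P. \<iota> (Poly_Mapping.lookup P m) *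
        (\<Prod>v\<in>Poly_Mapping.keys m. x v ^ Poly_Mapping.lookup m v))"

definition homogeneous :: "nat \<Rightarrow> ('v, 'k::zero) mpoly \<Rightarrow> bool" where
  "homogeneous d P \<longleftrightarrow>
     (\<forall>m\<in>Poly_Mapping.keys P. (\<Sum>v\<in>Poly_Mapping.keys m. Poly_Mapping.lookup m v) = d)"

text \<open>The vector of formal partial derivatives of \<open>P\<close>, evaluated at \<open>x\<close>.\<close>

definition mpgradient :: "('n::finite, 'k::comm_ring_1) mpoly \<Rightarrow> 'k ^ 'n \<Rightarrow> 'k ^ 'n" where
  "mpgradient P x = (\<chi> j.
     \<Sum>m\<in>Poly_Mapping.keys P. Poly_Mapping.lookup P m * of_nat (Poly_Mapping.lookup m j) *
        (\<Prod>i\<in>UNIV. x $ i ^ (Poly_Mapping.lookup m i - (if i = j then 1 else 0))))"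


section \<open>Projective varieties\<close>

text \<open>
  A subset of projective space of dimension \<open>CARD('n) - 1\<close> over an algebraically closed field is
  represented by the set of all vectors of homogeneous coordinates of its points. Such vectors
  are nonzero.
\<close>

definition vanishes_on :: "('n::finite, 'k::comm_ring_1) mpoly \<Rightarrow> ('k ^ 'n) set \<Rightarrow> bool" where
  "vanishes_on P V \<longleftrightarrow> (\<forall>x\<in>V. mpeval (\<lambda>c. c) (($) x) P = 0)"

definition projective_algebraic_set :: "('k::alg_closed_field ^ 'n::finite) set \<Rightarrow> bool" where
  "projective_algebraic_set V \<longleftrightarrow>
     (\<exists>S :: ('n, 'k) mpoly set. (\<forall>P\<in>S. \<exists>d. homogeneous d P) \<and>
        V = {x. x \<noteq> 0 \<and> (\<forall>P\<in>S. mpeval (\<lambda>c. c) (($) x) P = 0)})"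

definition projective_variety :: "('k::alg_closed_field ^ 'n::finite) set \<Rightarrow> bool" where
  "projective_variety V \<longleftrightarrow>
     projective_algebraic_set V \<and> V \<noteq> {} \<and>
     (\<forall>V1 V2. projective_algebraic_set V1 \<and> projective_algebraic_set V2 \<and> V = V1 \<union> V2
        \<longrightarrow> V1 = V \<or> V2 = V)"

text \<open>
  Jacobian criterion for a variety of dimension \<open>d\<close>: at every point, the gradients of the
  homogeneous elements of the vanishing ideal span a space of dimension \<open>N - d\<close>, where
  \<open>N = CARD('n) - 1\<close> is the dimension of the ambient projective space.
\<close>

definition smooth_of_dimension :: "nat \<Rightarrow> ('k::alg_closed_field ^ 'n::finite) set \<Rightarrow> bool" where
  "smooth_of_dimension d V \<longleftrightarrow>
     (\<forall>x\<in>V. vec.dim {mpgradient P x | P. (\<exists>e. homogeneous e P) \<and> vanishes_on P V} + d + 1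
        = CARD('n))"


section \<open>Function fields\<close>

text \<open>
  Pairs \<open>(F, G)\<close> representing rational functions \<open>F / G\<close> on \<open>V\<close>.
\<close>

definition rational_fractions ::
  "('k::alg_closed_field ^ 'n::finite) set \<Rightarrow> (('n, 'k) mpoly \<times> ('n, 'k) mpoly) set" where
  "rational_fractions V =
     {(F, G). (\<exists>d. homogeneous d F \<and> homogeneous d G) \<and> \<not> vanishes_on G V}"

text \<open>
  The field \<open>'a\<close>, with constants embedded by \<open>\<iota>\<close>, is isomorphic over \<open>'k\<close> to the field of
  rational functions on the projective variety \<open>V\<close>, i.e. the quotient of
  \<open>rational_fractions V\<close> by the relation \<open>F G' - F' G = 0\<close> on \<open>V\<close>. The map \<open>\<phi>\<close> is the
  composition of the quotient map with the isomorphism. The conditions on \<open>\<phi>\<close> force \<open>\<iota>\<close> to be a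
  ring homomorphism.
\<close>

definition is_function_field ::
  "('k::alg_closed_field \<Rightarrow> 'a::field) \<Rightarrow> ('k ^ 'n::finite) set \<Rightarrow> bool" where
  "is_function_field \<iota> V \<longleftrightarrow>
     (\<exists>\<phi> :: ('n, 'k) mpoly \<times> ('n, 'k) mpoly \<Rightarrow> 'a.
        \<phi> ` rational_fractions V = UNIV \<and>
        (\<forall>c. \<phi> (Poly_Mapping.single 0 c, 1) = \<iota> c) \<and>
        (\<forall>F G F' G'. (F, G) \<in> rational_fractions V \<longrightarrow> (F', G') \<in> rational_fractions V \<longrightarrow>
           (\<phi> (F, G) = \<phi> (F', G') \<longleftrightarrow> vanishes_on (F * G' - F' * G) V) \<and>
           \<phi> (F * G' + F' * G, G * G') = \<phi> (F, G) + \<phi> (F', G') \<and>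
           \<phi> (F * F', G * G') = \<phi> (F, G) * \<phi> (F', G')))"

definition alg_independent :: "('k::zero \<Rightarrow> 'a::field) \<Rightarrow> 'a set \<Rightarrow> bool" where
  "alg_independent \<iota> B \<longleftrightarrow>
     (\<forall>P :: ('a, 'k) mpoly.
        (\<forall>m\<in>Poly_Mapping.keys P. Poly_Mapping.keys m \<subseteq> B) \<longrightarrow> mpeval \<iota> (\<lambda>y. y) P = 0 \<longrightarrow> P = 0)"

definition transcendence_basis :: "('k::zero \<Rightarrow> 'a::field) \<Rightarrow> 'a set \<Rightarrow> bool" where
  "transcendence_basis \<iota> B \<longleftrightarrow>
     alg_independent \<iota> B \<and> (\<forall>B'. alg_independent \<iota> B' \<longrightarrow> B \<subseteq> B' \<longrightarrow> B' = B)"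

definition has_transcendence_degree :: "('k::zero \<Rightarrow> 'a::field) \<Rightarrow> nat \<Rightarrow> bool" where
  "has_transcendence_degree \<iota> d \<longleftrightarrow> (\<exists>B. transcendence_basis \<iota> B \<and> finite B \<and> card B = d)"

text \<open>
  The dimension of a variety is by definition the transcendence degree of its function field over
  the field of constants.
\<close>

definition is_function_field_of_smooth_projective_curve ::
  "('k::alg_closed_field \<Rightarrow> 'a::field) \<Rightarrow> ('k ^ 'n::finite) set \<Rightarrow> bool" where
  "is_function_field_of_smooth_projective_curve \<iota> V \<longleftrightarrow>
     projective_variety V \<and> is_function_field \<iota> V \<and> has_transcendence_degree \<iota> 1 \<and>
     smooth_of_dimension 1 V"


section \<open>Iteration and eventual stability\<close>

definition poly_iterate :: "'a::comm_semiring_1 poly \<Rightarrow> nat \<Rightarrow> 'a poly" where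
  "poly_iterate f n = (pcompose f ^^ n) [:0, 1:]"

definition periodic_point :: "'a::comm_semiring_1 poly \<Rightarrow> 'a \<Rightarrow> bool" where
  "periodic_point f \<beta> \<longleftrightarrow> (\<exists>n\<ge>1. poly (poly_iterate f n) \<beta> = \<beta>)"

definition is_irreducible_factorization :: "'a::field poly \<Rightarrow> 'a poly multiset \<Rightarrow> bool" where
  "is_irreducible_factorization P A \<longleftrightarrow>
     P \<noteq> 0 \<and> (\<forall>g\<in>#A. Factorial_Ring.irreducible g) \<and> (\<exists>c. P = Polynomial.smult c (prod_mset A))"

text \<open>
  Irreducible factors are counted with multiplicity; by unique factorization, \<open>size A\<close> below does
  not depend on the choice of the factorization \<open>A\<close>.
\<close>

definition eventually_stable :: "'a::field poly \<Rightarrow> 'a \<Rightarrow> bool" where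
  "eventually_stable f \<beta> \<longleftrightarrow>
     (\<exists>C. \<forall>n. \<exists>A. is_irreducible_factorization (poly_iterate f n - [:\<beta>:]) A \<and> size A \<le> C)"

end

theory Submission
  imports Defs "HOL-Analysis.Continuum_Not_Denumerable"
begin

text \<open>
  Choose \<open>u\<close> in the algebraic closure of \<open>K\<close> with \<open>u\<^sup>q + t = u\<close>. The field \<open>k(u)\<close>, where \<open>k\<close> is the
  field of constants, contains \<open>t = u - u\<^sup>q\<close>, and \<open>K(u)\<close> is finite over it, so it suffices to bound the
  degrees over \<open>k(u)\<close> of the points \<open>s\<close> with \<open>f\<^sup>n(s) = \<beta>\<close> from below by a constant times \<open>q\<^sup>n\<close>.

  Extend the \<open>p\<close>-adic valuation of \<open>k\<close> to the algebraic closure of \<open>k(u)\<close> such that \<open>v u\<close> is a small positive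
  irrational number \<open>\<gamma>\<close>. All values are of the form \<open>a + b\<gamma>\<close> with rational \<open>a\<close> and \<open>b\<close>, constants have
  \<open>b = 0\<close>, and elements of \<open>k(u)\<close> have integral \<open>b\<close>. Since \<open>f(u + y) - u\<close> is congruent to \<open>y\<^sup>q\<close> modulo
  \<open>p\<close>, a point \<open>u + y\<close> for which \<open>y\<close> is not \<open>p\<close>-adically close to a constant has only preimages \<open>u + y'\<close> whose
  distance to the constants has \<open>1/q\<close> times the value of the one of \<open>y\<close>. Above such a point the denominator of
  \<open>b\<close>, hence the ramification index, is multiplied by \<open>q\<close> at each level.

  At each high level, \<open>f\<close> is injective on the set of points with a preimage close to \<open>u\<close> plus a constant, so
  the number of these points is bounded independently of the level. If all conjugates of a point of a high level
  were of this kind, it would have bounded degree. The expansions at \<open>u = \<infinity>\<close> exclude this, because they force two points of its forward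
  orbit to coincide, whereas \<open>\<beta>\<close> is not periodic.
\<close>

section \<open>Subfields of algebraically closed fields\<close>

text \<open>Values of constants are rational, so an irrational \<open>v u\<close> makes the
  coefficient of \<open>v u\<close> in the value of a point well defined, and the smallness of that
  coefficient alone forces a large degree; no residue fields or ramification theory enter. Expanding
  around the fixed point u removes the constant term, and q being a power of p puts p into all mixed
  binomial coefficients.

  The obstacle is the points close to u plus a constant, about which this estimate says nothing. For
  two points with the same image, whose quotient is a q-th root of unity \<zeta> \<noteq> 1,
  closeness of a preimage of each yields a constant c such that (\<zeta> - 1)(u - c) has value at
  least v p + 1/(2 q^2). As v(\<zeta> - 1) is at most v p, this fails for small \<open>v u\<close>;
  hence the choice of \<gamma>. So these points are few, yet they could still be closed under
  conjugation. The place at infinity settles this because its residue characteristic is 0: the q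
  preimages of a point are told apart by their codes, and passing to preimages with equal codes
  contracts distances.\<close>

definition poly_over :: "'a set \<Rightarrow> 'a::zero poly \<Rightarrow> bool" where
  "poly_over E p \<longleftrightarrow> (\<forall>i. coeff p i \<in> E)"

lemma proots_linear_factors: "proots (\<Prod>x\<in>#A. [:-x, 1:]) = A"
proof (induction A)
  case (add x A)
  have "(\<Prod>x\<in>#A. [:-x, 1:]) \<noteq> 0"
    by (auto simp: prod_mset_zero_iff)
  thus ?case
    using add proots_mult[of "[:-x, 1:]" "\<Prod>x\<in>#A. [:-x, 1:]"]
    by (simp del: mult_pCons_left)
qed auto

lemma
  fixes p :: "'a::alg_closed_field poly"
  assumes "p \<noteq> 0"
  shows proots_factorization: "p = smult (lead_coeff p) (\<Prod>x\<in>#proots p. [:-x, 1:])"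
    and size_proots: "size (proots p) = degree p"
proof -
  obtain A where A: "size A = degree p" "p = smult (lead_coeff p) (\<Prod>x\<in>#A. [:-x, 1:])"
    using alg_closed_imp_factorization[OF assms] by blast
  have "proots p = proots (\<Prod>x\<in>#A. [:-x, 1:])"
    using assms by (subst A(2)) (simp add: proots_smult)
  hence "proots p = A" by (simp only: proots_linear_factors)
  thus "p = smult (lead_coeff p) (\<Prod>x\<in>#proots p. [:-x, 1:])" "size (proots p) = degree p"
    using A by simp_all
qed

lemma poly_eq_prod_proots:
  fixes p :: "'a::alg_closed_field poly"
  assumes "p \<noteq> 0"
  shows "poly p x = lead_coeff p * (\<Prod>r\<in>#proots p. x - r)"
proof -
  have "poly (\<Prod>x\<in>#A. [:-x, 1:]) x = (\<Prod>r\<in>#A. x - r)" for A :: "'a multiset"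
    by (induction A) (auto simp: algebra_simps)
  thus ?thesis
    using arg_cong[OF proots_factorization[OF assms], of "\<lambda>p. poly p x"] by simp
qed

lemma prod_mset_mult_const: "(\<Prod>x\<in>#M. c * g x) = c ^ size M * (\<Prod>x\<in>#M. g x)"
  for c :: "'a::comm_monoid_mult"
  by (induction M) (auto simp: mult_ac)

lemma prod_mset_swap:
  "(\<Prod>x\<in>#M. \<Prod>y\<in>#N. g x y) = (\<Prod>y\<in>#N. \<Prod>x\<in>#M. (g x y :: 'a::comm_monoid_mult))"
  by (induction M) (auto simp: prod_mset.distrib)

locale infinite_subfield =
  fixes E :: "'a::alg_closed_field set"
  assumes one_mem [simp]: "1 \<in> E"
    and diff_mem: "x \<in> E \<Longrightarrow> y \<in> E \<Longrightarrow> x - y \<in> E"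
    and mult_mem: "x \<in> E \<Longrightarrow> y \<in> E \<Longrightarrow> x * y \<in> E"
    and inverse_mem: "x \<in> E \<Longrightarrow> inverse x \<in> E"
    and infinite_subfield: "infinite E"
begin

lemma zero_mem [simp]: "0 \<in> E"
  using diff_mem[OF one_mem one_mem] by simp

lemma uminus_mem: "x \<in> E \<Longrightarrow> - x \<in> E"
  using diff_mem[of 0 x] by simp

lemma add_mem: "x \<in> E \<Longrightarrow> y \<in> E \<Longrightarrow> x + y \<in> E"
  using diff_mem[of x "- y"] uminus_mem[of y] by simp

lemma divide_mem: "x \<in> E \<Longrightarrow> y \<in> E \<Longrightarrow> x / y \<in> E"
  unfolding divide_inverse by (intro mult_mem inverse_mem)

lemma power_mem: "x \<in> E \<Longrightarrow> x ^ n \<in> E"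
  by (induction n) (auto intro: mult_mem)

lemma sum_mem: "(\<And>i. i \<in> I \<Longrightarrow> g i \<in> E) \<Longrightarrow> sum g I \<in> E"
  by (induction I rule: infinite_finite_induct) (auto intro: add_mem)

lemma prod_mset_mem: "(\<And>x. x \<in># M \<Longrightarrow> g x \<in> E) \<Longrightarrow> (\<Prod>x\<in>#M. g x) \<in> E"
  by (induction M) (auto intro: mult_mem)

lemmas mems = add_mem diff_mem mult_mem uminus_mem inverse_mem divide_mem power_mem sum_mem

lemma poly_over_simps [simp]:
  "poly_over E 0" "poly_over E 1"
  by (auto simp: poly_over_def coeff_1)

lemma poly_over_pCons: "a \<in> E \<Longrightarrow> poly_over E p \<Longrightarrow> poly_over E (pCons a p)"
  unfolding poly_over_def by (auto simp: coeff_pCons split: nat.split)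

lemma poly_over_const: "a \<in> E \<Longrightarrow> poly_over E [:a:]"
  by (intro poly_over_pCons) auto

lemma poly_over_add: "poly_over E p \<Longrightarrow> poly_over E q \<Longrightarrow> poly_over E (p + q)"
  unfolding poly_over_def by (auto intro: mems)

lemma poly_over_diff: "poly_over E p \<Longrightarrow> poly_over E q \<Longrightarrow> poly_over E (p - q)"
  unfolding poly_over_def by (auto intro: mems)

lemma poly_over_smult: "a \<in> E \<Longrightarrow> poly_over E p \<Longrightarrow> poly_over E (smult a p)"
  unfolding poly_over_def by (auto intro: mems)

lemma poly_over_monom: "a \<in> E \<Longrightarrow> poly_over E (monom a n)"
  unfolding poly_over_def by auto

lemma poly_over_mult: "poly_over E p \<Longrightarrow> poly_over E q \<Longrightarrow> poly_over E (p * q)"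
  unfolding poly_over_def coeff_mult by (auto intro!: mems)

lemma poly_over_sum: "(\<And>i. i \<in> I \<Longrightarrow> poly_over E (g i)) \<Longrightarrow> poly_over E (sum g I)"
  by (induction I rule: infinite_finite_induct) (auto intro: poly_over_add)

lemma poly_over_pcompose: "poly_over E p \<Longrightarrow> poly_over E q \<Longrightarrow> poly_over E (pcompose p q)"
proof (induction p)
  case (pCons a p)
  have "coeff (pCons a p) 0 \<in> E" "coeff (pCons a p) (Suc i) \<in> E" for i
    using pCons.prems unfolding poly_over_def by blast+
  hence "a \<in> E" "poly_over E p"
    by (auto simp: poly_over_def)
  thus ?case
    using pCons by (auto simp: pcompose_pCons intro!: poly_over_add poly_over_mult poly_over_const)
qed auto

lemma poly_over_divmod:
  assumes "poly_over E p" "poly_over E q" "q \<noteq> 0"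
  shows "\<exists>a b. poly_over E a \<and> poly_over E b \<and> p = a * q + b \<and> (b = 0 \<or> degree b < degree q)"
  using assms(1)
proof (induction "if p = 0 then 0 else Suc (degree p)" arbitrary: p rule: less_induct)
  case less
  show ?case
  proof (cases "p = 0 \<or> degree p < degree q")
    case True
    thus ?thesis
      using less.prems by (intro exI[of _ 0] exI[of _ p]) auto
  next
    case False
    hence "p \<noteq> 0" and deg: "degree q \<le> degree p" by auto
    define c where "c = monom (lead_coeff p / lead_coeff q) (degree p - degree q)"
    have c: "poly_over E c"
      unfolding c_def using less.prems assms(2)
      by (intro poly_over_monom mems) (auto simp: poly_over_def)
    have "c \<noteq> 0" and degc: "degree c = degree p - degree q"
      using \<open>p \<noteq> 0\<close> assms(3) by (auto simp: c_def degree_monom_eq monom_eq_0_iff)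
    define p' where "p' = p - c * q"
    have p': "poly_over E p'"
      unfolding p'_def using c less.prems assms(2) by (intro poly_over_diff poly_over_mult)
    have dcq: "degree (c * q) = degree p"
      using \<open>c \<noteq> 0\<close> assms(3) deg by (simp add: degree_mult_eq degc)
    have lcq: "lead_coeff (c * q) = lead_coeff p"
      using assms(3) by (simp add: lead_coeff_mult c_def degree_monom_eq \<open>p \<noteq> 0\<close>)
    have "p' = 0 \<or> degree p' < degree p"
      unfolding p'_def using dcq lcq
      by (metis (no_types, lifting) \<open>p \<noteq> 0\<close> coeff_diff degree_diff_le le_neq_implies_less 
          diff_self leading_coeff_0_iff order_refl)
    hence "\<exists>a b. poly_over E a \<and> poly_over E b \<and> p' = a * q + b \<and> (b = 0 \<or> degree b < degree q)"
      using p' \<open>p \<noteq> 0\<close> by (intro less.hyps) auto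
    then obtain a b where ab: "poly_over E a" "poly_over E b" "p' = a * q + b"
      "b = 0 \<or> degree b < degree q" by blast
    show ?thesis
      using ab c by (intro exI[of _ "a + c"] exI[of _ b])
        (auto simp: p'_def algebra_simps intro: poly_over_add)
  qed
qed

text \<open>The swap \<open>\<Prod>\<^bsub>P(s)=0\<^esub> h(s) \<leftrightarrow> \<Prod>\<^bsub>h(r)=0\<^esub> P(r)\<close> together with \<open>h \<mapsto> h mod P\<close> runs the
  Euclidean algorithm on the resultant.\<close>

lemma norm_mem:
  assumes "poly_over E P" "poly_over E h" "P \<noteq> 0"
  shows "(\<Prod>s\<in>#proots P. poly h s) \<in> E"
  using assms
proof (induction "degree P" arbitrary: P h rule: less_induct)
  case less
  obtain a b where ab: "poly_over E a" "poly_over E b" "h = a * P + b"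
    "b = 0 \<or> degree b < degree P"
    using poly_over_divmod[OF less.prems(2,1,3)] by blast
  have eq: "(\<Prod>s\<in>#proots P. poly h s) = (\<Prod>s\<in>#proots P. poly b s)"
    using less.prems by (intro arg_cong[where f = prod_mset] image_mset_cong) (auto simp: ab(3))
  show ?case
  proof (cases "b = 0")
    case True
    thus ?thesis
      unfolding eq by (intro prod_mset_mem) auto
  next
    case False
    hence deg: "degree b < degree P" using ab by simp
    define c where "c = (- 1) ^ degree P / lead_coeff P"
    have c: "(\<Prod>s\<in>#proots P. s - r) = c * poly P r" for r
    proof -
      have "(\<Prod>s\<in>#proots P. s - r) = (\<Prod>s\<in>#proots P. (- 1) * (r - s))"
        by (intro arg_cong[where f = prod_mset] image_mset_cong) auto
      also have "\<dots> = (- 1) ^ size (proots P) * (\<Prod>s\<in>#proots P. r - s)"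
        by (rule prod_mset_mult_const)
      finally show ?thesis
        using less.prems by (simp add: c_def size_proots poly_eq_prod_proots[of P r])
    qed
    have "(\<Prod>s\<in>#proots P. poly b s) = (\<Prod>s\<in>#proots P. lead_coeff b * (\<Prod>r\<in>#proots b. s - r))"
      by (subst poly_eq_prod_proots[OF False]) simp
    also have "\<dots> = lead_coeff b ^ size (proots P) * (\<Prod>r\<in>#proots b. \<Prod>s\<in>#proots P. s - r)"
      by (simp only: prod_mset_mult_const prod_mset_swap[of _ "proots b"])
    also have "\<dots> = lead_coeff b ^ size (proots P) * (c ^ size (proots b) * (\<Prod>r\<in>#proots b. poly P r))"
      by (simp only: c prod_mset_mult_const)
    finally have *: "(\<Prod>s\<in>#proots P. poly b s) = \<dots>" .
    have "(\<Prod>r\<in>#proots b. poly P r) \<in> E"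
      using less.hyps[OF deg ab(2) less.prems(1) False] .
    moreover have "lead_coeff b \<in> E" "lead_coeff P \<in> E"
      using ab less.prems by (auto simp: poly_over_def)
    ultimately show ?thesis
      unfolding eq * c_def by (intro mems) auto
  qed
qed

text \<open>Divided differences: after division by X - e for one e in S, the quotient still takes
  values in E on the rest of S and has smaller degree. This lets norms of polynomials be treated
  pointwise.\<close>

lemma poly_over_if_values:
  assumes "infinite S" "S \<subseteq> E" "\<And>e. e \<in> S \<Longrightarrow> poly Q e \<in> E"
  shows "poly_over E Q"
  using assms
proof (induction "degree Q" arbitrary: Q S rule: less_induct)
  case less
  show ?case
  proof (cases "degree Q = 0")
    case True
    then obtain a where a: "Q = [:a:]" by (elim degree_eq_zeroE)
    obtain e where "e \<in> S" using less.prems(1) by fastforce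
    thus ?thesis using less.prems(3)[of e] a by (auto intro: poly_over_const)
  next
    case False
    obtain e where e: "e \<in> S" using less.prems(1) by fastforce
    have "[:-e, 1:] dvd (Q - [:poly Q e:])"
      by (simp flip: poly_eq_0_iff_dvd)
    then obtain Q1 where Q1: "Q - [:poly Q e:] = [:-e, 1:] * Q1" by (elim dvdE)
    hence Q: "Q = [:-e, 1:] * Q1 + [:poly Q e:]" by (simp add: algebra_simps)
    have "Q1 \<noteq> 0" using False Q by (metis add.left_neutral degree_pCons_0 mult_zero_right)
    hence "degree ([:-e, 1:] * Q1) = Suc (degree Q1)"
      by (subst degree_mult_eq) auto
    moreover have "degree Q = degree ([:-e, 1:] * Q1)"
      by (subst Q, rule degree_add_eq_left) (simp add: calculation del: mult_pCons_left)
    ultimately have deg: "degree Q1 < degree Q" by simp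
    have "poly_over E Q1"
    proof (rule less.hyps[OF deg, of "S - {e}"])
      fix x assume x: "x \<in> S - {e}"
      have "poly Q x = (x - e) * poly Q1 x + poly Q e"
        using arg_cong[OF Q, of "\<lambda>p. poly p x"] by (simp add: algebra_simps)
      hence "poly Q1 x = (poly Q x - poly Q e) / (x - e)"
        using x by (simp add: field_simps)
      thus "poly Q1 x \<in> E"
        using x e less.prems by (auto intro!: mems)
    qed (use less.prems in auto)
    thus ?thesis
      using e less.prems by (subst Q) (intro poly_over_add poly_over_mult poly_over_const poly_over_pCons mems; auto)
  qed
qed

text \<open>The norm of a polynomial whose coefficients depend on the root s. At an element e of E
  it becomes a product of values of a single polynomial over E at the roots, which
  \<open>norm_mem\<close> covers; infinitely many such e suffice.\<close>

lemma poly_over_norm: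
  assumes "poly_over E P" "P \<noteq> 0" "\<And>j. j \<le> n \<Longrightarrow> poly_over E (h j)"
  shows "poly_over E (\<Prod>s\<in>#proots P. \<Sum>j\<le>n. monom (poly (h j) s) j)"
proof (rule poly_over_if_values[OF infinite_subfield])
  fix e assume e: "e \<in> E"
  have "poly (\<Prod>s\<in>#M. \<Sum>j\<le>n. monom (poly (h j) s) j) e =
          (\<Prod>s\<in>#M. poly (\<Sum>j\<le>n. smult (e ^ j) (h j)) s)" for M
    by (induction M) (auto simp: poly_sum poly_monom mult_ac)
  moreover have "poly_over E (\<Sum>j\<le>n. smult (e ^ j) (h j))"
    using assms e by (intro poly_over_sum poly_over_smult mems) auto
  ultimately show "poly (\<Prod>s\<in>#proots P. \<Sum>j\<le>n. monom (poly (h j) s) j) e \<in> E"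
    using norm_mem[OF assms(1) _ assms(2)] by simp
qed auto

text \<open>Divisibility is taken among all polynomials over the big field, so irreducibility over E
  is never mentioned, and the polynomial is determined only up to a scalar factor.\<close>

definition minimal_poly :: "'a \<Rightarrow> 'a poly \<Rightarrow> bool" where
  "minimal_poly s P \<longleftrightarrow> poly_over E P \<and> P \<noteq> 0 \<and> poly P s = 0 \<and>
     (\<forall>Q. poly_over E Q \<longrightarrow> poly Q s = 0 \<longrightarrow> P dvd Q)"

lemma minimal_poly_exists:
  assumes "poly_over E Q" "Q \<noteq> 0" "poly Q s = 0"
  shows "\<exists>P. minimal_poly s P"
proof -
  define A where "A = {Q. poly_over E Q \<and> Q \<noteq> 0 \<and> poly Q s = 0}"
  have "A \<noteq> {}" using assms by (auto simp: A_def)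
  define P where "P = arg_min degree (\<lambda>Q. Q \<in> A)"
  have P: "P \<in> A" and min: "\<And>Q. Q \<in> A \<Longrightarrow> degree P \<le> degree Q"
    using arg_min_nat_lemma[of "\<lambda>Q. Q \<in> A" Q degree] assms
    by (auto simp: P_def A_def)
  have "P dvd Q" if Q: "poly_over E Q" "poly Q s = 0" for Q
  proof -
    obtain a b where ab: "poly_over E b" "Q = a * P + b" "b = 0 \<or> degree b < degree P"
      using poly_over_divmod[of Q P] P Q by (auto simp: A_def)
    have "poly b s = 0" using Q P ab by (auto simp: A_def)
    hence "b = 0" using min[of b] ab by (force simp: A_def)
    thus ?thesis using ab by simp
  qed
  thus ?thesis using P unfolding minimal_poly_def A_def by blast
qed

text \<open>The product of X - h(s') over the roots s' of P is a norm, hence lies over E, and it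
  vanishes at h(s); so P' divides it. The lemma serves to lift a chosen conjugate of an iterate of s
  to a conjugate of s itself.\<close>

lemma minimal_poly_conj_surj:
  assumes s: "minimal_poly s P" and h: "poly_over E h"
    and hs: "minimal_poly (poly h s) P'" and x: "poly P' x = 0"
  shows "\<exists>s'. poly P s' = 0 \<and> poly h s' = x"
proof -
  define Q where "Q = (\<Prod>s\<in>#proots P. \<Sum>j\<le>(1::nat). monom (poly (if j = 0 then - h else 1) s) j)"
  have Q: "poly Q y = (\<Prod>s\<in>#proots P. y - poly h s)" for y
  proof -
    have "poly (\<Prod>s\<in>#M. \<Sum>j\<le>(1::nat). monom (poly (if j = 0 then - h else 1) s) j) y =
      (\<Prod>s\<in>#M. y - poly h s)" for M
      by (induction M) (auto simp: poly_monom)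
    thus ?thesis by (simp add: Q_def)
  qed
  have P: "P \<noteq> 0" "poly P s = 0" using s by (auto simp: minimal_poly_def)
  have "poly_over E Q"
    unfolding Q_def using s h poly_over_diff[of 0 h]
    by (intro poly_over_norm) (auto simp: minimal_poly_def)
  moreover have "poly Q (poly h s) = 0"
    unfolding Q using P by (auto simp: prod_mset_zero_iff)
  ultimately have "P' dvd Q"
    using hs by (auto simp: minimal_poly_def)
  hence "poly Q x = 0" using x by (metis dvdE mult_zero_left poly_mult)
  thus ?thesis
    unfolding Q using P by (auto simp: prod_mset_zero_iff)
qed

text \<open>Write P = Q * R with Q minimal for x. If z were a root of R, minimality of P would leave
  degree 0 for Q; so z is a root of Q, and P and Q divide each other.\<close>

lemma minimal_poly_root:
  assumes z: "minimal_poly z P" and x: "poly P x = 0"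
  shows "minimal_poly x P"
proof -
  have P: "poly_over E P" "P \<noteq> 0" "poly P z = 0" using z by (auto simp: minimal_poly_def)
  obtain Q where Q: "minimal_poly x Q" using minimal_poly_exists[OF P(1,2) x] by blast
  have "Q dvd P" using Q P x by (auto simp: minimal_poly_def)
  then obtain R where R: "P = Q * R" by (elim dvdE)
  \<comment> \<open>\<open>Q\<close> divides \<open>P\<close> only in the big polynomial ring;
    division with remainder over E, whose remainder must vanish, places the cofactor over E.\<close>
  have "poly_over E R"
  proof -
    obtain a b where ab: "poly_over E a" "poly_over E b" "P = a * Q + b" "b = 0 \<or> degree b < degree Q"
      using poly_over_divmod[of P Q] P Q by (auto simp: minimal_poly_def)
    have "Q dvd b" using ab(3) \<open>Q dvd P\<close> by (metis dvd_add_right_iff dvd_triv_right)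
    hence "b = 0" using ab(4) by (metis dvd_imp_degree_le leD)
    hence "Q * R = Q * a" using R ab(3) by (metis mult.commute add_0_right)
    hence "R = a" using Q by (simp add: minimal_poly_def)
    thus ?thesis using ab(1) by simp
  qed
  moreover have False if "poly R z = 0"
  proof -
    have "P dvd R" using z that \<open>poly_over E R\<close> by (auto simp: minimal_poly_def)
    moreover have "R \<noteq> 0" "Q \<noteq> 0" using R P by auto
    ultimately have "degree P \<le> degree R" by (intro dvd_imp_degree_le)
    hence "degree Q = 0" using R \<open>R \<noteq> 0\<close> \<open>Q \<noteq> 0\<close> by (simp add: degree_mult_eq)
    thus False using Q by (auto simp: minimal_poly_def elim!: degree_eq_zeroE)
  qed
  ultimately have "poly Q z = 0" using P(3) R by auto
  hence "P dvd Q" using z Q by (auto simp: minimal_poly_def)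
  thus ?thesis using P Q x dvd_trans unfolding minimal_poly_def by blast
qed

text \<open>\<open>g'\<close> is the product of the polynomials obtained from \<open>g\<close> by replacing \<open>z\<close> by its conjugates.\<close>

lemma adjoin_degree:
  assumes P: "poly_over E P" "P \<noteq> 0" "poly P z = 0"
  shows "\<exists>e>0. \<forall>g s. (\<forall>i. coeff g i \<in> {poly h z |h. poly_over E h}) \<longrightarrow> g \<noteq> 0 \<longrightarrow> poly g s = 0 \<longrightarrow>
     (\<exists>g'. poly_over E g' \<and> g' \<noteq> 0 \<and> poly g' s = 0 \<and> degree g' \<le> e * degree g)"
proof -
  obtain P where z: "minimal_poly z P" using minimal_poly_exists[OF P] by blast
  hence P: "poly_over E P" "P \<noteq> 0" "poly P z = 0" by (auto simp: minimal_poly_def)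
  have zP: "z \<in># proots P" using P by auto
  hence "degree P > 0"
    using size_proots[OF P(2)] by (metis gr0I size_eq_0_iff_empty empty_iff set_mset_empty)
  show ?thesis
  proof (intro exI[of _ "degree P"] conjI allI impI \<open>degree P > 0\<close>)
    fix g s assume g: "\<forall>i. coeff g i \<in> {poly h z |h. poly_over E h}" "g \<noteq> 0" "poly g s = 0"
    then obtain h where h: "\<And>i. coeff g i = poly (h i) z" "\<And>i. poly_over E (h i)"
      by (auto simp: choice_iff)
    let ?F = "\<lambda>x. \<Sum>j\<le>degree g. monom (poly (h j) x) j"
    define g' where "g' = (\<Prod>x\<in>#proots P. ?F x)"
    have Fz: "?F z = g"
      using poly_as_sum_of_monoms[of g] by (simp add: h(1))
    have nz: "?F x \<noteq> 0" if Px: "poly P x = 0" for x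
    proof
      assume "?F x = 0"
      hence "coeff (?F x) (degree g) = 0" by simp
      moreover have "coeff (?F x) (degree g) = poly (h (degree g)) x"
        by (simp add: coeff_sum)
      ultimately have x0: "poly (h (degree g)) x = 0" by simp
      have "P dvd h (degree g)"
        using minimal_poly_root[OF z Px] x0 h by (auto simp: minimal_poly_def)
      hence "poly (h (degree g)) z = 0" using P(3) by (metis dvdE mult_zero_left poly_mult)
      thus False using h(1)[of "degree g"] g(2) by simp
    qed
    have "poly_over E g'" unfolding g'_def using P h by (intro poly_over_norm) auto
    moreover have "g' \<noteq> 0" unfolding g'_def using nz P(2) by (auto simp: prod_mset_zero_iff)
    moreover have "poly g' s = 0"
    proof -
      have "?F z dvd g'" unfolding g'_def using zP by (intro dvd_prod_mset) auto
      thus ?thesis unfolding Fz using g(3) by (metis dvdE mult_zero_left poly_mult)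
    qed
    moreover have "degree g' \<le> degree P * degree g"
    proof -
      have "degree (\<Prod>x\<in>#M. ?F x) \<le> size M * degree g" for M
      proof (induction M)
        case (add x M)
        have "degree (?F x) \<le> degree g"
          by (intro degree_sum_le) (auto intro: order.trans[OF degree_monom_le])
        thus ?case using add degree_mult_le[of "?F x" "\<Prod>x\<in>#M. ?F x"] by simp
      qed auto
      from this[of "proots P"] show ?thesis unfolding g'_def size_proots[OF P(2)] .
    qed
    ultimately show "\<exists>g'. poly_over E g' \<and> g' \<noteq> 0 \<and> poly g' s = 0 \<and> degree g' \<le> degree P * degree g"
      by blast
  qed
qed

text \<open>Only inverses need an argument. Applied to X - x, \<open>adjoin_degree\<close> shows
  that x is algebraic over E; its minimal polynomial c + X M' has c \<noteq> 0 when x \<noteq> 0,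
  and -M'(x)/c inverts x.\<close>

lemma adjoin_subfield:
  assumes P: "poly_over E P" "P \<noteq> 0" "poly P z = 0"
  shows "infinite_subfield {poly h z |h. poly_over E h}"
proof
  let ?A = "{poly h z |h. poly_over E h}"
  have const: "c \<in> E \<Longrightarrow> c \<in> ?A" for c
    by (rule CollectI, rule exI[of _ "[:c:]"]) (auto intro: poly_over_const)
  show "1 \<in> ?A" using const[OF one_mem] .
  show "x - y \<in> ?A" if xy: "x \<in> ?A" "y \<in> ?A" for x y
  proof -
    obtain a b where "x = poly a z" "y = poly b z" "poly_over E a" "poly_over E b" using xy by blast
    thus ?thesis by (intro CollectI exI[of _ "a - b"]) (auto intro: poly_over_diff)
  qed
  have mult: "x * y \<in> ?A" if xy: "x \<in> ?A" "y \<in> ?A" for x y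
  proof -
    obtain a b where "x = poly a z" "y = poly b z" "poly_over E a" "poly_over E b" using xy by blast
    thus ?thesis by (intro CollectI exI[of _ "a * b"]) (auto intro: poly_over_mult)
  qed
  thus "x * y \<in> ?A" if "x \<in> ?A" "y \<in> ?A" for x y using that by blast
  show "infinite ?A" using const infinite_subfield by (meson finite_subset subsetI)
  show "inverse x \<in> ?A" if xA: "x \<in> ?A" for x
  proof (cases "x = 0")
    case True
    thus ?thesis using const[OF zero_mem] by simp
  next
    case False
    obtain h where h: "poly_over E h" "x = poly h z" using xA by blast
    have "coeff [:- x, 1:] i \<in> ?A" for i
    proof -
      have "poly_over E (- h)" using poly_over_diff[of 0 h] h by simp
      hence "- x \<in> ?A" using h by (intro CollectI exI[of _ "- h"]) auto
      thus ?thesis using const by (auto simp: coeff_pCons split: nat.splits)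
    qed
    moreover have "poly [:- x, 1:] x = 0" "[:- x, 1:] \<noteq> 0" by auto
    ultimately obtain g where g: "poly_over E g" "g \<noteq> 0" "poly g x = 0"
      using adjoin_degree[OF P] by meson
    obtain M where M: "minimal_poly x M" using minimal_poly_exists[OF g] by blast
    obtain c M' where cM: "M = pCons c M'" by (cases M)
    have cE: "c \<in> E" "poly_over E M'"
    proof -
      have "coeff M 0 \<in> E" "\<And>i. coeff M (Suc i) \<in> E" using M by (auto simp: minimal_poly_def poly_over_def)
      thus "c \<in> E" "poly_over E M'" by (auto simp: cM poly_over_def)
    qed
    have eq: "c + x * poly M' x = 0" using M by (auto simp: minimal_poly_def cM)
    have "c \<noteq> 0"
    proof
      assume "c = 0"
      hence "poly M' x = 0" using eq False by simp
      hence "M dvd M'" using M cE by (auto simp: minimal_poly_def)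
      moreover have "M' \<noteq> 0" using M \<open>c = 0\<close> by (auto simp: minimal_poly_def cM)
      ultimately have "degree M \<le> degree M'" by (intro dvd_imp_degree_le)
      thus False using \<open>M' \<noteq> 0\<close> by (simp add: cM)
    qed
    have "c = - x * poly M' x" using eq by (metis add_eq_0_iff2 mult_minus_left add.inverse_inverse)
    hence "inverse x = - poly M' x / c" using False \<open>c \<noteq> 0\<close> by (simp add: field_simps)
    also have "\<dots> = poly (pcompose (smult (- inverse c) M') h) z"
      by (simp add: poly_pcompose h(2) field_simps)
    finally have "inverse x = poly (pcompose (smult (- inverse c) M') h) z" .
    moreover have "poly_over E (pcompose (smult (- inverse c) M') h)"
      using cE h by (intro poly_over_pcompose poly_over_smult mems)
    ultimately show ?thesis by blast
  qed
qed

end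

section \<open>Real-valued valuations\<close>

locale valuation =
  fixes v :: "'a::field \<Rightarrow> real"
  assumes v_mult: "x \<noteq> 0 \<Longrightarrow> y \<noteq> 0 \<Longrightarrow> v (x * y) = v x + v y"
    and v_add: "x \<noteq> 0 \<Longrightarrow> y \<noteq> 0 \<Longrightarrow> x + y \<noteq> 0 \<Longrightarrow> min (v x) (v y) \<le> v (x + y)"
begin

text \<open>\<open>v 0\<close> is a junk value; \<open>vge r x\<close> treats it as \<open>\<infinity>\<close>.\<close>

definition vge :: "real \<Rightarrow> 'a \<Rightarrow> bool" where
  "vge r x \<longleftrightarrow> x = 0 \<or> r \<le> v x"

lemma v_one [simp]: "v 1 = 0"
  using v_mult[of 1 1] by simp

lemma v_power: "x \<noteq> 0 \<Longrightarrow> v (x ^ n) = n * v x"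
  by (induction n) (auto simp: v_mult algebra_simps)

lemma v_minus [simp]: "v (- x) = v x"
proof (cases "x = 0")
  case False
  have "v (- 1) + v (- 1) = 0"
    using v_mult[of "- 1" "- 1"] by simp
  thus ?thesis
    using v_mult[of "- 1" x] False by simp
qed auto

lemma v_inverse: "x \<noteq> 0 \<Longrightarrow> v (inverse x) = - v x"
  using v_mult[of x "inverse x"] by simp

lemma v_divide: "x \<noteq> 0 \<Longrightarrow> y \<noteq> 0 \<Longrightarrow> v (x / y) = v x - v y"
  unfolding divide_inverse by (simp add: v_mult v_inverse)

lemma vge_0 [simp]: "vge r 0"
  by (simp add: vge_def)

lemma vge_refl [simp]: "vge (v x) x"
  by (simp add: vge_def)

lemma vgeD: "vge r x \<Longrightarrow> x \<noteq> 0 \<Longrightarrow> r \<le> v x"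
  by (simp add: vge_def)

lemma vge_mono: "vge r x \<Longrightarrow> s \<le> r \<Longrightarrow> vge s x"
  by (auto simp: vge_def)

lemma vge_minus [simp]: "vge r (- x) \<longleftrightarrow> vge r x"
  by (simp add: vge_def)

lemma vge_add: "vge r x \<Longrightarrow> vge r y \<Longrightarrow> vge r (x + y)"
  using v_add[of x y] by (cases "x = 0"; cases "y = 0"; cases "x + y = 0") (auto simp: vge_def)

lemma vge_diff: "vge r x \<Longrightarrow> vge r y \<Longrightarrow> vge r (x - y)"
  using vge_add[of r x "- y"] by simp

lemma vge_mult: "vge r x \<Longrightarrow> vge s y \<Longrightarrow> vge (r + s) (x * y)"
  using v_mult[of x y] by (cases "x = 0"; cases "y = 0") (auto simp: vge_def)

lemma vge_power: "vge r x \<Longrightarrow> vge (n * r) (x ^ n)"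
proof (induction n)
  case (Suc n)
  have "vge (r + n * r) (x * x ^ n)"
    using Suc by (intro vge_mult) auto
  thus ?case
    by (simp add: algebra_simps)
qed (simp add: vge_def)

lemma vge_powerD:
  assumes "vge (n * r) (x ^ n)" "n > 0"
  shows "vge r x"
  using assms by (cases "x = 0") (auto simp: vge_def v_power)

lemma vge_sum: "(\<And>i. i \<in> I \<Longrightarrow> vge r (g i)) \<Longrightarrow> vge r (sum g I)"
  by (induction I rule: infinite_finite_induct) (auto intro: vge_add)

lemma vge_prod_mset:
  "(\<And>x. x \<in># M \<Longrightarrow> vge r (g x)) \<Longrightarrow> vge (real (size M) * r) (\<Prod>x\<in>#M. g x)"
proof (induction M)
  case (add x M)
  have "vge (r + real (size M) * r) (g x * (\<Prod>x\<in>#M. g x))"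
    using add by (intro vge_mult) auto
  thus ?case
    by (simp add: algebra_simps)
qed (simp add: vge_def)

lemma vge_of_nat: "vge 0 (of_nat n)"
  by (induction n) (auto intro!: vge_add simp: vge_def[of _ 1])

lemma add_dominated:
  assumes "x \<noteq> 0" "y \<noteq> 0 \<Longrightarrow> v x < v y"
  shows "x + y \<noteq> 0" "v (x + y) = v x"
proof -
  show nz: "x + y \<noteq> 0"
    using assms by (metis add_eq_0_iff2 neg_0_equal_iff_equal order_less_irrefl v_minus)
  show "v (x + y) = v x"
  proof (cases "y = 0")
    case False
    have "v x \<le> v (x + y)"
      using v_add[of x y] assms nz False by auto
    moreover have "min (v (x + y)) (v (- y)) \<le> v x"
      using v_add[of "x + y" "- y"] assms nz False by simp
    ultimately show ?thesis
      using assms False by auto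
  qed auto
qed

lemma v_add_vge:
  assumes "x \<noteq> 0" "vge r y" "v x < r"
  shows "x + y \<noteq> 0" "v (x + y) = v x"
  using add_dominated[of x y] assms by (auto simp: vge_def)

lemma v_add_distinct:
  assumes "x \<noteq> 0" "y \<noteq> 0" "v x \<noteq> v y"
  shows "x + y \<noteq> 0" "v (x + y) = min (v x) (v y)"
  using add_dominated[of x y] add_dominated[of y x] assms
  by (cases "v x < v y"; simp add: add.commute min_def)+

lemma sum_dominated:
  assumes "finite I" "j \<in> I" "g j \<noteq> 0" "\<And>i. i \<in> I \<Longrightarrow> i \<noteq> j \<Longrightarrow> g i \<noteq> 0 \<Longrightarrow> v (g j) < v (g i)"
  shows "sum g I \<noteq> 0" "v (sum g I) = v (g j)"
proof -
  have "sum g (I - {j}) \<noteq> 0 \<Longrightarrow> v (g j) < v (sum g (I - {j}))"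
  proof -
    assume nz: "sum g (I - {j}) \<noteq> 0"
    define J where "J = {i \<in> I - {j}. g i \<noteq> 0}"
    have eq: "sum g (I - {j}) = sum g J"
      unfolding J_def using assms(1) by (intro sum.mono_neutral_right) auto
    hence "J \<noteq> {}" using nz by auto
    have "finite J" using assms(1) by (simp add: J_def)
    define m where "m = Min ((v \<circ> g) ` J)"
    have "vge m (sum g J)"
      using \<open>finite J\<close> by (intro vge_sum) (auto simp: vge_def m_def)
    moreover have "m \<in> (v \<circ> g) ` J"
      unfolding m_def using \<open>finite J\<close> \<open>J \<noteq> {}\<close> by (intro Min_in) auto
    hence "v (g j) < m"
      using assms(4) by (auto simp: J_def)
    ultimately show ?thesis
      using nz eq by (auto simp: vge_def)
  qed
  moreover have "sum g I = g j + sum g (I - {j})"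
    using assms by (simp add: sum.remove)
  ultimately show "sum g I \<noteq> 0" "v (sum g I) = v (g j)"
    using add_dominated[of "g j" "sum g (I - {j})"] assms(3) by auto
qed

lemma distinct_values_sum:
  assumes "finite I" "i0 \<in> I" "g i0 \<noteq> 0"
    and "\<And>i j. i \<in> I \<Longrightarrow> j \<in> I \<Longrightarrow> i \<noteq> j \<Longrightarrow> g i \<noteq> 0 \<Longrightarrow> g j \<noteq> 0 \<Longrightarrow> v (g i) \<noteq> v (g j)"
  obtains j where "j \<in> I" "g j \<noteq> 0" "sum g I \<noteq> 0" "v (sum g I) = v (g j)"
proof -
  define J where "J = {i \<in> I. g i \<noteq> 0}"
  have J: "finite J" "J \<noteq> {}" using assms by (auto simp: J_def)
  obtain j where j: "j \<in> J" "\<And>i. i \<in> J \<Longrightarrow> v (g j) \<le> v (g i)"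
    using J arg_min_if_finite[OF J, of "v \<circ> g"] by (metis comp_apply linorder_not_less)
  have "sum g I \<noteq> 0" "v (sum g I) = v (g j)"
    using assms(1,4) j by (intro sum_dominated; force simp: J_def)+
  thus ?thesis using that j by (auto simp: J_def)
qed

text \<open>A unique minimum among the values could not cancel. This is the substitute for Newton
  polygons: a polynomial relation for x yields two terms of equal value, that is, a slope.\<close>

lemma sum_eq_0_imp_equal_values:
  assumes "finite I" "i0 \<in> I" "g i0 \<noteq> 0" "sum g I = 0"
  obtains i j where "i \<in> I" "j \<in> I" "i \<noteq> j" "g i \<noteq> 0" "g j \<noteq> 0" "v (g i) = v (g j)"
proof -
  have "\<exists>i\<in>I. \<exists>j\<in>I. i \<noteq> j \<and> g i \<noteq> 0 \<and> g j \<noteq> 0 \<and> v (g i) = v (g j)"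
    using distinct_values_sum[of I i0 g] assms by metis
  thus ?thesis using that by blast
qed

end


section \<open>Extension of valuations\<close>

definition subring_set :: "'a::field set \<Rightarrow> bool" where
  "subring_set B \<longleftrightarrow> 1 \<in> B \<and> (\<forall>x\<in>B. \<forall>y\<in>B. x - y \<in> B \<and> x * y \<in> B)"

lemma subring_setD:
  assumes "subring_set B"
  shows "1 \<in> B" "0 \<in> B" "\<And>x y. x \<in> B \<Longrightarrow> y \<in> B \<Longrightarrow> x - y \<in> B"
    "\<And>x y. x \<in> B \<Longrightarrow> y \<in> B \<Longrightarrow> x * y \<in> B" "\<And>x. x \<in> B \<Longrightarrow> - x \<in> B"
    "\<And>x y. x \<in> B \<Longrightarrow> y \<in> B \<Longrightarrow> x + y \<in> B" "\<And>x n. x \<in> B \<Longrightarrow> x ^ n \<in> B"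
proof -
  show 1: "1 \<in> B" and d: "\<And>x y. x \<in> B \<Longrightarrow> y \<in> B \<Longrightarrow> x - y \<in> B"
    and m: "\<And>x y. x \<in> B \<Longrightarrow> y \<in> B \<Longrightarrow> x * y \<in> B"
    using assms by (auto simp: subring_set_def)
  show 0: "0 \<in> B" using d[OF 1 1] by simp
  show um: "\<And>x. x \<in> B \<Longrightarrow> - x \<in> B" using d[OF 0] by simp
  show "\<And>x y. x \<in> B \<Longrightarrow> y \<in> B \<Longrightarrow> x + y \<in> B" using d um by (metis diff_minus_eq_add)
  show "x ^ n \<in> B" if "x \<in> B" for x n by (induction n) (auto intro: 1 m that)
qed

lemma subring_set_sum:
  assumes "subring_set B" "\<And>i. i \<in> I \<Longrightarrow> g i \<in> B"
  shows "sum g I \<in> B"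
  using assms(2) by (induction I rule: infinite_finite_induct) (auto intro: subring_setD[OF assms(1)])

lemma subring_set_adjoin:
  assumes B: "subring_set B"
  shows "subring_set {poly p z |p. \<forall>i. coeff p i \<in> B}"
  unfolding subring_set_def
proof (intro conjI ballI)
  note B' = subring_setD[OF B]
  show "1 \<in> {poly p z |p. \<forall>i. coeff p i \<in> B}"
    by (intro CollectI exI[of _ 1]) (auto simp: coeff_1 intro: B')
  fix x y assume "x \<in> {poly p z |p. \<forall>i. coeff p i \<in> B}" "y \<in> {poly p z |p. \<forall>i. coeff p i \<in> B}"
  then obtain p q where pq: "x = poly p z" "y = poly q z" "\<forall>i. coeff p i \<in> B" "\<forall>i. coeff q i \<in> B"
    by blast
  show "x - y \<in> {poly p z |p. \<forall>i. coeff p i \<in> B}"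
    using pq by (intro CollectI exI[of _ "p - q"]) (auto intro: B')
  show "x * y \<in> {poly p z |p. \<forall>i. coeff p i \<in> B}"
    using pq by (intro CollectI exI[of _ "p * q"]) (auto simp: coeff_mult intro!: subring_set_sum[OF B] B')
qed

text \<open>A subring maximal among those not containing \<open>\<pi>\<inverse>\<close> is a valuation ring.\<close>

lemma exists_valuation_ring:
  assumes A: "subring_set A" "\<pi> \<in> A" "inverse \<pi> \<notin> A"
  obtains M where "subring_set M" "A \<subseteq> M" "inverse \<pi> \<notin> M" "\<And>x. x \<in> M \<or> inverse x \<in> M"
proof -
  define S0 where "S0 = {B. subring_set B \<and> A \<subseteq> B \<and> inverse \<pi> \<notin> B}"
  have "\<exists>M\<in>S0. \<forall>X1\<in>S0. M \<subseteq> X1 \<longrightarrow> X1 = M"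
  proof (rule subset_Zorn_nonempty)
    show "S0 \<noteq> {}" using A by (auto simp: S0_def)
    fix C assume C: "C \<noteq> {}" "subset.chain S0 C"
    hence mem: "\<And>B. B \<in> C \<Longrightarrow> subring_set B \<and> A \<subseteq> B \<and> inverse \<pi> \<notin> B"
      by (auto simp: subset_chain_def S0_def)
    have "subring_set (\<Union>C)"
      unfolding subring_set_def
    proof (intro conjI ballI)
      show "1 \<in> \<Union>C" using C(1) mem by (auto simp: subring_set_def)
      fix x y assume "x \<in> \<Union>C" "y \<in> \<Union>C"
      then obtain X1 Y where XY: "x \<in> X1" "X1 \<in> C" "y \<in> Y" "Y \<in> C" by blast
      hence "X1 \<subseteq> Y \<or> Y \<subseteq> X1" using C(2) by (auto simp: subset_chain_def)
      then obtain Z where "x \<in> Z" "y \<in> Z" "Z \<in> C" using XY by blast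
      thus "x - y \<in> \<Union>C" "x * y \<in> \<Union>C"
        using mem[of Z] by (auto simp: subring_set_def)
    qed
    thus "\<Union>C \<in> S0" using C(1) mem by (auto simp: S0_def)
  qed
  then obtain M where "M \<in> S0" and max0: "\<And>Y. Y \<in> S0 \<Longrightarrow> M \<subseteq> Y \<Longrightarrow> Y = M"
    by metis
  hence M: "subring_set M" "A \<subseteq> M" "inverse \<pi> \<notin> M" by (auto simp: S0_def)
  have max: "Y = M" if "subring_set Y" "inverse \<pi> \<notin> Y" "M \<subseteq> Y" for Y
    using that M(2) by (intro max0) (auto simp: S0_def)
  note M' = subring_setD[OF M(1)]
  have \<pi>: "\<pi> \<in> M" "\<pi> \<noteq> 0" using A M M'(2) by auto
  \<comment> \<open>Maximality: M[z] is strictly larger than M, so it contains the inverse of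
    \<pi>.\<close>
  have adj: "\<exists>p. (\<forall>i. coeff p i \<in> M) \<and> \<pi> * poly p z = 1" if z: "z \<notin> M" for z
  proof (rule ccontr)
    assume no: "\<not> ?thesis"
    let ?Y = "{poly p z |p. \<forall>i. coeff p i \<in> M}"
    have "inverse \<pi> \<notin> ?Y"
    proof
      assume "inverse \<pi> \<in> ?Y"
      then obtain p where "inverse \<pi> = poly p z" "\<forall>i. coeff p i \<in> M" by blast
      thus False using no \<pi> by (metis right_inverse)
    qed
    moreover have "M \<subseteq> ?Y"
    proof
      fix c assume "c \<in> M"
      thus "c \<in> ?Y" by (intro CollectI exI[of _ "[:c:]"]) (auto simp: coeff_pCons M' split: nat.splits)
    qed
    ultimately have "?Y = M" using max[of ?Y] subring_set_adjoin[OF M(1)] by blast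
    moreover have "z \<in> ?Y"
      by (intro CollectI exI[of _ "[:0, 1:]"]) (auto simp: coeff_pCons M' split: nat.splits)
    ultimately show False using z by blast
  qed
  \<comment> \<open>Otherwise inverse \<pi> is a polynomial in 1/w over M, where w = 1 - \<pi> c;
    multiplying by a power of w, which is 1 modulo \<pi>, puts inverse \<pi> itself into M.\<close>
  have unit: "inverse (1 - \<pi> * c) \<in> M" if c: "c \<in> M" for c
  proof (rule ccontr)
    define w where "w = 1 - \<pi> * c"
    assume "inverse (1 - \<pi> * c) \<notin> M"
    then obtain p where p: "\<forall>i. coeff p i \<in> M" "\<pi> * poly p (inverse w) = 1"
      using adj w_def by metis
    have "w \<in> M" unfolding w_def by (intro M' \<pi> c)
    have "w \<noteq> 0"
      using M(3) c \<pi> inverse_unique[of \<pi> c] unfolding w_def by auto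
    have "w ^ degree p * poly p (inverse w) = (\<Sum>i\<le>degree p. coeff p i * w ^ (degree p - i))"
      unfolding poly_altdef sum_distrib_left
      by (intro sum.cong) (auto simp: power_diff power_inverse field_simps \<open>w \<noteq> 0\<close>)
    also have "\<dots> \<in> M" using p \<open>w \<in> M\<close> by (intro subring_set_sum[OF M(1)] M') auto
    finally have 1: "w ^ degree p * poly p (inverse w) \<in> M" .
    have "\<exists>c'\<in>M. w ^ n = 1 - \<pi> * c'" for n
    proof (induction n)
      case (Suc n)
      then obtain c' where c': "c' \<in> M" "w ^ n = 1 - \<pi> * c'" by blast
      have "w ^ Suc n = 1 - \<pi> * (c + c' - \<pi> * c * c')"
        unfolding power_Suc c'(2) by (simp add: w_def algebra_simps)
      moreover have "c + c' - \<pi> * c * c' \<in> M" by (intro M' \<pi> c c')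
      ultimately show ?case by blast
    qed (auto intro: bexI[of _ 0] M')
    then obtain c' where c': "c' \<in> M" "w ^ degree p = 1 - \<pi> * c'" by blast
    have "poly p (inverse w) = inverse \<pi>"
      using p(2) by (metis inverse_unique)
    hence "w ^ degree p * poly p (inverse w) = (1 - \<pi> * c') * inverse \<pi>"
      using c' by simp
    also have "\<dots> = inverse \<pi> - c'"
      using \<pi> by (simp add: left_diff_distrib)
    finally have "w ^ degree p * poly p (inverse w) = inverse \<pi> - c'" .
    hence "inverse \<pi> - c' \<in> M" using 1 by simp
    hence "inverse \<pi> - c' + c' \<in> M" using c'(1) by (rule M'(6))
    thus False using M(3) by (metis diff_add_cancel)
  qed
  have "x \<in> M \<or> inverse x \<in> M" for x
  proof (rule ccontr)
    assume no: "\<not> ?thesis"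
    \<comment> \<open>Chevalley's argument: with x and 1/x both outside M, relations
      \<open>\<pi> * poly p z = 1\<close> of least degree for the two are compared, and the one of
      no larger degree serves to lower the degree of the other.\<close>
    define P where "P = (\<lambda>z p. (\<forall>i. coeff p i \<in> M) \<and> \<pi> * poly p z = 1)"
    define N where "N = (\<lambda>z. LEAST n. \<exists>p. P z p \<and> degree p = n)"
    have key: False if z: "z \<notin> M" "inverse z \<notin> M" "N (inverse z) \<le> N z" for z
    proof -
      have "z \<noteq> 0" using z M'(2) by auto
      have Nex: "\<exists>p. P y p \<and> degree p = N y" if y: "y \<notin> M" for y
        unfolding N_def by (rule LeastI_ex) (use adj[OF y] in \<open>auto simp: P_def\<close>)
      have Nmin: "N y \<le> degree p" if "P y p" for y p
        unfolding N_def by (rule Least_le) (use that in auto)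
      obtain p where p: "P z p" "degree p = N z" using Nex z by blast
      obtain r where r: "P (inverse z) r" "degree r = N (inverse z)" using Nex z by blast
      obtain c r' where cr: "r = pCons c r'" by (cases r)
      have cM: "c \<in> M" "\<forall>i. coeff r' i \<in> M"
      proof -
        have "coeff r 0 \<in> M" "\<And>i. coeff r (Suc i) \<in> M" using r(1) by (auto simp: P_def)
        thus "c \<in> M" "\<forall>i. coeff r' i \<in> M" by (auto simp: cr)
      qed
      define n where "n = degree p"
      have "n > 0"
      proof (rule ccontr)
        assume "\<not> n > 0"
        then obtain b where "p = [:b:]" by (auto simp: n_def elim: degree_eq_zeroE)
        hence "b = inverse \<pi>" "coeff p 0 = b" using p(1) by (auto simp: P_def intro: inverse_unique[symmetric])
        thus False using M(3) p(1) unfolding P_def by metis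
      qed
      have "degree r \<le> n" using p r z by (simp add: n_def)
      have "r' \<noteq> 0"
      proof
        assume "r' = 0"
        hence "c = inverse \<pi>" using r(1) by (auto simp: P_def cr intro: inverse_unique[symmetric])
        thus False using M(3) cM by simp
      qed
      hence degr': "degree r' < n" using \<open>degree r \<le> n\<close> by (simp add: cr)
      define e where "e = inverse (1 - \<pi> * c)"
      have e: "e \<in> M" unfolding e_def by (rule unit[OF cM(1)])
      have "1 - \<pi> * c \<noteq> 0" using M(3) cM inverse_unique[of \<pi> c] by auto
      have "\<pi> * (c + inverse z * poly r' (inverse z)) = 1" using r(1) by (simp add: P_def cr)
      hence "1 - \<pi> * c = \<pi> * inverse z * poly r' (inverse z)" by (simp add: algebra_simps)
      hence eq1: "e * (\<pi> * inverse z * poly r' (inverse z)) = 1"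
        unfolding e_def using \<open>1 - \<pi> * c \<noteq> 0\<close> by (metis left_inverse)
      define b where "b = lead_coeff p"
      have b: "b \<in> M" using p(1) by (simp add: P_def b_def)
      \<comment> \<open>The leading term b z^n of p is rewritten with \<open>eq1\<close>, which
        expresses 1 through negative powers of z; since the degree of r' is below n, no negative
        power remains.\<close>
      define p2 where "p2 = p - monom b n + (\<Sum>i\<le>degree r'. monom (\<pi> * b * e * coeff r' i) (n - 1 - i))"
      have c2: "\<forall>i. coeff p2 i \<in> M"
        unfolding p2_def coeff_add coeff_diff coeff_sum coeff_monom using p(1) b e cM \<pi>
        by (auto intro!: M' subring_set_sum[OF M(1)] simp: P_def)
      have "poly (\<Sum>i\<le>degree r'. monom (\<pi> * b * e * coeff r' i) (n - 1 - i)) z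
          = (\<Sum>i\<le>degree r'. (\<pi> * b * e * z ^ (n - 1)) * (coeff r' i * inverse z ^ i))"
        unfolding poly_sum poly_monom using degr'
        by (intro sum.cong) (auto simp: power_diff power_inverse \<open>z \<noteq> 0\<close> field_simps)
      also have "\<dots> = (\<pi> * b * e * z ^ (n - 1)) * poly r' (inverse z)"
        unfolding poly_altdef sum_distrib_left ..
      also have "\<dots> = b * z ^ n * (e * (\<pi> * inverse z * poly r' (inverse z)))"
        using \<open>n > 0\<close> \<open>z \<noteq> 0\<close> by (cases n) auto
      finally have "poly p2 z = poly p z"
        unfolding p2_def eq1 by (simp add: poly_monom)
      hence "P z p2" using p(1) c2 by (simp add: P_def)
      hence "n \<le> degree p2" using Nmin p by (simp add: n_def)
      moreover have "degree p2 < n"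
      proof -
        have "degree (p - monom b n) < n"
        proof -
          have "coeff (p - monom b n) i = 0" if "i \<ge> n" for i
            using that by (cases "i = n") (auto simp: b_def n_def coeff_eq_0)
          thus ?thesis using \<open>n > 0\<close> by (metis leading_coeff_0_iff not_le_imp_less degree_0)
        qed
        moreover have "degree (\<Sum>i\<le>degree r'. monom (\<pi> * b * e * coeff r' i) (n - 1 - i)) \<le> n - 1"
          by (intro degree_sum_le) (auto intro: order.trans[OF degree_monom_le])
        ultimately show ?thesis unfolding p2_def using \<open>n > 0\<close> by (intro degree_add_less) auto
      qed
      ultimately show False by simp
    qed
    show False
      using key[of x] key[of "inverse x"] no by (metis inverse_inverse_eq nle_le)
  qed
  thus ?thesis using that M by blast
qed

text \<open>A map h out of a domain, rather than an inclusion of fields, lets one extension theorem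
  start both from the integers inside \<open>Qbar\<close> and from polynomials in one variable
  evaluated at u.\<close>

locale valued_domain =
  fixes h :: "'r::idom \<Rightarrow> 'a::field" and w :: "'r \<Rightarrow> real"
  assumes h_one: "h 1 = 1"
    and h_add: "h (a + b) = h a + h b"
    and h_mult: "h (a * b) = h a * h b"
    and h_nonzero: "a \<noteq> 0 \<Longrightarrow> h a \<noteq> 0"
    and w_mult: "a \<noteq> 0 \<Longrightarrow> b \<noteq> 0 \<Longrightarrow> w (a * b) = w a + w b"
    and w_add: "a \<noteq> 0 \<Longrightarrow> b \<noteq> 0 \<Longrightarrow> a + b \<noteq> 0 \<Longrightarrow> min (w a) (w b) \<le> w (a + b)"
begin

lemma h_zero [simp]: "h 0 = 0"
  using h_add[of 0 0] add_left_cancel[of "h 0" "h 0" 0] by simp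

lemma h_uminus: "h (- a) = - h a"
  using h_add[of a "- a"] by (simp add: eq_neg_iff_add_eq_0 add.commute)

lemma h_eq_iff: "h a = h b \<longleftrightarrow> a = b"
  using h_nonzero[of "a - b"] h_add[of a "- b"] by (auto simp: h_uminus)

lemma w_one: "w 1 = 0"
  using w_mult[of 1 1] by simp

lemma w_uminus: "w (- a) = w a"
proof (cases "a = 0")
  case False
  have "w (- 1) = 0" using w_mult[of "- 1" "- 1"] w_one by simp
  thus ?thesis using w_mult[of "- 1" a] False by simp
qed auto

lemma w_power: "a \<noteq> 0 \<Longrightarrow> w (a ^ n) = n * w a"
  by (induction n) (auto simp: w_mult w_one algebra_simps)

lemma h_power: "h (a ^ n) = h a ^ n"
  by (induction n) (auto simp: h_one h_mult)

definition integers :: "'a set" where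
  "integers = {h a / h b |a b. b \<noteq> 0 \<and> (a \<noteq> 0 \<longrightarrow> w b \<le> w a)}"

lemma integersI: "b \<noteq> 0 \<Longrightarrow> (a \<noteq> 0 \<Longrightarrow> w b \<le> w a) \<Longrightarrow> h a / h b \<in> integers"
  by (auto simp: integers_def)

lemma integersD:
  assumes "h a / h b \<in> integers" "a \<noteq> 0" "b \<noteq> 0"
  shows "w b \<le> w a"
proof -
  obtain c d where cd: "h a / h b = h c / h d" "d \<noteq> 0" "c \<noteq> 0 \<longrightarrow> w d \<le> w c"
    using assms(1) by (auto simp: integers_def)
  hence "h (a * d) = h (c * b)" using assms h_nonzero by (simp add: h_mult field_simps)
  hence eq: "a * d = c * b" by (simp only: h_eq_iff)
  hence "c \<noteq> 0" using assms cd by auto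
  have "w a + w d = w c + w b"
    using eq assms cd \<open>c \<noteq> 0\<close> by (metis w_mult)
  thus ?thesis using cd \<open>c \<noteq> 0\<close> by simp
qed

lemma subring_integers: "subring_set integers"
  unfolding subring_set_def
proof (intro conjI ballI)
  show "1 \<in> integers" using integersI[of 1 1] by (simp add: h_one)
  fix x y assume "x \<in> integers" "y \<in> integers"
  then obtain a b c d where x: "x = h a / h b" "b \<noteq> 0" "a \<noteq> 0 \<longrightarrow> w b \<le> w a"
    and y: "y = h c / h d" "d \<noteq> 0" "c \<noteq> 0 \<longrightarrow> w d \<le> w c"
    by (auto simp: integers_def)
  have "x * y = h (a * c) / h (b * d)" using x y by (simp add: h_mult)
  moreover have "h (a * c) / h (b * d) \<in> integers"
    using x y by (intro integersI) (auto simp: w_mult)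
  ultimately show "x * y \<in> integers" by simp
  have "x - y = h (a * d + - (c * b)) / h (b * d)"
    unfolding h_mult h_add h_uminus x(1) y(1) using h_nonzero[OF x(2)] h_nonzero[OF y(2)]
    by (simp add: field_simps)
  moreover have "h (a * d + - (c * b)) / h (b * d) \<in> integers"
  proof (rule integersI)
    show "b * d \<noteq> 0" using x y by simp
    assume nz: "a * d + - (c * b) \<noteq> 0"
    have 1: "a * d \<noteq> 0 \<Longrightarrow> w (b * d) \<le> w (a * d)" using x y by (auto simp: w_mult)
    have 2: "- (c * b) \<noteq> 0 \<Longrightarrow> w (b * d) \<le> w (- (c * b))" using x y by (auto simp: w_mult w_uminus)
    show "w (b * d) \<le> w (a * d + - (c * b))"
    proof (cases "a * d = 0 \<or> c * b = 0")
      case True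
      thus ?thesis using 1 2 nz by (metis add.left_neutral add.right_neutral neg_equal_0_iff_equal)
    next
      case False
      thus ?thesis using 1 2 w_add[of "a * d" "- (c * b)"] nz by auto
    qed
  qed
  ultimately show "x - y \<in> integers" by simp
qed

text \<open>The valuation ring supplied by \<open>exists_valuation_ring\<close> meets the fraction
  field exactly in \<open>integers\<close>. By algebraicity some positive power of each x \<noteq> 0
  equals a fraction up to a unit, and the value of that fraction divided by the exponent becomes the
  value of x; so the extension is again real-valued.\<close>

theorem valuation_extension:
  assumes alg: "\<And>x. \<exists>p. p \<noteq> 0 \<and> (\<Sum>i\<le>degree p. h (coeff p i) * x ^ i) = 0"
    and nontriv: "a0 \<noteq> 0" "w a0 \<noteq> 0"
  obtains v where "valuation v" "\<And>a. a \<noteq> 0 \<Longrightarrow> v (h a) = w a"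
proof -
  define \<pi> where "\<pi> = (if w a0 > 0 then h a0 / h 1 else h 1 / h a0)"
  have "\<pi> \<in> integers"
    unfolding \<pi>_def using nontriv by (auto intro!: integersI simp: w_one)
  moreover have "inverse \<pi> \<notin> integers"
    using integersD[of 1 a0] integersD[of a0 1] nontriv by (auto simp: \<pi>_def w_one)
  ultimately obtain M where M: "subring_set M" "integers \<subseteq> M" "inverse \<pi> \<notin> M"
    "\<And>x. x \<in> M \<or> inverse x \<in> M"
    using exists_valuation_ring[OF subring_integers] by blast
  note M' = subring_setD[OF M(1)]
  define U where "U = {x. x \<noteq> 0 \<and> x \<in> M \<and> inverse x \<in> M}"
  have U_mult: "x * y \<in> U" if "x \<in> U" "y \<in> U" for x y
    using that M' by (auto simp: U_def)
  have U_inv: "inverse x \<in> U" if "x \<in> U" for x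
    using that by (auto simp: U_def)
  have U_pow: "x ^ n \<in> U" if "x \<in> U" for x n
    using that M'(7)[of x n] M'(7)[of "inverse x" n] by (simp add: U_def power_inverse)
  \<comment> \<open>Archimedean argument: if c/d had negative value but lay in M, a high power of
    d/c would absorb inverse \<pi> into \<open>integers\<close>; cancelling with the same power of
    c/d puts inverse \<pi> into M.\<close>
  have U_le: "w d \<le> w c" if cd: "h c / h d \<in> M" "c \<noteq> 0" "d \<noteq> 0" for c d
  proof (rule ccontr)
    assume "\<not> ?thesis"
    hence pos: "w d - w c > 0" by simp
    define e where "e = \<bar>w a0\<bar>"
    obtain n where n: "e < of_nat n * (w d - w c)" using ex_less_of_nat_mult[OF pos] by blast
    have "inverse \<pi> * (h d / h c) ^ n \<in> integers"
    proof (cases "w a0 > 0")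
      case True
      have "inverse \<pi> * (h d / h c) ^ n = h (d ^ n) / h (a0 * c ^ n)"
        using True by (simp add: \<pi>_def h_power h_mult h_one power_mult_distrib power_inverse divide_inverse mult_ac)
      also have "\<dots> \<in> integers"
        using n cd nontriv by (intro integersI) (auto simp: w_mult w_power e_def algebra_simps)
      finally show ?thesis .
    next
      case False
      have "inverse \<pi> * (h d / h c) ^ n = h (a0 * d ^ n) / h (c ^ n)"
        using False by (simp add: \<pi>_def h_power h_mult h_one power_mult_distrib power_inverse divide_inverse mult_ac)
      also have "\<dots> \<in> integers"
        using n cd nontriv by (intro integersI) (auto simp: w_mult w_power e_def algebra_simps)
      finally show ?thesis .
    qed
    hence "inverse \<pi> * (h d / h c) ^ n * (h c / h d) ^ n \<in> M"
      using M(2) cd M'(4)[of "inverse \<pi> * (h d / h c) ^ n"] M'(7)[of "h c / h d" n] by blast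
    moreover have "inverse \<pi> * (h d / h c) ^ n * (h c / h d) ^ n = inverse \<pi>"
      using cd h_nonzero by (simp add: mult.assoc flip: power_mult_distrib)
    ultimately show False using M(3) by simp
  qed
  have U_eq: "w c = w d" if "h c / h d \<in> U" "c \<noteq> 0" "d \<noteq> 0" for c d
    using U_le[of c d] U_le[of d c] that by (auto simp: U_def)
  \<comment> \<open>M is local: of two nonzero summands one divides the other in M, so a unit sum
    would turn the divisor into a unit.\<close>
  have nonunit_sum: "sum g I \<notin> U" if "finite I" "\<And>i. i \<in> I \<Longrightarrow> g i \<in> M - U" for g and I :: "nat set"
    using that
  proof (induction I)
    case (insert i I)
    let ?x = "g i" and ?y = "sum g I"
    have x: "?x \<in> M" "?x \<notin> U" "?y \<in> M" "?y \<notin> U"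
      using insert by (auto intro!: subring_set_sum[OF M(1)])
    have key: "a + b \<notin> U" if ab: "a \<in> M" "a \<notin> U" "a \<noteq> 0" "b / a \<in> M" for a b
    proof
      assume u: "a + b \<in> U"
      have "inverse a = (1 + b / a) * inverse (a + b)"
        using u ab by (simp add: U_def field_simps)
      hence "inverse a \<in> M" using u ab by (auto simp: U_def intro!: M')
      thus False using ab by (simp add: U_def)
    qed
    show ?case
    proof (cases "?x = 0 \<or> ?y = 0")
      case True
      thus ?thesis using x insert by auto
    next
      case False
      have "?y / ?x \<in> M \<or> ?x / ?y \<in> M" using M(4)[of "?y / ?x"] by auto
      thus ?thesis using key[of ?x ?y] key[of ?y ?x] x insert False by (auto simp: add.commute)
    qed
  qed (simp add: U_def)
  \<comment> \<open>In a polynomial relation for x, divide by a term that divides all others in M.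
    The remaining quotients add up to -1, so one of them is a unit and relates two powers of
    x.\<close>
  have val: "\<exists>m a b. m > 0 \<and> a \<noteq> 0 \<and> b \<noteq> 0 \<and> x ^ m * (h a / h b) \<in> U" if x: "x \<noteq> 0" for x
  proof -
    obtain p where p: "p \<noteq> 0" "(\<Sum>i\<le>degree p. h (coeff p i) * x ^ i) = 0" using alg by blast
    define g where "g = (\<lambda>i. h (coeff p i) * x ^ i)"
    define I where "I = {i. i \<le> degree p \<and> coeff p i \<noteq> 0}"
    have I: "finite I" "I \<noteq> {}" using p by (auto simp: I_def)
    have gnz: "g i \<noteq> 0" if "i \<in> I" for i using that x h_nonzero by (auto simp: g_def I_def)
    have sum0: "sum g I = 0"
    proof -
      have "sum g I = sum g {..degree p}"
        by (intro sum.mono_neutral_left) (auto simp: I_def g_def)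
      thus ?thesis using p(2) by (simp add: g_def)
    qed
    have max: "\<exists>i\<in>J. \<forall>j\<in>J. g j / g i \<in> M" if "finite J" "J \<noteq> {}" "J \<subseteq> I" for J
      using that
    proof (induction J rule: finite_ne_induct)
      case (singleton i)
      thus ?case using gnz M'(1) by auto
    next
      case (insert k J)
      then obtain i where i: "i \<in> J" "\<forall>j\<in>J. g j / g i \<in> M" by auto
      have nz: "g k \<noteq> 0" "g i \<noteq> 0" using insert i gnz by auto
      show ?case
      proof (cases "g k / g i \<in> M")
        case True
        thus ?thesis using i by auto
      next
        case False
        hence ik: "g i / g k \<in> M" using M(4)[of "g k / g i"] by auto
        have "g j / g k \<in> M" if "j \<in> J" for j
        proof -
          have "g j / g k = (g j / g i) * (g i / g k)" using nz by simp
          moreover have "(g j / g i) * (g i / g k) \<in> M"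
            using i that by (intro M'(4) ik) auto
          ultimately show ?thesis by metis
        qed
        thus ?thesis using nz M'(1) by auto
      qed
    qed
    obtain i where i: "i \<in> I" "\<forall>j\<in>I. g j / g i \<in> M" using max[OF I] by blast
    have "(\<Sum>j\<in>I. g j / g i) = 0" using sum0 by (simp flip: sum_divide_distrib)
    hence "(\<Sum>j\<in>I - {i}. g j / g i) = - 1"
      using I(1) i gnz by (simp add: sum.remove[of I i] eq_neg_iff_add_eq_0 add.commute)
    moreover have "- 1 \<in> U" using M' by (auto simp: U_def)
    ultimately obtain j where j: "j \<in> I" "j \<noteq> i" "g j / g i \<in> U"
      using nonunit_sum[of "I - {i}" "\<lambda>j. g j / g i"] I(1) i by fastforce
    show ?thesis
    proof (cases "i < j")
      case True
      have "g j / g i = x ^ (j - i) * (h (coeff p j) / h (coeff p i))"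
        using True x by (simp add: g_def power_diff mult.commute)
      thus ?thesis using j i True by (auto simp: I_def intro!: exI[of _ "j - i"])
    next
      case False
      have "inverse (g j / g i) = x ^ (i - j) * (h (coeff p i) / h (coeff p j))"
        using False x by (simp add: g_def power_diff mult.commute)
      thus ?thesis using j i False U_inv[OF j(3)]
        by (auto simp: I_def intro!: exI[of _ "i - j"])
    qed
  qed
  define R where "R = (\<lambda>x r. \<exists>m a b. m > 0 \<and> a \<noteq> 0 \<and> b \<noteq> 0 \<and> x ^ m * (h a / h b) \<in> U \<and> r = (w b - w a) / real m)"
  define v where "v = (\<lambda>x. SOME r. R x r)"
  have R_unique: "r = s" if rs: "R x r" "R x s" "x \<noteq> 0" for x r s
  proof -
    obtain m a b where 1: "m > 0" "a \<noteq> 0" "b \<noteq> 0" "x ^ m * (h a / h b) \<in> U" "r = (w b - w a) / real m"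
      using rs(1) unfolding R_def by blast
    obtain n c d where 2: "n > 0" "c \<noteq> 0" "d \<noteq> 0" "x ^ n * (h c / h d) \<in> U" "s = (w d - w c) / real n"
      using rs(2) unfolding R_def by blast
    have "(x ^ m * (h a / h b)) ^ n * inverse ((x ^ n * (h c / h d)) ^ m) \<in> U"
      by (rule U_mult[OF U_pow[OF 1(4)] U_inv[OF U_pow[OF 2(4)]]])
    moreover have "(x ^ m * (h a / h b)) ^ n * inverse ((x ^ n * (h c / h d)) ^ m)
        = h (a ^ n * d ^ m) / h (b ^ n * c ^ m)"
    proof -
      have e1: "(x ^ m * (h a / h b)) ^ n = x ^ (m * n) * (h a ^ n / h b ^ n)"
        by (simp only: power_mult_distrib power_divide power_mult)
      have e2: "(x ^ n * (h c / h d)) ^ m = x ^ (m * n) * (h c ^ m / h d ^ m)"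
        by (simp only: power_mult_distrib power_divide mult.commute[of m n] power_mult)
      show ?thesis
        unfolding e1 e2 h_mult h_power using rs(3) 1 2 h_nonzero by simp
    qed
    ultimately have "w (a ^ n * d ^ m) = w (b ^ n * c ^ m)"
      using 1 2 by (intro U_eq) auto
    hence "real n * w a + real m * w d = real n * w b + real m * w c"
      using 1 2 by (simp add: w_mult w_power)
    thus ?thesis unfolding 1(5) 2(5) using 1(1) 2(1) by (simp add: frac_eq_eq algebra_simps)
  qed
  have vR: "R x (v x)" if "x \<noteq> 0" for x
    unfolding v_def by (rule someI_ex) (use val[OF that] in \<open>unfold R_def, blast\<close>)
  have vI: "v x = r" if "R x r" "x \<noteq> 0" for x r
    using R_unique vR that by blast
  have v_h: "v (h a) = w a" if "a \<noteq> 0" for a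
  proof (rule vI)
    show "R (h a) (w a)"
      unfolding R_def using that h_nonzero M'
      by (intro exI[of _ 1] exI[of _ 1] exI[of _ a]) (auto simp: h_one w_one U_def)
  qed (use that h_nonzero in auto)
  have v_mult: "v (x * y) = v x + v y" if xy: "x \<noteq> 0" "y \<noteq> 0" for x y
  proof (rule vI)
    obtain m a b where 1: "m > 0" "a \<noteq> 0" "b \<noteq> 0" "x ^ m * (h a / h b) \<in> U" "v x = (w b - w a) / real m"
      using vR[OF xy(1)] unfolding R_def by blast
    obtain n c d where 2: "n > 0" "c \<noteq> 0" "d \<noteq> 0" "y ^ n * (h c / h d) \<in> U" "v y = (w d - w c) / real n"
      using vR[OF xy(2)] unfolding R_def by blast
    have "(x ^ m * (h a / h b)) ^ n * (y ^ n * (h c / h d)) ^ m \<in> U"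
      by (rule U_mult[OF U_pow[OF 1(4)] U_pow[OF 2(4)]])
    moreover have "(x ^ m * (h a / h b)) ^ n * (y ^ n * (h c / h d)) ^ m
        = (x * y) ^ (m * n) * (h (a ^ n * c ^ m) / h (b ^ n * d ^ m))"
    proof -
      have e1: "(x ^ m * (h a / h b)) ^ n = x ^ (m * n) * (h a ^ n / h b ^ n)"
        by (simp only: power_mult_distrib power_divide power_mult)
      have e2: "(y ^ n * (h c / h d)) ^ m = y ^ (m * n) * (h c ^ m / h d ^ m)"
        by (simp only: power_mult_distrib power_divide mult.commute[of m n] power_mult)
      show ?thesis
        unfolding e1 e2 by (simp add: h_mult h_power power_mult_distrib mult_ac)
    qed
    moreover have "v x + v y = (w (b ^ n * d ^ m) - w (a ^ n * c ^ m)) / real (m * n)"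
      unfolding 1(5) 2(5) using 1(1-3) 2(1-3) by (simp add: w_mult w_power add_frac_eq algebra_simps)
    ultimately show "R (x * y) (v x + v y)"
      unfolding R_def using 1 2
      by (intro exI[of _ "m * n"] exI[of _ "a ^ n * c ^ m"] exI[of _ "b ^ n * d ^ m"]) auto
  qed (use that in auto)
  \<comment> \<open>Identifying nonnegative values with membership in M turns the ultrametric
    inequality into closure of M under adding 1.\<close>
  have v_ge0: "v x \<ge> 0 \<longleftrightarrow> x \<in> M" if x: "x \<noteq> 0" for x
  proof -
    obtain m a b where 1: "m > 0" "a \<noteq> 0" "b \<noteq> 0" "x ^ m * (h a / h b) \<in> U" "v x = (w b - w a) / real m"
      using vR[OF x] unfolding R_def by blast
    have nz: "h a \<noteq> 0" "h b \<noteq> 0" using 1 h_nonzero by auto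
    have iff: "v x \<ge> 0 \<longleftrightarrow> w a \<le> w b"
      unfolding 1(5) using 1(1) by (simp add: zero_le_divide_iff)
    have "x \<in> M" if le: "w a \<le> w b"
    proof (rule ccontr)
      assume xM: "x \<notin> M"
      hence inv: "inverse x \<in> M" using M(4) by blast
      have "h b / h a \<in> M" using le 1 M(2) integersI[of a b] by blast
      moreover have "x ^ m * (h a / h b) \<in> M" using 1(4) by (simp add: U_def)
      ultimately have "x ^ m * (h a / h b) * (h b / h a) \<in> M" by (rule M'(4)[rotated])
      hence "x ^ m \<in> M" using nz by simp
      hence "x ^ m * inverse x ^ (m - 1) \<in> M" by (rule M'(4)[OF _ M'(7)[OF inv]])
      moreover have "x ^ m * inverse x ^ (m - 1) = x"
        using \<open>x \<noteq> 0\<close> 1 by (cases m) (auto simp: power_inverse field_simps)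
      ultimately show False using xM by simp
    qed
    moreover have "w a \<le> w b" if xM: "x \<in> M"
    proof -
      have "x ^ m * inverse (x ^ m * (h a / h b)) \<in> M"
        using 1(4) by (intro M'(4)[OF M'(7)[OF xM]]) (simp add: U_def)
      moreover have "x ^ m * inverse (x ^ m * (h a / h b)) = h b / h a" using nz \<open>x \<noteq> 0\<close> by simp
      ultimately show ?thesis using U_le[of b a] 1 by simp
    qed
    ultimately show ?thesis using iff by blast
  qed
  have "valuation v"
  proof
    show "v (x * y) = v x + v y" if "x \<noteq> 0" "y \<noteq> 0" for x y using v_mult that .
    fix x y :: 'a assume xy: "x \<noteq> 0" "y \<noteq> 0" "x + y \<noteq> 0"
    have *: "v a \<le> v (a + b)" if ab: "a \<noteq> 0" "b \<noteq> 0" "a + b \<noteq> 0" "v a \<le> v b" for a b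
    proof -
      have "v b = v a + v (b / a)" using v_mult[of a "b / a"] ab by simp
      hence "b / a \<in> M" using v_ge0[of "b / a"] ab by simp
      hence "1 + b / a \<in> M" by (intro M')
      moreover have "1 + b / a \<noteq> 0" using ab by (simp add: field_simps)
      ultimately have "v (1 + b / a) \<ge> 0" using v_ge0 by blast
      moreover have "v (a + b) = v a + v (1 + b / a)"
      proof -
        have "a * (1 + b / a) = a + b" using ab by (simp add: distrib_left)
        thus ?thesis using v_mult[of a "1 + b / a"] \<open>1 + b / a \<noteq> 0\<close> ab by simp
      qed
      ultimately show ?thesis by simp
    qed
    show "min (v x) (v y) \<le> v (x + y)"
      using *[of x y] *[of y x] xy by (cases "v x \<le> v y") (auto simp: add.commute)
  qed
  thus ?thesis using that v_h by blast
qed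

end

section \<open>Valuations on algebraic extensions of a rational function field\<close>

text \<open>The multiplicity of p is extended directly from the integers, so rational polynomial
  relations are cleared of denominators. Values are rational because two terms of such a relation
  have equal value.\<close>

lemma padic_valuation_alg_closure_rat:
  assumes p: "prime (p::nat)"
  obtains v where "valuation (v :: Qbar \<Rightarrow> real)" "v (of_nat p) = 1" "\<And>x. x \<noteq> 0 \<Longrightarrow> v x \<in> \<rat>"
proof -
  have p': "prime (int p)" using p by simp
  interpret valued_domain "of_int :: int \<Rightarrow> Qbar" "\<lambda>n. real (multiplicity (int p) n)"
  proof
    fix a b :: int
    show "real (multiplicity (int p) (a * b)) = real (multiplicity (int p) a) + real (multiplicity (int p) b)"
      if "a \<noteq> 0" "b \<noteq> 0" using that p' by (simp add: prime_elem_multiplicity_mult_distrib)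
    show "min (real (multiplicity (int p) a)) (real (multiplicity (int p) b)) \<le> real (multiplicity (int p) (a + b))"
      if "a \<noteq> 0" "b \<noteq> 0" "a + b \<noteq> 0"
    proof -
      define m where "m = min (multiplicity (int p) a) (multiplicity (int p) b)"
      have "int p ^ m dvd a" "int p ^ m dvd b"
        by (rule multiplicity_dvd', simp add: m_def)+
      hence "int p ^ m dvd a + b" by simp
      hence "m \<le> multiplicity (int p) (a + b)"
        using that p' by (intro multiplicity_geI) (auto dest: prime_gt_1_int)
      thus ?thesis by (simp add: m_def min_def split: if_splits)
    qed
  qed auto
  have alg: "\<exists>c. c \<noteq> 0 \<and> (\<Sum>i\<le>degree c. of_int (coeff c i) * x ^ i) = 0" for x :: Qbar
  proof -
    obtain P :: "rat poly" where P: "P \<noteq> 0" "poly (map_poly to_ac P) x = 0"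
      by (rule alg_closure_algebraic)
    have "\<exists>d c. d \<noteq> 0 \<and> smult (of_int d) Q = map_poly rat_of_int c" for Q :: "rat poly"
    proof (induction Q)
      case 0
      show ?case by (intro exI[of _ 1] exI[of _ 0]) auto
    next
      case (pCons a Q)
      then obtain d c where dc: "d \<noteq> 0" "smult (of_int d) Q = map_poly rat_of_int c" by blast
      obtain m n where mn: "quotient_of a = (m, n)" by force
      have n: "n > 0" "a = of_int m / of_int n"
        using quotient_of_denom_pos[OF mn] quotient_of_div[OF mn] by auto
      have "smult (of_int (n * d)) (pCons a Q) = pCons (of_int (m * d)) (smult (of_int n) (smult (of_int d) Q))"
        using n by simp
      also have "\<dots> = map_poly rat_of_int (pCons (m * d) (smult n c))"
        unfolding dc(2) by (simp add: map_poly_pCons map_poly_smult)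
      finally show ?case using n dc by (intro exI[of _ "n * d"] exI[of _ "pCons (m * d) (smult n c)"]) auto
    qed
    then obtain d c where dc: "d \<noteq> 0" "smult (of_int d) P = map_poly rat_of_int c" by blast
    have "c \<noteq> 0" using dc P by auto
    have coeff: "of_int (coeff c i) = of_int d * coeff P i" for i
      using arg_cong[OF dc(2), of "\<lambda>p. coeff p i"] by (simp add: coeff_map_poly)
    have deg: "degree c = degree P"
    proof -
      have "degree (map_poly rat_of_int c) = degree c" by (rule degree_map_poly) simp
      thus ?thesis using dc(1) by (simp flip: dc(2))
    qed
    have "to_ac (of_int (coeff c i)) = to_ac (of_int d * coeff P i)" for i
      by (simp only: coeff)
    hence "(\<Sum>i\<le>degree c. of_int (coeff c i) * x ^ i) = of_int d * poly (map_poly to_ac P) x"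
      by (simp add: poly_altdef deg sum_distrib_left coeff_map_poly degree_map_poly mult.assoc)
    thus ?thesis using \<open>c \<noteq> 0\<close> P by auto
  qed
  obtain v where v: "valuation v" "\<And>a. a \<noteq> 0 \<Longrightarrow> v (of_int a :: Qbar) = real (multiplicity (int p) a)"
  proof (rule valuation_extension[OF alg, of "int p"])
    show "int p \<noteq> 0" "real (multiplicity (int p) (int p)) \<noteq> 0"
      using p' by (auto simp: multiplicity_prime)
  qed blast
  interpret valuation v by (rule v(1))
  have "v x \<in> \<rat>" if x: "x \<noteq> 0" for x
  proof -
    obtain c where c: "c \<noteq> 0" "(\<Sum>i\<le>degree c. of_int (coeff c i) * x ^ i) = 0" using alg by blast
    obtain i j where ij: "i \<noteq> j" "coeff c i \<noteq> 0" "coeff c j \<noteq> 0"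
      "v (of_int (coeff c i) * x ^ i) = v (of_int (coeff c j) * x ^ j)"
      by (rule sum_eq_0_imp_equal_values[of "{..degree c}" "degree c" "\<lambda>i. of_int (coeff c i) * x ^ i"])
        (use c x in auto)
    have "v (of_int (coeff c i)) + i * v x = v (of_int (coeff c j)) + j * v x"
      using ij x by (simp add: v_mult v_power)
    hence "v x = (v (of_int (coeff c j)) - v (of_int (coeff c i))) / (real i - real j)"
      using ij(1) by (simp add: field_simps)
    thus ?thesis using ij v(2) by simp
  qed
  moreover have "v (of_nat p) = 1"
    using v(2)[of "int p"] p' by (simp add: multiplicity_prime prime_gt_0_nat[OF p] not_prime_0)
  ultimately show ?thesis using that v(1) by blast
qed

text \<open>\<open>u_notin_range\<close> expresses transcendence: the constants are algebraically
  closed, so every polynomial splits into linear factors, none of which vanishes at u.\<close>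

locale transcendental_element =
  fixes \<kappa> :: "'k::{alg_closed_field,field_char_0} \<Rightarrow> 'a::alg_closed_field" and u :: 'a
  assumes \<kappa>_one [simp]: "\<kappa> 1 = 1"
    and \<kappa>_add: "\<kappa> (a + b) = \<kappa> a + \<kappa> b"
    and \<kappa>_mult: "\<kappa> (a * b) = \<kappa> a * \<kappa> b"
    and u_notin_range: "u \<notin> range \<kappa>"
begin

lemma \<kappa>_zero [simp]: "\<kappa> 0 = 0"
  using \<kappa>_add[of 0 0] add_left_cancel[of "\<kappa> 0" "\<kappa> 0" 0] by simp

lemma \<kappa>_uminus: "\<kappa> (- a) = - \<kappa> a"
  using \<kappa>_add[of a "- a"] by (simp add: eq_neg_iff_add_eq_0 add.commute)

lemma \<kappa>_diff: "\<kappa> (a - b) = \<kappa> a - \<kappa> b"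
  using \<kappa>_add[of a "- b"] by (simp add: \<kappa>_uminus)

lemma \<kappa>_nonzero: "a \<noteq> 0 \<Longrightarrow> \<kappa> a \<noteq> 0"
  using \<kappa>_mult[of a "inverse a"] by auto

lemma \<kappa>_eq_0_iff [simp]: "\<kappa> a = 0 \<longleftrightarrow> a = 0"
  using \<kappa>_nonzero by auto

lemma \<kappa>_inj: "\<kappa> a = \<kappa> b \<longleftrightarrow> a = b"
  using \<kappa>_nonzero[of "a - b"] by (auto simp: \<kappa>_diff)

lemma \<kappa>_inverse: "\<kappa> (inverse a) = inverse (\<kappa> a)"
proof (cases "a = 0")
  case False
  hence "\<kappa> a * \<kappa> (inverse a) = 1" by (simp flip: \<kappa>_mult)
  thus ?thesis by (simp add: inverse_unique)
qed auto

lemma \<kappa>_divide: "\<kappa> (a / b) = \<kappa> a / \<kappa> b"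
  by (simp add: divide_inverse \<kappa>_mult \<kappa>_inverse)

lemma \<kappa>_power: "\<kappa> (a ^ n) = \<kappa> a ^ n"
  by (induction n) (auto simp: \<kappa>_mult)

lemma \<kappa>_of_nat: "\<kappa> (of_nat n) = of_nat n"
  by (induction n) (auto simp: \<kappa>_add)

lemma of_nat_nonzero: "n > 0 \<Longrightarrow> of_nat n \<noteq> (0 :: 'a)"
  using \<kappa>_nonzero[of "of_nat n"] by (simp add: \<kappa>_of_nat)

definition ev_at :: "'k poly \<Rightarrow> 'a \<Rightarrow> 'a" where
  "ev_at F x = poly (map_poly \<kappa> F) x"

lemma ev_at_simps [simp]: "ev_at 0 x = 0" "ev_at (pCons a F) x = \<kappa> a + x * ev_at F x"
  by (auto simp: ev_at_def map_poly_pCons)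

lemma ev_at_1 [simp]: "ev_at 1 x = 1"
  by (simp add: one_pCons)

lemma ev_at_add: "ev_at (F + G) x = ev_at F x + ev_at G x"
  by (induction F G rule: poly_induct2) (auto simp: \<kappa>_add algebra_simps)

lemma ev_at_smult: "ev_at (smult c F) x = \<kappa> c * ev_at F x"
  by (induction F) (auto simp: \<kappa>_mult algebra_simps)

lemma ev_at_mult: "ev_at (F * G) x = ev_at F x * ev_at G x"
  by (induction F) (auto simp: ev_at_add ev_at_smult algebra_simps)

lemma ev_at_altdef: "ev_at F x = (\<Sum>i\<le>degree F. \<kappa> (coeff F i) * x ^ i)"
  by (simp add: ev_at_def poly_altdef degree_map_poly coeff_map_poly)

lemma ev_at_eq_prod:
  assumes "F \<noteq> 0"
  shows "ev_at F x = \<kappa> (lead_coeff F) * (\<Prod>c\<in>#proots F. x - \<kappa> c)"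
proof -
  have "ev_at (\<Prod>c\<in>#A. [:-c, 1:]) x = (\<Prod>c\<in>#A. x - \<kappa> c)" for A
  proof (induction A)
    case (add c A)
    have "ev_at ([:-c, 1:] * (\<Prod>c\<in>#A. [:-c, 1:])) x = (x - \<kappa> c) * (\<Prod>c\<in>#A. x - \<kappa> c)"
      by (subst ev_at_mult) (simp add: add \<kappa>_uminus)
    thus ?case by (simp only: image_mset_add_mset prod_mset.add_mset)
  qed simp
  thus ?thesis
    using arg_cong[OF proots_factorization[OF assms], of "\<lambda>F. ev_at F x"] by (simp only: ev_at_smult)
qed

lemma ev_at_eq_0D:
  assumes "F \<noteq> 0" "ev_at F x = 0"
  shows "x \<in> range \<kappa>"
  using assms by (auto simp: ev_at_eq_prod prod_mset_zero_iff)

abbreviation ev :: "'k poly \<Rightarrow> 'a" where "ev F \<equiv> ev_at F u"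

lemma ev_nonzero: "F \<noteq> 0 \<Longrightarrow> ev F \<noteq> 0"
  using ev_at_eq_0D u_notin_range by blast

definition ratfield :: "'a set" where
  "ratfield = {ev F / ev G |F G. G \<noteq> 0}"

lemma ratfieldI: "G \<noteq> 0 \<Longrightarrow> ev F / ev G \<in> ratfield"
  by (auto simp: ratfield_def)

lemma ev_in_ratfield: "ev F \<in> ratfield"
  using ratfieldI[of 1 F] by simp

lemma \<kappa>_in_ratfield: "\<kappa> c \<in> ratfield"
  using ev_in_ratfield[of "[:c:]"] by simp

lemma u_in_ratfield: "u \<in> ratfield"
  using ev_in_ratfield[of "[:0, 1:]"] by simp

sublocale E: infinite_subfield ratfield
proof
  show "1 \<in> ratfield" using \<kappa>_in_ratfield[of 1] by simp
  fix x y assume "x \<in> ratfield" "y \<in> ratfield"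
  then obtain F G F' G' where x: "x = ev F / ev G" "G \<noteq> 0" and y: "y = ev F' / ev G'" "G' \<noteq> 0"
    by (auto simp: ratfield_def)
  note nz = ev_nonzero[OF x(2)] ev_nonzero[OF y(2)]
  have "x * y = ev (F * F') / ev (G * G')" using x y by (simp add: ev_at_mult)
  thus "x * y \<in> ratfield" using x y ratfieldI[of "G * G'"] by simp
  have "x - y = ev (F * G' + smult (- 1) (F' * G)) / ev (G * G')"
    unfolding x(1) y(1) ev_at_mult ev_at_add ev_at_smult using nz
    by (simp add: \<kappa>_uminus field_simps)
  thus "x - y \<in> ratfield" using x y ratfieldI[of "G * G'"] by simp
  show "inverse x \<in> ratfield"
  proof (cases "F = 0")
    case True
    thus ?thesis using x \<kappa>_in_ratfield[of 0] by simp
  next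
    case False
    thus ?thesis using x ratfieldI[of F G] by simp
  qed
next
  have "infinite (range \<kappa>)"
    using range_inj_infinite[of "\<lambda>n::nat. \<kappa> (of_nat n)"] \<kappa>_inj
    by (metis (no_types, lifting) injI of_nat_eq_iff finite_subset image_subsetI rangeI)
  thus "infinite ratfield" using \<kappa>_in_ratfield by (meson finite_subset image_subsetI)
qed

lemma clear_denominators:
  assumes "poly_over ratfield P"
  shows "\<exists>g C. g \<noteq> 0 \<and> smult (ev g) P = map_poly ev C"
  using assms
proof (induction P)
  case 0
  show ?case by (intro exI[of _ 1] exI[of _ 0]) auto
next
  case (pCons a P)
  have "coeff (pCons a P) 0 \<in> ratfield" "\<And>i. coeff (pCons a P) (Suc i) \<in> ratfield"
    using pCons.prems by (auto simp only: poly_over_def)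
  hence a: "a \<in> ratfield" and P: "poly_over ratfield P" by (auto simp: poly_over_def)
  obtain g C where gC: "g \<noteq> 0" "smult (ev g) P = map_poly ev C" using pCons.IH[OF P] by blast
  obtain F G where FG: "a = ev F / ev G" "G \<noteq> 0" using a by (auto simp: ratfield_def)
  have "smult (ev (G * g)) (pCons a P) = pCons (ev (F * g)) (smult (ev G) (smult (ev g) P))"
    using FG ev_nonzero by (simp add: ev_at_mult)
  also have "\<dots> = map_poly ev (pCons (F * g) (smult G C))"
    unfolding gC(2) by (simp add: map_poly_pCons map_poly_smult ev_at_mult)
  finally show ?case using gC FG by (intro exI[of _ "G * g"] exI[of _ "pCons (F * g) (smult G C)"]) auto
qed

definition algebraic_over :: "'a \<Rightarrow> bool" where
  "algebraic_over x \<longleftrightarrow> (\<exists>P. poly_over ratfield P \<and> P \<noteq> 0 \<and> poly P x = 0)"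

lemma algebraic_overE:
  assumes "algebraic_over x"
  obtains C where "C \<noteq> 0" "(\<Sum>i\<le>degree C. ev (coeff C i) * x ^ i) = 0"
proof -
  obtain P where P: "poly_over ratfield P" "P \<noteq> 0" "poly P x = 0"
    using assms by (auto simp: algebraic_over_def)
  obtain g C where gC: "g \<noteq> 0" "smult (ev g) P = map_poly ev C" using clear_denominators[OF P(1)] by blast
  have "C \<noteq> 0" using gC P ev_nonzero by auto
  moreover have "poly (map_poly ev C) x = 0" using P by (simp flip: gC(2))
  hence "(\<Sum>i\<le>degree C. ev (coeff C i) * x ^ i) = 0"
    using \<open>C \<noteq> 0\<close> ev_nonzero by (simp add: poly_altdef degree_map_poly coeff_map_poly)
  ultimately show ?thesis using that by blast
qed

end

locale algebraic_extension = transcendental_element \<kappa> u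
  for \<kappa> :: "'k::{alg_closed_field,field_char_0} \<Rightarrow> 'a::alg_closed_field" and u :: 'a +
  assumes algebraic: "algebraic_over x"
begin

text \<open>The two alternatives for a nontrivial value suit the instances: X for the degree and the
  Gauss valuation, X - c for the order at c.\<close>

lemma extend_valuation:
  assumes mult: "\<And>F G. F \<noteq> 0 \<Longrightarrow> G \<noteq> 0 \<Longrightarrow> w (F * G) = w F + w G"
    and add: "\<And>F G. F \<noteq> 0 \<Longrightarrow> G \<noteq> 0 \<Longrightarrow> F + G \<noteq> 0 \<Longrightarrow> min (w F) (w G) \<le> w (F + G)"
    and nontriv: "w [:0, 1:] \<noteq> 0 \<or> w [:- c, 1:] \<noteq> 0"
  obtains v where "valuation v" "\<And>F. F \<noteq> 0 \<Longrightarrow> v (ev F) = w F"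
proof -
  interpret valued_domain ev w
    by standard (use mult add in \<open>auto simp: ev_at_add ev_at_mult ev_nonzero\<close>)
  have "\<exists>p. p \<noteq> 0 \<and> (\<Sum>i\<le>degree p. ev (coeff p i) * x ^ i) = 0" for x
    using algebraic_overE[OF algebraic] by metis
  note alg = this
  have "\<exists>a. a \<noteq> 0 \<and> w a \<noteq> 0" using nontriv by (metis one_neq_zero pCons_eq_0_iff)
  then obtain a where a: "a \<noteq> 0" "w a \<noteq> 0" by blast
  from valuation_extension[OF alg a] show ?thesis using that by blast
qed

lemma valuation_at_infinity:
  obtains v where "valuation v" "\<And>F. F \<noteq> 0 \<Longrightarrow> v (ev F) = - real (degree F)"
proof (rule extend_valuation[of "\<lambda>F. - real (degree F)"])
  fix F G :: "'k poly"
  show "- real (degree (F * G)) = - real (degree F) + - real (degree G)" if "F \<noteq> 0" "G \<noteq> 0"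
    using that by (simp add: degree_mult_eq)
  show "min (- real (degree F)) (- real (degree G)) \<le> - real (degree (F + G))"
    using degree_add_le_max[of F G] by (auto simp: min_def max_def split: if_splits)
qed (use that in auto)

lemma valuation_at_point:
  obtains v where "valuation v" "\<And>F. F \<noteq> 0 \<Longrightarrow> v (ev F) = real (order c F)"
proof (rule extend_valuation[of "\<lambda>F. real (order c F)" c])
  fix F G :: "'k poly"
  show "real (order c (F * G)) = real (order c F) + real (order c G)" if "F \<noteq> 0" "G \<noteq> 0"
    using that by (simp add: order_mult)
  show "min (real (order c F)) (real (order c G)) \<le> real (order c (F + G))" if "F \<noteq> 0" "G \<noteq> 0" "F + G \<noteq> 0"
  proof -
    define m where "m = min (order c F) (order c G)"
    have "[:-c, 1:] ^ m dvd F" "[:-c, 1:] ^ m dvd G" by (auto simp: order_divides m_def)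
    hence "[:-c, 1:] ^ m dvd F + G" by simp
    hence "m \<le> order c (F + G)" using that by (simp add: order_divides)
    thus ?thesis by (simp add: m_def min_def split: if_splits)
  qed
  show "real (order c [:0, 1:]) \<noteq> 0 \<or> real (order c [:- c, 1:]) \<noteq> 0"
    using order_power_n_n[of c 1] by simp
qed (use that in auto)

text \<open>An irrational \<gamma> gives distinct values to distinct monomials, so the minimum over
  the monomials of F is attained once. Multiplicativity follows because the product of the two
  minimal monomials cannot be cancelled.\<close>

lemma gauss_valuation:
  assumes vk: "valuation vk" and rat: "\<And>a. a \<noteq> 0 \<Longrightarrow> vk a \<in> \<rat>" and \<gamma>: "\<gamma> \<notin> \<rat>"
  obtains v where "valuation v" "\<And>a. a \<noteq> 0 \<Longrightarrow> v (\<kappa> a) = vk a" "v u = \<gamma>"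
proof -
  interpret vk: valuation vk by (rule vk)
  define val where "val = (\<lambda>(F :: 'k poly) i. vk (coeff F i) + real i * \<gamma>)"
  define S where "S = (\<lambda>F :: 'k poly. {i. coeff F i \<noteq> 0})"
  define w where "w = (\<lambda>F. Min (val F ` S F))"
  have finS: "finite (S F)" for F
    by (rule finite_subset[of _ "{..degree F}"]) (auto simp: S_def le_degree)
  have S_ne: "S F \<noteq> {}" if "F \<noteq> 0" for F using that by (auto simp: S_def poly_eq_iff)
  have distinct: "i = j" if "val F i = val F j" "i \<in> S F" "j \<in> S F" for F i j
  proof (rule ccontr)
    assume "i \<noteq> j"
    hence "\<gamma> = (vk (coeff F j) - vk (coeff F i)) / (real i - real j)"
      using that by (simp add: val_def field_simps)
    hence "\<gamma> \<in> \<rat>" using that rat by (simp add: S_def)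
    thus False using \<gamma> by simp
  qed
  have w_le: "w F \<le> val F i" if "i \<in> S F" for F i
    using that finS by (auto simp: w_def)
  have w_ex: "\<exists>i\<in>S F. w F = val F i" if "F \<noteq> 0" for F
  proof -
    have "w F \<in> val F ` S F" unfolding w_def using finS S_ne[OF that] by (intro Min_in) auto
    thus ?thesis by blast
  qed
  have w_ge: "r \<le> w F" if "F \<noteq> 0" "\<And>i. coeff F i \<noteq> 0 \<Longrightarrow> r \<le> val F i" for F r
    using w_ex[OF that(1)] that(2) by (auto simp: S_def)
  have "coeff [:0, 1 :: 'k:] i \<noteq> 0 \<longleftrightarrow> i = 1" for i
    by (cases i) (auto simp: coeff_pCons split: nat.splits)
  hence "S [:0, 1:] = {1}" by (simp add: S_def)
  hence w_u: "w [:0, 1:] = \<gamma>" by (simp add: w_def val_def)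
  obtain v where v: "valuation v" "\<And>F. F \<noteq> 0 \<Longrightarrow> v (ev F) = w F"
  proof (rule extend_valuation[of w])
    fix F G :: "'k poly"
    assume nz: "F \<noteq> 0" "G \<noteq> 0"
    obtain i0 where i0: "i0 \<in> S F" "w F = val F i0" using w_ex nz by blast
    obtain j0 where j0: "j0 \<in> S G" "w G = val G j0" using w_ex nz by blast
    define n where "n = i0 + j0"
    let ?t = "\<lambda>n i. coeff F i * coeff G (n - i)"
    have t_ge: "w F + w G \<le> vk (?t m i) + real m * \<gamma>" if "i \<le> m" "?t m i \<noteq> 0" for m i
    proof -
      have "w F \<le> val F i" "w G \<le> val G (m - i)" using that by (auto intro!: w_le simp: S_def)
      thus ?thesis using that by (simp add: val_def vk.v_mult of_nat_diff algebra_simps)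
    qed
    \<comment> \<open>Every other contribution to the coefficient of index n pairs a non-minimal
      monomial of F with some monomial of G.\<close>
    have dom: "vk (?t n i0) < vk (?t n i)" if "i \<le> n" "i \<noteq> i0" "?t n i \<noteq> 0" for i
    proof -
      have "i \<in> S F" "n - i \<in> S G" using that by (auto simp: S_def)
      moreover have "w F \<noteq> val F i" using distinct[of F i i0] i0 that calculation by auto
      ultimately have "w F < val F i" "w G \<le> val G (n - i)"
        using w_le by (auto simp: order_less_le)
      thus ?thesis using i0 j0 that
        by (simp add: val_def vk.v_mult of_nat_diff algebra_simps n_def S_def)
    qed
    have t0: "?t n i0 \<noteq> 0" using i0 j0 by (simp add: S_def n_def)
    have c: "coeff (F * G) n \<noteq> 0" "vk (coeff (F * G) n) = vk (?t n i0)"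
    proof -
      have "finite {..n}" "i0 \<in> {..n}" by (auto simp: n_def)
      note * = vk.sum_dominated[of "{..n}" i0 "?t n", OF this t0]
      show "coeff (F * G) n \<noteq> 0" "vk (coeff (F * G) n) = vk (?t n i0)"
        unfolding coeff_mult using dom by (intro *; simp)+
    qed
    have FG: "F * G \<noteq> 0" using nz by simp
    show "w (F * G) = w F + w G"
    proof (rule antisym)
      have "val (F * G) n = w F + w G"
        using c i0 j0 by (simp add: val_def vk.v_mult n_def S_def algebra_simps)
      thus "w (F * G) \<le> w F + w G" using w_le[of n "F * G"] c by (simp add: S_def)
      show "w F + w G \<le> w (F * G)"
      proof (rule w_ge[OF FG])
        fix m assume m: "coeff (F * G) m \<noteq> 0"
        have "vk.vge (w F + w G - real m * \<gamma>) (coeff (F * G) m)"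
          unfolding coeff_mult using t_ge by (intro vk.vge_sum) (force simp: vk.vge_def)
        thus "w F + w G \<le> val (F * G) m" using m by (simp add: vk.vge_def val_def)
      qed
    qed
    assume "F + G \<noteq> 0"
    thus "min (w F) (w G) \<le> w (F + G)"
    proof (rule w_ge)
      fix i assume i: "coeff (F + G) i \<noteq> 0"
      have "vk.vge (min (w F) (w G) - real i * \<gamma>) (coeff F i)"
        using w_le[of i F] by (cases "coeff F i = 0") (auto simp: vk.vge_def S_def val_def)
      moreover have "vk.vge (min (w F) (w G) - real i * \<gamma>) (coeff G i)"
        using w_le[of i G] by (cases "coeff G i = 0") (auto simp: vk.vge_def S_def val_def)
      ultimately have "vk.vge (min (w F) (w G) - real i * \<gamma>) (coeff (F + G) i)"
        unfolding coeff_add by (rule vk.vge_add)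
      thus "min (w F) (w G) \<le> val (F + G) i" using i by (simp add: vk.vge_def val_def)
    qed
  next
    show "w [:0, 1:] \<noteq> 0 \<or> w [:- 0, 1:] \<noteq> 0" using w_u \<gamma> by auto
  qed blast
  have "w [:a:] = vk a" if "a \<noteq> 0" for a
  proof -
    have "coeff [:a:] i \<noteq> 0 \<longleftrightarrow> i = 0" for i
      using that by (cases i) (auto simp: coeff_pCons)
    hence "S [:a:] = {0}" by (simp add: S_def)
    thus ?thesis by (simp add: w_def val_def)
  qed
  hence "v (\<kappa> a) = vk a" if "a \<noteq> 0" for a using v(2)[of "[:a:]"] that by simp
  moreover have "v u = \<gamma>"
    using v(2)[of "[:0, 1:]"] w_u by simp
  ultimately show ?thesis using that v(1) by blast
qed

end

section \<open>Values and degrees under an extension with irrational \<open>v u\<close>\<close>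

locale gauss_valued = algebraic_extension \<kappa> u + valuation v
  for \<kappa> :: "'k::{alg_closed_field,field_char_0} \<Rightarrow> 'a::alg_closed_field" and u :: 'a and v :: "'a \<Rightarrow> real" +
  assumes v_const: "c \<noteq> 0 \<Longrightarrow> v (\<kappa> c) \<in> \<rat>"
    and v_u: "v u \<notin> \<rat>"
begin

lemma u_nonzero [simp]: "u \<noteq> 0"
  using u_notin_range \<kappa>_zero by (metis rangeI)

lemma rational_multiple_v_u:
  assumes "a \<in> \<rat>" "b \<in> \<rat>" "c \<in> \<rat>" "d \<in> \<rat>" "a + b * v u = c + d * v u"
  shows "b = d"
proof (rule ccontr)
  assume "b \<noteq> d"
  hence "v u = (c - a) / (b - d)"
    using assms(5) by (simp add: field_simps)
  thus False using assms v_u by simp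
qed

lemma distinct_monomials:
  assumes "x \<noteq> 0" "y \<noteq> 0" "v x \<in> \<rat>" "v y \<in> \<rat>" "v (x * u ^ i) = v (y * u ^ j)"
  shows "i = j"
proof -
  have "v x + real i * v u = v y + real j * v u"
    using assms by (simp add: v_mult v_power)
  thus ?thesis using rational_multiple_v_u[of "v x" "real i" "v y" "real j"] assms by simp
qed

lemma v_ev:
  assumes "F \<noteq> 0"
  shows "\<exists>r\<in>\<rat>. \<exists>m::int. v (ev F) = r + of_int m * v u"
proof -
  define g where "g = (\<lambda>i. \<kappa> (coeff F i) * u ^ i)"
  obtain j where j: "g j \<noteq> 0" "v (sum g {..degree F}) = v (g j)"
  proof (rule distinct_values_sum[of "{..degree F}" "degree F" g])
    show "v (g i) \<noteq> v (g j)" if "i \<noteq> j" "g i \<noteq> 0" "g j \<noteq> 0" for i j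
      using distinct_monomials[of "\<kappa> (coeff F i)" "\<kappa> (coeff F j)" i j] v_const that by (auto simp: g_def)
  qed (use assms in \<open>auto simp: g_def\<close>)
  have "v (ev F) = v (\<kappa> (coeff F j)) + of_int (int j) * v u"
    using j by (simp add: ev_at_altdef g_def v_mult v_power)
  thus ?thesis using v_const[of "coeff F j"] j
    by (intro bexI[of _ "v (\<kappa> (coeff F j))"] exI[of _ "int j"]) (auto simp: g_def)
qed

lemma v_ratfield:
  assumes "x \<in> ratfield" "x \<noteq> 0"
  shows "\<exists>r\<in>\<rat>. \<exists>m::int. v x = r + of_int m * v u"
proof -
  obtain F G where FG: "x = ev F / ev G" "G \<noteq> 0" using assms by (auto simp: ratfield_def)
  hence "F \<noteq> 0" using assms by auto
  obtain r m where 1: "r \<in> \<rat>" "v (ev F) = r + of_int m * v u" using v_ev[OF \<open>F \<noteq> 0\<close>] by blast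
  obtain s n where 2: "s \<in> \<rat>" "v (ev G) = s + of_int n * v u" using v_ev[OF FG(2)] by blast
  have "v x = (r - s) + of_int (m - n) * v u"
    using FG \<open>F \<noteq> 0\<close> ev_nonzero 1 2 by (simp add: v_divide algebra_simps)
  moreover have "r - s \<in> \<rat>" using 1 2 by simp
  ultimately show ?thesis by blast
qed

text \<open>Two terms of P(x) have equal value, and the difference of their exponents, at most the
  degree, is a denominator for the coefficient of \<open>v u\<close> in \<open>v x\<close>.\<close>

lemma root_values:
  assumes "poly_over ratfield P" "P \<noteq> 0" "poly P x = 0" "x \<noteq> 0"
  obtains i j r and m :: int where "i < j" "j \<le> degree P" "r \<in> \<rat>" "real (j - i) * v x = r + of_int m * v u"
proof -
  define g where "g = (\<lambda>i. coeff P i * x ^ i)"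
  obtain i j where ij: "i \<le> degree P" "j \<le> degree P" "i \<noteq> j" "g i \<noteq> 0" "g j \<noteq> 0" "v (g i) = v (g j)"
    by (rule sum_eq_0_imp_equal_values[of "{..degree P}" "degree P" g])
      (use assms in \<open>auto simp: g_def poly_altdef\<close>)
  have *: "\<exists>r\<in>\<rat>. \<exists>m::int. real (j - i) * v x = r + of_int m * v u"
    if ij: "i < j" "g i \<noteq> 0" "g j \<noteq> 0" "v (g i) = v (g j)" for i j
  proof -
    have "coeff P i \<in> ratfield" "coeff P j \<in> ratfield" using assms(1) by (auto simp: poly_over_def)
    moreover have nz: "coeff P i \<noteq> 0" "coeff P j \<noteq> 0" using ij by (auto simp: g_def)
    ultimately obtain r m s n where rs: "r \<in> \<rat>" "v (coeff P i) = r + of_int m * v u"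
      "s \<in> \<rat>" "v (coeff P j) = s + of_int n * v u" using v_ratfield by metis
    have "v (coeff P i) + real i * v x = v (coeff P j) + real j * v x"
      using ij assms(4) nz by (simp add: g_def v_mult v_power)
    hence "real (j - i) * v x = (r - s) + of_int (m - n) * v u"
      using ij(1) rs by (simp add: of_nat_diff algebra_simps)
    moreover have "r - s \<in> \<rat>" using rs by simp
    ultimately show ?thesis by blast
  qed
  show ?thesis
  proof (cases "i < j")
    case True
    thus ?thesis using *[OF True] ij that by blast
  next
    case False
    hence "j < i" using ij by simp
    thus ?thesis using *[of j i] ij that by metis
  qed
qed

text \<open>Multiplied by a suitable positive integer up to the degree, s becomes a nonzero integer.
  Thus a small coefficient of \<open>v u\<close> bounds the degree from below without any
  computation of denominators.\<close>

lemma degree_lower_bound: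
  assumes "poly_over ratfield P" "P \<noteq> 0" "poly P x = 0" "x \<noteq> 0"
    and "v x = r + s * v u" "r \<in> \<rat>" "s \<in> \<rat>" "s \<noteq> 0"
  shows "1 \<le> real (degree P) * \<bar>s\<bar>"
proof -
  obtain i j r' m where ij: "i < j" "j \<le> degree P" "r' \<in> \<rat>" "real (j - i) * v x = r' + of_int m * v u"
    using root_values[OF assms(1-4)] by metis
  have "real (j - i) * s = of_int m"
    using rational_multiple_v_u[of "real (j - i) * r" "real (j - i) * s" r' "of_int m"] ij assms
    by (simp add: algebra_simps)
  moreover from this have "m \<noteq> 0" using ij(1) assms(8) by auto
  ultimately have "\<bar>real (j - i) * s\<bar> = of_int \<bar>m\<bar>" by (simp only: of_int_abs)
  moreover have "(1 :: real) \<le> of_int \<bar>m\<bar>" using \<open>m \<noteq> 0\<close> by linarith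
  ultimately have "1 \<le> \<bar>real (j - i) * s\<bar>" by (simp only:)
  also have "\<dots> = real (j - i) * \<bar>s\<bar>" by (simp add: abs_mult)
  also have "\<dots> \<le> real (degree P) * \<bar>s\<bar>" using ij by (intro mult_right_mono) auto
  finally show ?thesis .
qed

lemma v_form:
  assumes "x \<noteq> 0"
  shows "\<exists>r\<in>\<rat>. \<exists>s\<in>\<rat>. v x = r + s * v u"
proof -
  obtain P where P: "poly_over ratfield P" "P \<noteq> 0" "poly P x = 0"
    using algebraic by (auto simp: algebraic_over_def)
  obtain i j r m where ij: "i < j" "r \<in> \<rat>" "real (j - i) * v x = r + of_int m * v u"
    using root_values[OF P assms] by metis
  define d where "d = real (j - i)"
  have "d > 0" "d \<in> \<rat>" using ij by (auto simp: d_def)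
  hence "v x = r / d + (of_int m / d) * v u"
    using ij(3) by (simp add: field_simps flip: d_def)
  moreover have "r / d \<in> \<rat>" "of_int m / d \<in> \<rat>" using ij \<open>d \<in> \<rat>\<close> by auto
  ultimately show ?thesis by blast
qed

lemma v_ev_at_rational:
  assumes "\<And>a. v (y - \<kappa> a) \<in> \<rat>" "y \<notin> range \<kappa>" "F \<noteq> 0"
  shows "v (ev_at F y) \<in> \<rat>"
proof -
  have "(\<Prod>c\<in>#A. y - \<kappa> c) \<noteq> 0 \<and> v (\<Prod>c\<in>#A. y - \<kappa> c) \<in> \<rat>" for A
  proof (induction A)
    case (add c A)
    have "y - \<kappa> c \<noteq> 0" using assms(2) by auto
    thus ?case using add assms(1)[of c] by (simp add: v_mult)
  qed simp
  from this[of "proots F"] show ?thesis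
    using v_const[of "lead_coeff F"] assms(3) by (simp add: ev_at_eq_prod v_mult)
qed

text \<open>If all distances from \<open>y\<close> to constants had rational value, \<open>u\<close> could not be algebraic over
  the field generated by \<open>y\<close>: the powers of \<open>u\<close> would have values in distinct classes.\<close>

lemma irrational_distance:
  assumes "y \<notin> range \<kappa>"
  shows "\<exists>a. v (y - \<kappa> a) \<notin> \<rat>"
proof (rule ccontr)
  assume "\<not> ?thesis"
  hence rat: "\<And>a. v (y - \<kappa> a) \<in> \<rat>" by blast
  obtain C where C: "C \<noteq> 0" "(\<Sum>i\<le>degree C. ev (coeff C i) * y ^ i) = 0"
    using algebraic_overE[OF algebraic] by blast
  define N where "N = Max ((\<lambda>i. degree (coeff C i)) ` {..degree C})"
  \<comment> \<open>The relation between u and y, rearranged by powers of u: \<open>D j\<close> is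
    the polynomial whose value at y multiplies u^j.\<close>
  define D where "D = (\<lambda>j. \<Sum>i\<le>degree C. monom (coeff (coeff C i) j) i)"
  have coeff_D: "coeff (D j) i = (if i \<le> degree C then coeff (coeff C i) j else 0)" for i j
    by (simp add: D_def coeff_sum)
  have N: "degree (coeff C i) \<le> N" if "i \<le> degree C" for i
    unfolding N_def using that by (intro Max_ge) auto
  have ev_D: "ev_at (D j) y = (\<Sum>i\<le>degree C. \<kappa> (coeff (coeff C i) j) * y ^ i)" for j
  proof -
    have "degree (D j) \<le> degree C" unfolding D_def
      by (intro degree_sum_le) (auto intro: order.trans[OF degree_monom_le])
    hence "ev_at (D j) y = (\<Sum>i\<le>degree C. \<kappa> (coeff (D j) i) * y ^ i)"
      unfolding ev_at_altdef by (intro sum.mono_neutral_left) (auto simp: coeff_eq_0)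
    thus ?thesis by (simp add: coeff_D)
  qed
  have "(\<Sum>i\<le>degree C. ev (coeff C i) * y ^ i) =
      (\<Sum>i\<le>degree C. \<Sum>j\<le>N. \<kappa> (coeff (coeff C i) j) * y ^ i * u ^ j)"
  proof (rule sum.cong)
    fix i assume i: "i \<in> {..degree C}"
    have "ev (coeff C i) = (\<Sum>j\<le>N. \<kappa> (coeff (coeff C i) j) * u ^ j)"
      unfolding ev_at_altdef using N i by (intro sum.mono_neutral_left) (auto simp: coeff_eq_0)
    thus "ev (coeff C i) * y ^ i = (\<Sum>j\<le>N. \<kappa> (coeff (coeff C i) j) * y ^ i * u ^ j)"
      by (simp add: sum_distrib_left sum_distrib_right mult_ac)
  qed auto
  also have "\<dots> = (\<Sum>j\<le>N. ev_at (D j) y * u ^ j)"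
    unfolding ev_D sum_distrib_right by (rule sum.swap)
  finally have sum0: "(\<Sum>j\<le>N. ev_at (D j) y * u ^ j) = 0" using C by simp
  have D_val: "ev_at (D j) y \<noteq> 0 \<Longrightarrow> v (ev_at (D j) y) \<in> \<rat>" for j
    using v_ev_at_rational[OF rat assms, of "D j"] by (cases "D j = 0") auto
  obtain j0 where j0: "j0 \<le> N" "ev_at (D j0) y \<noteq> 0"
  proof -
    define j0 where "j0 = degree (lead_coeff C)"
    have "coeff (D j0) (degree C) \<noteq> 0" using C by (simp add: coeff_D j0_def)
    hence "D j0 \<noteq> 0" by auto
    hence "ev_at (D j0) y \<noteq> 0" using ev_at_eq_0D assms by blast
    thus ?thesis using that[of j0] N[of "degree C"] by (simp add: j0_def)
  qed
  obtain i j where ij: "i \<noteq> j" "ev_at (D i) y * u ^ i \<noteq> 0" "ev_at (D j) y * u ^ j \<noteq> 0"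
    "v (ev_at (D i) y * u ^ i) = v (ev_at (D j) y * u ^ j)"
    by (rule sum_eq_0_imp_equal_values[of "{..N}" j0 "\<lambda>j. ev_at (D j) y * u ^ j"]) (use j0 sum0 in auto)
  thus False using distinct_monomials[of "ev_at (D i) y" "ev_at (D j) y" i j] D_val by auto
qed

end


section \<open>Local analysis of the preimage tree\<close>

text \<open>From k * (p^r choose k) = p^r * (p^r - 1 choose k - 1): if p did not divide the binomial
  coefficient, p^r would divide k.\<close>

lemma prime_dvd_choose_prime_power:
  assumes p: "prime (p::nat)" and k: "0 < k" "k < p ^ r"
  shows "p dvd (p ^ r choose k)"
proof (rule ccontr)
  assume "\<not> p dvd (p ^ r choose k)"
  hence "coprime (p ^ r) (p ^ r choose k)"
    using p by (simp add: prime_imp_coprime)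
  moreover have "k * (p ^ r choose k) = p ^ r * (p ^ r - 1 choose (k - 1))"
    using k by (metis Suc_pred' binomial_absorption Suc_times_binomial_eq gr_zeroI less_nat_zero_code mult.commute)
  hence "p ^ r dvd k * (p ^ r choose k)" by simp
  ultimately have "p ^ r dvd k" by (simp add: coprime_dvd_mult_left_iff)
  thus False using k by (auto dest: dvd_imp_le)
qed

text \<open>The upper bound on \<open>v u\<close> is the gain \<delta> reached in
  \<open>not_good_siblings\<close>; positivity makes u integral.\<close>

locale padic_tree = gauss_valued \<kappa> u v
  for \<kappa> :: "'k::{alg_closed_field,field_char_0} \<Rightarrow> 'a::alg_closed_field" and u :: 'a and v :: "'a \<Rightarrow> real" +
  fixes p r q :: nat
  assumes p: "prime p" and r: "r \<ge> 1" and q: "q = p ^ r"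
    and v_p: "v (of_nat p) = 1"
    and v_u_pos: "0 < v u" and v_u_less: "v u < 1 / (2 * real q ^ 2)"
begin

definition t :: 'a where "t = u - u ^ q"
text \<open>Points of high level are only known to have value at least -\<epsilon>, since passing to
  a preimage divides a negative bound by q without reaching 0. The constant makes q \<epsilon> half
  of the bound on \<open>v u\<close>.\<close>

definition \<epsilon> :: real where "\<epsilon> = 1 / (4 * real q ^ 3)"
text \<open>The precision to which y \<mapsto> (u + y)^q - u^q agrees with the q-th power on
  arguments of value at least -\<epsilon>.\<close>

definition \<tau> :: real where "\<tau> = 1 - real q * \<epsilon>"

lemma q_ge_2: "q \<ge> 2"
proof -
  have "p ^ 1 \<le> p ^ r" using p r by (intro power_increasing) (auto dest: prime_gt_0_nat)
  thus ?thesis using prime_ge_2_nat[OF p] q by simp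
qed

lemma \<epsilon>_pos: "\<epsilon> > 0"
  using q_ge_2 by (simp add: \<epsilon>_def)

lemma q_\<epsilon>: "real q * \<epsilon> = 1 / (4 * real q ^ 2)"
  using q_ge_2 by (simp add: \<epsilon>_def power2_eq_square power3_eq_cube)

lemma q2_bound: "1 / real q ^ 2 \<le> 1 / 4" "1 / real q \<le> 1 / 2" "1 / real q ^ 2 \<le> 1 / real q"
proof -
  have "real q \<ge> 2" using q_ge_2 by simp
  hence "2 ^ 2 \<le> real q ^ 2" by (intro power_mono) auto
  thus "1 / real q ^ 2 \<le> 1 / 4" using q_ge_2 by (intro divide_left_mono) auto
  show "1 / real q \<le> 1 / 2" "1 / real q ^ 2 \<le> 1 / real q"
    using \<open>real q \<ge> 2\<close> by (auto simp: field_simps power2_eq_square)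
qed

lemma vge_u: "vge 0 u"
  using v_u_pos by (simp add: vge_def)

lemma vge_choose:
  assumes "0 < k" "k < q"
  shows "vge 1 (of_nat (q choose k))"
proof -
  obtain m where "q choose k = p * m"
    using prime_dvd_choose_prime_power[OF p assms(1)] assms(2) q by (auto elim: dvdE)
  moreover have "vge (1 + 0) (of_nat p * of_nat m)"
    using v_p vge_of_nat[of m] by (intro vge_mult) (auto simp: vge_def)
  ultimately show ?thesis by simp
qed

lemma binomial_middle:
  "(x + y) ^ q - x ^ q - y ^ q = (\<Sum>k\<in>{0<..<q}. of_nat (q choose k) * x ^ k * y ^ (q - k))" for x y :: 'a
proof -
  have "{..q} = insert 0 (insert q {0<..<q})" by auto
  thus ?thesis using q_ge_2 by (simp add: binomial_ring)
qed

text \<open>Every mixed term carries a binomial coefficient divisible by p and has total degree q in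
  x and y, which costs q * e.\<close>

lemma vge_cross:
  assumes x: "vge (- e) x" and y: "vge (- e) y" and e: "e \<ge> 0"
  shows "vge (1 - real q * e) ((x + y) ^ q - x ^ q - y ^ q)"
  unfolding binomial_middle
proof (rule vge_sum)
  fix k assume k: "k \<in> {0<..<q}"
  have "vge (1 + real k * (- e) + real (q - k) * (- e)) (of_nat (q choose k) * x ^ k * y ^ (q - k))"
    using k x y by (intro vge_mult vge_power vge_choose) auto
  thus "vge (1 - real q * e) (of_nat (q choose k) * x ^ k * y ^ (q - k))"
    using k by (simp add: of_nat_diff algebra_simps)
qed

lemma vge_perturb:
  assumes x: "vge (- e) x" and y: "vge s y" and e: "e \<ge> 0" "s \<ge> 0"
  shows "vge (min (1 + s - real q * e) (real q * s)) ((x + y) ^ q - x ^ q)"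
proof -
  have "vge (1 + s - real q * e) ((x + y) ^ q - x ^ q - y ^ q)"
    unfolding binomial_middle
  proof (rule vge_sum)
    fix k assume k: "k \<in> {0<..<q}"
    have "vge (1 + real k * (- e) + real (q - k) * s) (of_nat (q choose k) * x ^ k * y ^ (q - k))"
      using k x y by (intro vge_mult vge_power vge_choose) auto
    moreover have "1 * s \<le> real (q - k) * s" using k e by (intro mult_right_mono) auto
    moreover have "real k * e \<le> real q * e" using k e by (intro mult_right_mono) auto
    ultimately show "vge (1 + s - real q * e) (of_nat (q choose k) * x ^ k * y ^ (q - k))"
      by (elim vge_mono) simp
  qed
  hence "vge (min (1 + s - real q * e) (real q * s)) ((x + y) ^ q - x ^ q - y ^ q)"
    by (rule vge_mono) simp
  moreover have "vge (min (1 + s - real q * e) (real q * s)) (y ^ q)"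
    using vge_power[OF y, of q] by (rule vge_mono) simp
  ultimately show ?thesis using vge_add by fastforce
qed

text \<open>Stands for y not being too close to the constants. One witness a replaces a distance to
  all constants; its irrational value has a nonzero coefficient of \<open>v u\<close>, which is what
  gets divided by q further up. By \<open>irrational_distance\<close>, failure means closeness to
  some constant with precision \<tau>.\<close>

definition good :: "'a \<Rightarrow> bool" where
  "good y \<longleftrightarrow> (\<exists>a. y \<noteq> \<kappa> a \<and> v (y - \<kappa> a) \<notin> \<rat> \<and> v (y - \<kappa> a) < \<tau>)"

lemma not_goodD:
  assumes "\<not> good y"
  shows "\<exists>a. vge \<tau> (y - \<kappa> a)"
proof (cases "y \<in> range \<kappa>")
  case True
  then obtain a where "y = \<kappa> a" by blast
  thus ?thesis by (intro exI[of _ a]) auto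
next
  case False
  then obtain a where a: "v (y - \<kappa> a) \<notin> \<rat>" using irrational_distance by blast
  thus ?thesis using assms False unfolding good_def vge_def by (metis linorder_not_less rangeI)
qed

lemma \<tau>_bounds: "0 \<le> \<tau>" "1 / 2 \<le> \<tau>" "real q * \<epsilon> \<le> 1 / 16"
  using q2_bound(1) unfolding \<tau>_def q_\<epsilon> by simp_all

text \<open>With a1^q = a, the binomial estimates give (y1 - a1)^q = y - a up to an error of value
  at least \<tau>. Since v(y - a) < \<tau>, the error is dominated, and taking the q-th root divides
  the value by q.\<close>

lemma good_step:
  assumes y: "y = (u + y1) ^ q - u ^ q" "vge (- \<epsilon>) y" "vge (- \<epsilon>) y1"
    and a: "y \<noteq> \<kappa> a" "v (y - \<kappa> a) \<notin> \<rat>" "v (y - \<kappa> a) < \<tau>"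
  shows "\<exists>a1. y1 \<noteq> \<kappa> a1 \<and> v (y1 - \<kappa> a1) = v (y - \<kappa> a) / real q"
proof -
  have q0: "q > 0" using q_ge_2 by simp
  obtain a1 where a1: "a1 ^ q = a" using nth_root_exists[OF q0, of a] by blast
  \<comment> \<open>A rational and an irrational value cannot coincide, so y = (y - a) + a has the
    smaller of both values, and a inherits the lower bound of y.\<close>
  have va: "vge (- \<epsilon>) (\<kappa> a)"
  proof (cases "a = 0")
    case False
    have "v (\<kappa> a) \<noteq> v (y - \<kappa> a)" using a v_const[OF False] by metis
    hence "y \<noteq> 0" "v y = min (v (y - \<kappa> a)) (v (\<kappa> a))"
      using v_add_distinct[of "y - \<kappa> a" "\<kappa> a"] a False by auto
    thus ?thesis using y(2) by (simp add: vge_def)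
  qed simp
  have va1: "vge (- \<epsilon>) (\<kappa> a1)"
  proof (rule vge_powerD[OF _ q0])
    have "real q * (- \<epsilon>) \<le> - \<epsilon>" using \<epsilon>_pos q_ge_2 by simp
    thus "vge (real q * (- \<epsilon>)) (\<kappa> a1 ^ q)" using va a1 by (metis \<kappa>_power vge_mono)
  qed
  define z where "z = y1 - \<kappa> a1"
  have "vge (- \<epsilon>) z" unfolding z_def using y va1 by (intro vge_diff)
  hence "vge \<tau> ((\<kappa> a1 + z) ^ q - \<kappa> a1 ^ q - z ^ q)"
    unfolding \<tau>_def using va1 \<epsilon>_pos by (intro vge_cross) auto
  moreover have "vge \<tau> ((u + y1) ^ q - u ^ q - y1 ^ q)"
    unfolding \<tau>_def using y(3) vge_mono[OF vge_u, of "- \<epsilon>"] \<epsilon>_pos by (intro vge_cross) auto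
  moreover define W where "W = - (((\<kappa> a1 + z) ^ q - \<kappa> a1 ^ q - z ^ q) + ((u + y1) ^ q - u ^ q - y1 ^ q))"
  ultimately have "vge \<tau> W"
    unfolding W_def by (intro vge_minus[THEN iffD2] vge_add)
  moreover have eq: "z ^ q = (y - \<kappa> a) + W"
    using a1 by (simp add: W_def y(1) z_def flip: \<kappa>_power)
  ultimately have z: "z ^ q \<noteq> 0" "v (z ^ q) = v (y - \<kappa> a)"
    using v_add_vge[of "y - \<kappa> a" \<tau> W] a unfolding eq by auto
  hence "z \<noteq> 0" using q0 by (auto simp: zero_power)
  hence "real q * v z = v (y - \<kappa> a)" using z by (simp add: v_power)
  thus ?thesis using \<open>z \<noteq> 0\<close> q0 by (intro exI[of _ a1]) (auto simp: z_def field_simps)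
qed

lemma less_\<tau>_div: "x < \<tau> \<Longrightarrow> x / real q < \<tau>"
proof -
  assume x: "x < \<tau>"
  have "x / real q \<le> max x 0"
  proof (cases "x \<ge> 0")
    case True
    have "x / real q \<le> x / 1" using True q_ge_2 by (intro divide_left_mono) auto
    thus ?thesis by simp
  next
    case False
    thus ?thesis using q_ge_2 by (simp add: divide_le_0_iff)
  qed
  thus ?thesis using x \<tau>_bounds by simp
qed

lemma irrational_div: "x \<notin> \<rat> \<Longrightarrow> x / real q \<notin> \<rat>"
proof
  assume "x \<notin> \<rat>" "x / real q \<in> \<rat>"
  hence "x / real q * real q \<in> \<rat>" by (intro Rats_mult) auto
  thus False using \<open>x \<notin> \<rat>\<close> q_ge_2 by simp
qed

lemma good_child:
  assumes "y = (u + y1) ^ q - u ^ q" "vge (- \<epsilon>) y" "vge (- \<epsilon>) y1" "good y"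
  shows "good y1"
proof -
  obtain a where a: "y \<noteq> \<kappa> a" "v (y - \<kappa> a) \<notin> \<rat>" "v (y - \<kappa> a) < \<tau>" using assms(4) by (auto simp: good_def)
  obtain a1 where a1: "y1 \<noteq> \<kappa> a1" "v (y1 - \<kappa> a1) = v (y - \<kappa> a) / real q"
    using good_step[OF assms(1-3) a] by blast
  thus ?thesis unfolding good_def using a less_\<tau>_div irrational_div by metis
qed

text \<open>Lower bound: modulo p, (\<zeta> - 1)^q is \<zeta>^q - 1 = 0. Upper bound: some power
  \<omega> of \<zeta> has order p; among integral elements \<omega> - 1 divides p, and \<zeta> - 1
  divides \<omega> - 1.\<close>

lemma root_of_unity_value:
  assumes "\<zeta> ^ q = 1" "\<zeta> \<noteq> 1"
  shows "v \<zeta> = 0" "v (\<zeta> - 1) \<le> 1" "vge (1 / real q) (\<zeta> - 1)"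
proof -
  have q0: "q > 0" using q_ge_2 by simp
  have "\<zeta> \<noteq> 0" using assms q0 by (auto simp: zero_power)
  hence "real q * v \<zeta> = 0" using assms v_power[of \<zeta> q] by simp
  thus v\<zeta>: "v \<zeta> = 0" using q0 by simp
  have vp: "vge 0 (\<zeta> ^ i)" for i using v\<zeta> \<open>\<zeta> \<noteq> 0\<close> by (simp add: vge_def v_power)
  have vd: "vge 0 (\<zeta> - 1)" using vp[of 1] vp[of 0] vge_diff[of 0 \<zeta> 1] by simp
  have "vge (1 - real q * 0) ((1 + (\<zeta> - 1)) ^ q - 1 ^ q - (\<zeta> - 1) ^ q)"
    using vd vp[of 0] by (intro vge_cross) auto
  hence "vge (real q * (1 / real q)) ((\<zeta> - 1) ^ q)" using assms q0 by simp
  thus "vge (1 / real q) (\<zeta> - 1)" by (rule vge_powerD[OF _ q0])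
  define i where "i = (LEAST i. \<zeta> ^ (p ^ i) = 1)"
  have i1: "\<zeta> ^ (p ^ i) = 1" unfolding i_def using LeastI[of "\<lambda>i. \<zeta> ^ (p ^ i) = 1" r] assms(1) q by simp
  have "i \<noteq> 0" using i1 assms(2) by (intro notI) simp
  define \<omega> where "\<omega> = \<zeta> ^ (p ^ (i - 1))"
  obtain j where j: "i = Suc j" using \<open>i \<noteq> 0\<close> not0_implies_Suc by blast
  have "\<omega> ^ p = \<zeta> ^ (p ^ j * p)" by (simp add: \<omega>_def j power_mult)
  also have "p ^ j * p = p ^ i" by (simp add: j)
  finally have "\<omega> ^ p = 1" using i1 by simp
  have "\<omega> \<noteq> 1"
    using not_less_Least[of "i - 1" "\<lambda>i. \<zeta> ^ (p ^ i) = 1"] \<open>i \<noteq> 0\<close> by (simp add: \<omega>_def flip: i_def)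
  have v\<omega>: "vge 0 (\<omega> ^ j)" for j unfolding \<omega>_def using vp by (simp flip: power_mult)
  have geom: "x ^ n - 1 = (x - 1) * (\<Sum>j<n. x ^ j)" for x :: 'a and n
    using power_diff_1_eq[of x n] by simp
  have "(\<omega> - 1) * (\<Sum>j<p. \<omega> ^ j) = 0" using geom[of \<omega> p] \<open>\<omega> ^ p = 1\<close> by simp
  hence "(\<Sum>j<p. \<omega> ^ j) = 0" using \<open>\<omega> \<noteq> 1\<close> by simp
  hence "of_nat p = (\<Sum>j<p. 1 - \<omega> ^ j)" by (simp add: sum_subtractf)
  also have "\<dots> = (\<Sum>j<p. (\<omega> - 1) * (- (\<Sum>k<j. \<omega> ^ k)))"
    by (intro sum.cong) (auto simp flip: geom)
  also have "\<dots> = (\<omega> - 1) * (\<Sum>j<p. - (\<Sum>k<j. \<omega> ^ k))" by (simp only: sum_distrib_left)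
  finally have p_eq: "of_nat p = (\<omega> - 1) * (\<Sum>j<p. - (\<Sum>k<j. \<omega> ^ k))" .
  have "vge (v (\<omega> - 1) + 0) (of_nat p)"
    unfolding p_eq using v\<omega> by (intro vge_mult vge_sum vge_minus[THEN iffD2]) auto
  hence 1: "v (\<omega> - 1) \<le> 1"
    using v_p of_nat_nonzero[of p] prime_gt_0_nat[OF p] by (simp add: vge_def)
  have "vge (v (\<zeta> - 1) + 0) (\<omega> - 1)"
    unfolding \<omega>_def geom[of \<zeta>] using vp by (intro vge_mult vge_sum) auto
  thus "v (\<zeta> - 1) \<le> 1" using 1 \<open>\<omega> \<noteq> 1\<close> by (simp add: vge_def)
qed

lemma root_of_unity_const:
  assumes "\<zeta> ^ q = 1"
  shows "\<zeta> \<in> range \<kappa>"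
proof (rule ev_at_eq_0D)
  have "ev_at (monom 1 q) \<zeta> = \<zeta> ^ q"
    by (simp add: ev_at_def map_poly_monom poly_monom)
  thus "ev_at (monom 1 q + smult (- 1) 1) \<zeta> = 0"
    using assms unfolding ev_at_add ev_at_smult by (simp add: \<kappa>_uminus)
  have "coeff (monom 1 q + smult (- 1) 1 :: 'k poly) q = 1" using q_ge_2 by (cases q) auto
  thus "monom 1 q + smult (- 1) 1 \<noteq> (0 :: 'k poly)" by (metis coeff_0 zero_neq_one)
qed

text \<open>Two distinct points with the same image cannot both have a preimage whose distance from
  \<open>u\<close> is close to a constant: the quotient \<open>\<zeta>\<close> of the two points satisfies \<open>v (\<zeta> - 1) \<le> v p\<close>,
  and comparing the two expansions would force \<open>u\<close> itself to be close to a constant.\<close>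

lemma not_good_siblings:
  assumes x: "x ^ q = x' ^ q" "x \<noteq> x'"
    and child: "z ^ q + t = x" "z' ^ q + t = x'"
    and vz: "vge (- \<epsilon>) z" "vge (- \<epsilon>) z'"
    and bad: "\<not> good (z - u)" "\<not> good (z' - u)"
  shows False
proof -
  have q0: "q > 0" using q_ge_2 by simp
  have "x \<noteq> 0" using x q0 by (metis power_eq_0_iff zero_power)
  define \<zeta> where "\<zeta> = x' / x"
  have \<zeta>: "\<zeta> ^ q = 1" "\<zeta> \<noteq> 1" using x \<open>x \<noteq> 0\<close> q0 by (auto simp: \<zeta>_def power_divide zero_power)
  have x': "x' = \<zeta> * x" using \<open>x \<noteq> 0\<close> by (simp add: \<zeta>_def)
  note \<zeta>v = root_of_unity_value[OF \<zeta>]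
  have \<zeta>0: "vge 0 \<zeta>" using \<zeta>v by (simp add: vge_def)
  obtain c\<zeta> where c\<zeta>: "\<zeta> = \<kappa> c\<zeta>" using root_of_unity_const[OF \<zeta>(1)] by blast
  obtain A where A: "vge \<tau> (z - u - \<kappa> A)" using not_goodD[OF bad(1)] by blast
  obtain A' where A': "vge \<tau> (z' - u - \<kappa> A')" using not_goodD[OF bad(2)] by blast
  define a where "a = \<kappa> A"
  define a' where "a' = \<kappa> A'"
  \<comment> \<open>The q-th powers of w and u + \<kappa> B agree to precision 2 \<tau>: mixed terms
    combine p with the difference, and the pure power contains the difference at least
    twice.\<close>
  have const: "vge (- \<epsilon>) (\<kappa> B) \<and> vge (- \<epsilon>) (u + \<kappa> B) \<and>
      vge (2 - 2 * (real q * \<epsilon>)) (w ^ q - (u + \<kappa> B) ^ q)"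
    if w: "vge (- \<epsilon>) w" "vge \<tau> (w - u - \<kappa> B)" for w B
  proof -
    have "vge (- \<epsilon>) (w - u - \<kappa> B)" using w(2) by (rule vge_mono) (use \<tau>_bounds \<epsilon>_pos in auto)
    hence 1: "vge (- \<epsilon>) (w - (w - u - \<kappa> B))" using w(1) by (rule vge_diff[rotated])
    hence uB: "vge (- \<epsilon>) (u + \<kappa> B)" by simp
    have "vge (- \<epsilon>) (u + \<kappa> B - u)"
      using uB vge_mono[OF vge_u, of "- \<epsilon>"] \<epsilon>_pos by (intro vge_diff) auto
    hence B: "vge (- \<epsilon>) (\<kappa> B)" by simp
    have "vge (min (1 + \<tau> - real q * \<epsilon>) (real q * \<tau>)) ((u + \<kappa> B + (w - u - \<kappa> B)) ^ q - (u + \<kappa> B) ^ q)"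
      using uB w \<epsilon>_pos \<tau>_bounds by (intro vge_perturb) auto
    moreover have "2 * \<tau> \<le> real q * \<tau>" using q_ge_2 \<tau>_bounds by (intro mult_right_mono) auto
    ultimately have "vge (2 - 2 * (real q * \<epsilon>)) ((u + \<kappa> B + (w - u - \<kappa> B)) ^ q - (u + \<kappa> B) ^ q)"
      by (elim vge_mono) (auto simp: \<tau>_def)
    thus ?thesis using uB B by simp
  qed
  note c1 = const[OF vz(1) A, folded a_def] and c2 = const[OF vz(2) A', folded a'_def]
  define S where "S = (u + a) ^ q - u ^ q - a ^ q"
  define S' where "S' = (u + a') ^ q - u ^ q - a' ^ q"
  define D where "D = z ^ q - (u + a) ^ q"
  define D' where "D' = z' ^ q - (u + a') ^ q"
  have va: "vge (- \<epsilon>) a" "vge (- \<epsilon>) a'" using c1 c2 by auto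
  have vu: "vge (- \<epsilon>) u" using vge_u \<epsilon>_pos by (elim vge_mono) auto
  have vS: "vge (1 - real q * \<epsilon>) S" "vge (1 - real q * \<epsilon>) S'"
    unfolding S_def S'_def using va vu \<epsilon>_pos by (auto intro!: vge_cross)
  have vD: "vge (2 - 2 * (real q * \<epsilon>)) D" "vge (2 - 2 * (real q * \<epsilon>)) D'"
    using c1 c2 by (auto simp: D_def D'_def)
  have \<zeta>mult: "vge s (\<zeta> * y)" if "vge s y" for s y using vge_mult[OF \<zeta>0 that] by simp
  \<comment> \<open>Since t = u - u^q, the image of u + a is u + a^q + S; comparing x' with \<zeta>
    x isolates (\<zeta> - 1) u.\<close>
  have eq: "(\<zeta> - 1) * u = (a' ^ q - \<zeta> * a ^ q) + (S' - \<zeta> * S) + (D' - \<zeta> * D)"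
  proof -
    have "x = u + a ^ q + S + D" by (simp add: S_def D_def t_def flip: child(1))
    moreover have "x' = u + a' ^ q + S' + D'" by (simp add: S'_def D'_def t_def flip: child(2))
    ultimately have "u + a' ^ q + S' + D' = \<zeta> * (u + a ^ q + S + D)" using x' by simp
    thus ?thesis by (simp add: algebra_simps)
  qed
  \<comment> \<open>\<open>M\<close> is a constant, because \<zeta>, a and a' are. The crude bound
    1/q for it is enough to bring a' and a together.\<close>
  define M where "M = a' ^ q - \<zeta> * a ^ q"
  have vM: "vge (1 / real q) M"
  proof -
    have "vge (1 / real q + 0) ((\<zeta> - 1) * u)" using \<zeta>v(3) vge_u by (rule vge_mult)
    hence 1: "vge (1 / real q) ((\<zeta> - 1) * u)" by simp
    have 2: "vge (1 / real q) (S' - \<zeta> * S)"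
      by (rule vge_mono[OF vge_diff[OF vS(2) \<zeta>mult[OF vS(1)]]]) (use q2_bound \<tau>_bounds in linarith)
    have 3: "vge (1 / real q) (D' - \<zeta> * D)"
      by (rule vge_mono[OF vge_diff[OF vD(2) \<zeta>mult[OF vD(1)]]]) (use q2_bound \<tau>_bounds in linarith)
    have "vge (1 / real q) ((\<zeta> - 1) * u - (S' - \<zeta> * S) - (D' - \<zeta> * D))"
      by (rule vge_diff[OF vge_diff[OF 1 2] 3])
    thus ?thesis unfolding eq M_def by simp
  qed
  define d where "d = a' - a"
  have vd: "vge (1 / real q ^ 2 - \<epsilon>) d"
  proof (rule vge_powerD[OF _ q0])
    have "vge (1 / real q + real q * (- \<epsilon>)) ((\<zeta> - 1) * a ^ q)"
      using \<zeta>v(3) va by (intro vge_mult vge_power)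
    moreover have "vge (1 / real q + real q * (- \<epsilon>)) M"
      using vM by (rule vge_mono) (use \<epsilon>_pos in simp)
    ultimately have "vge (1 / real q + real q * (- \<epsilon>)) (M + (\<zeta> - 1) * a ^ q)" by (rule vge_add[rotated])
    moreover have "vge (1 - real q * \<epsilon>) ((a + d) ^ q - a ^ q - d ^ q)"
      using va vge_diff[OF va(2,1)] \<epsilon>_pos by (intro vge_cross) (auto simp: d_def)
    hence "vge (1 / real q + real q * (- \<epsilon>)) ((a + d) ^ q - a ^ q - d ^ q)"
      by (rule vge_mono) (use q2_bound in simp)
    ultimately have "vge (1 / real q + real q * (- \<epsilon>))
      ((M + (\<zeta> - 1) * a ^ q) - ((a + d) ^ q - a ^ q - d ^ q))" by (rule vge_diff)
    moreover have "(M + (\<zeta> - 1) * a ^ q) - ((a + d) ^ q - a ^ q - d ^ q) = d ^ q"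
      by (simp add: M_def d_def algebra_simps)
    moreover have "real q * (1 / real q ^ 2 - \<epsilon>) = 1 / real q + real q * (- \<epsilon>)"
      using q0 by (simp add: power2_eq_square algebra_simps)
    ultimately show "vge (real q * (1 / real q ^ 2 - \<epsilon>)) (d ^ q)" by simp
  qed
  \<comment> \<open>Half of 1/q^2: this much of the bound on a' - a survives the losses \<epsilon>
    and q \<epsilon>.\<close>
  define \<delta> where "\<delta> = 1 / (2 * real q ^ 2)"
  have \<delta>: "\<delta> \<le> 1 / real q ^ 2 - \<epsilon> - real q * \<epsilon>" "\<delta> \<le> 1 / real q - real q * \<epsilon>" "\<delta> \<le> 1 - 2 * (real q * \<epsilon>)"
  proof -
    have "\<epsilon> \<le> real q * \<epsilon>" using \<epsilon>_pos q_ge_2 by simp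
    moreover have "real q * \<epsilon> = \<delta> / 2" "1 / real q ^ 2 = 2 * \<delta>" "\<delta> \<ge> 0" by (simp_all add: q_\<epsilon> \<delta>_def)
    ultimately show "\<delta> \<le> 1 / real q ^ 2 - \<epsilon> - real q * \<epsilon>" "\<delta> \<le> 1 / real q - real q * \<epsilon>"
       "\<delta> \<le> 1 - 2 * (real q * \<epsilon>)" using q2_bound by linarith+
  qed
  have vdiff: "vge \<delta> (a' ^ i - \<zeta> * a ^ i)" if "i \<le> q" for i
  proof -
    have bnd: "- (real q * \<epsilon>) \<le> real j * (- \<epsilon>)" if "j \<le> q" for j
      using that \<epsilon>_pos by simp
    have "vge (- (real q * \<epsilon>)) (a ^ (i - Suc j) * a' ^ j)" if "j < i" for j
    proof -
      have "vge (real (i - Suc j) * (- \<epsilon>) + real j * (- \<epsilon>)) (a ^ (i - Suc j) * a' ^ j)"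
        using va by (intro vge_mult vge_power)
      thus ?thesis
      proof (rule vge_mono)
        have "real (i - Suc j) * (- \<epsilon>) + real j * (- \<epsilon>) = real (i - 1) * (- \<epsilon>)"
          using that by (simp add: of_nat_diff algebra_simps)
        thus "- (real q * \<epsilon>) \<le> real (i - Suc j) * (- \<epsilon>) + real j * (- \<epsilon>)" using bnd[of "i - 1"] \<open>i \<le> q\<close> by simp
      qed
    qed
    hence "vge ((1 / real q ^ 2 - \<epsilon>) + - (real q * \<epsilon>)) (d * (\<Sum>j<i. a ^ (i - Suc j) * a' ^ j))"
      using vd by (intro vge_mult vge_sum) auto
    moreover have "d * (\<Sum>j<i. a ^ (i - Suc j) * a' ^ j) = a' ^ i - a ^ i"
      unfolding d_def by (rule power_diff_sumr2[symmetric])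
    ultimately have 1: "vge \<delta> (a' ^ i - a ^ i)" using \<delta> by (auto elim: vge_mono)
    have "vge (1 / real q + real i * (- \<epsilon>)) ((\<zeta> - 1) * a ^ i)"
      using \<zeta>v(3) va by (intro vge_mult vge_power)
    hence "vge \<delta> ((\<zeta> - 1) * a ^ i)"
      by (rule vge_mono) (use \<delta>(2) bnd[OF that] in linarith)
    hence "vge \<delta> ((a' ^ i - a ^ i) - (\<zeta> - 1) * a ^ i)" using 1 by (rule vge_diff[rotated])
    thus ?thesis by (simp add: algebra_simps)
  qed
  \<comment> \<open>Second pass: with a' close to a, each mixed term of S' - \<zeta> S carries a
    factor a'^i - \<zeta> a^i besides p, so its value exceeds 1, the largest value that \<zeta> - 1
    can have.\<close>
  have "vge (1 + \<delta>) (S' - \<zeta> * S)"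
  proof -
    have "S' - \<zeta> * S = (\<Sum>k\<in>{0<..<q}. of_nat (q choose k) * u ^ k * (a' ^ (q - k) - \<zeta> * a ^ (q - k)))"
      unfolding S_def S'_def binomial_middle
      by (simp add: sum_distrib_left sum_subtractf algebra_simps)
    moreover have "vge (1 + \<delta>) (of_nat (q choose k) * u ^ k * (a' ^ (q - k) - \<zeta> * a ^ (q - k)))"
      if "k \<in> {0<..<q}" for k
    proof -
      have "vge (1 + real k * 0 + \<delta>) (of_nat (q choose k) * u ^ k * (a' ^ (q - k) - \<zeta> * a ^ (q - k)))"
        using that vge_u by (intro vge_mult vge_power vge_choose vdiff) auto
      thus ?thesis by simp
    qed
    ultimately show ?thesis by (simp only: vge_sum)
  qed
  moreover have "vge (1 + \<delta>) (D' - \<zeta> * D)"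
    by (rule vge_mono[OF vge_diff[OF vD(2) \<zeta>mult[OF vD(1)]]]) (use \<delta> in linarith)
  ultimately have "vge (1 + \<delta>) ((S' - \<zeta> * S) + (D' - \<zeta> * D))" by (rule vge_add)
  hence main: "vge (1 + \<delta>) ((\<zeta> - 1) * u - M)" unfolding eq M_def by (simp add: add.assoc)
  \<comment> \<open>Chosen so that (\<zeta> - 1) u - M is \<zeta> - 1 times u - \<kappa> C; the
    distance of u from a constant has value at most \<open>v u\<close>.\<close>
  define C where "C = (A' ^ q - c\<zeta> * A ^ q) / (c\<zeta> - 1)"
  have "c\<zeta> \<noteq> 1" using c\<zeta> \<zeta> by auto
  have "(\<zeta> - 1) * u - M = (\<zeta> - 1) * (u - \<kappa> C)"
  proof -
    have "(\<zeta> - 1) * \<kappa> C = M"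
      using \<zeta> by (simp add: C_def M_def c\<zeta> a_def a'_def \<kappa>_divide \<kappa>_diff \<kappa>_mult \<kappa>_power)
    thus ?thesis by (simp add: algebra_simps)
  qed
  moreover have uC: "u - \<kappa> C \<noteq> 0" using u_notin_range by auto
  ultimately have "1 + \<delta> \<le> v (\<zeta> - 1) + v (u - \<kappa> C)"
    using main \<zeta> by (simp add: vge_def v_mult)
  moreover have "v (u - \<kappa> C) \<le> v u"
  proof (cases "C = 0")
    case False
    have "v u \<noteq> v (- \<kappa> C)" using v_const[OF False] v_u by auto
    thus ?thesis using v_add_distinct[of u "- \<kappa> C"] False by simp
  qed simp
  ultimately have "\<delta> \<le> v u" using \<zeta>v(2) by linarith
  thus False using v_u_less by (simp add: \<delta>_def)
qed

end

section \<open>Preimages of bounded degree\<close>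

lemma poly_poly_iterate: "poly (poly_iterate f n) x = (poly f ^^ n) x"
  by (induction n) (auto simp: poly_iterate_def poly_pcompose)

lemma funpow_funpow: "(f ^^ m) ((f ^^ n) x) = (f ^^ (m + n)) x"
  by (simp add: funpow_add)

lemma funpow_commute: "(f ^^ m) ((f ^^ n) x) = (f ^^ n) ((f ^^ m) x)"
  by (simp add: funpow_funpow add.commute)

section \<open>The map x^q + u - u^q and its iterates over k(u)\<close>

context transcendental_element
begin

definition step :: "nat \<Rightarrow> 'a \<Rightarrow> 'a" where
  "step q x = x ^ q + (u - u ^ q)"

definition step_poly :: "nat \<Rightarrow> 'a poly" where
  "step_poly q = monom 1 q + [:u - u ^ q:]"

lemma poly_step_poly: "poly (step_poly q) = step q"
  by (auto simp: step_poly_def step_def poly_monom)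

lemma poly_iterate_step: "poly (poly_iterate (step_poly q) n) x = (step q ^^ n) x"
  by (simp add: poly_poly_iterate poly_step_poly)

lemma poly_over_step_poly: "poly_over ratfield (step_poly q)"
  unfolding step_poly_def
  by (intro E.poly_over_add E.poly_over_monom E.poly_over_const E.mems u_in_ratfield E.one_mem)

lemma poly_over_iterate: "poly_over ratfield (poly_iterate (step_poly q) n)"
proof (induction n)
  case 0
  show ?case
    by (auto simp: poly_iterate_def intro!: E.poly_over_pCons)
next
  case (Suc n)
  thus ?case using poly_over_step_poly
    by (auto simp: poly_iterate_def intro!: E.poly_over_pcompose)
qed

end

section \<open>Finite points and the point at infinity of k(u)\<close>

context algebraic_extension
begin

text \<open>A denominator of least degree has no zero: at a zero c integrality would make the
  numerator vanish too, and X - c could be cancelled. Valuations of the big field appear because Q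
  will be a norm, whose factors may lie outside \<open>ratfield\<close>.\<close>

lemma integral_at_points_imp_polynomial:
  assumes Q: "Q \<in> ratfield"
    and int: "\<And>c v. valuation v \<Longrightarrow> (\<And>F. F \<noteq> 0 \<Longrightarrow> v (ev F) = real (order c F)) \<Longrightarrow> valuation.vge v 0 Q"
  shows "\<exists>F. Q = ev F"
proof -
  define R where "R = (\<lambda>G. G \<noteq> 0 \<and> (\<exists>F. Q = ev F / ev G))"
  define G where "G = arg_min degree R"
  have "\<exists>G. R G" using Q by (auto simp: ratfield_def R_def)
  hence "R G" and min: "\<And>G'. R G' \<Longrightarrow> degree G \<le> degree G'"
    using arg_min_nat_lemma[of R _ degree] by (auto simp: G_def)
  then obtain F where F: "Q = ev F / ev G" "G \<noteq> 0" by (auto simp: R_def)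
  have "degree G = 0"
  proof (rule ccontr)
    assume "degree G \<noteq> 0"
    then obtain c where c: "poly G c = 0" using alg_closed_imp_poly_has_root by blast
    hence "[:- c, 1:] dvd G" by (simp add: poly_eq_0_iff_dvd)
    then obtain G' where G': "G = [:- c, 1:] * G'" by (elim dvdE)
    hence "G' \<noteq> 0" using F by auto
    hence degG: "degree G' < degree G" by (simp add: G' degree_mult_eq del: mult_pCons_left)
    have "poly F c = 0"
    proof (rule ccontr)
      assume Fc: "poly F c \<noteq> 0"
      hence "F \<noteq> 0" by auto
      obtain v where v: "valuation v" "\<And>F. F \<noteq> 0 \<Longrightarrow> v (ev F) = real (order c F)"
        using valuation_at_point by blast
      interpret valuation v by (rule v(1))
      have "vge 0 Q" using int v by blast
      moreover have "Q \<noteq> 0" using F \<open>F \<noteq> 0\<close> ev_nonzero by simp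
      moreover have "v Q = real (order c F) - real (order c G)"
        using F \<open>F \<noteq> 0\<close> ev_nonzero by (simp add: v_divide v)
      moreover have "order c F = 0" using Fc by (simp add: order_root)
      moreover have "order c G > 0" using c F by (simp add: order_root)
      ultimately show False by (simp add: vge_def)
    qed
    hence "[:- c, 1:] dvd F" by (simp add: poly_eq_0_iff_dvd)
    then obtain F' where F': "F = [:- c, 1:] * F'" by (elim dvdE)
    have "ev [:- c, 1:] \<noteq> 0" by (rule ev_nonzero) simp
    hence "Q = ev F' / ev G'" unfolding F(1) F' G' ev_at_mult by simp
    hence "R G'" using \<open>G' \<noteq> 0\<close> by (auto simp: R_def)
    thus False using min degG by force
  qed
  then obtain a where a: "G = [:a:]" by (elim degree_eq_zeroE)
  hence "a \<noteq> 0" using F by simp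
  hence "Q = ev (smult (inverse a) F)"
    using a by (simp add: F(1) ev_at_smult \<kappa>_inverse divide_inverse mult.commute)
  thus ?thesis by blast
qed

text \<open>The leading coefficient g of an equation over the polynomials makes g \<beta> integral:
  multiplied by g^(N - 1), the equation becomes monic in g \<beta>. One g serves all finite points
  and all roots of B.\<close>

lemma clear_root_denominators:
  assumes B: "poly_over ratfield B" "B \<noteq> 0"
  shows "\<exists>g. g \<noteq> 0 \<and> (\<forall>c v \<beta>. valuation v \<longrightarrow> (\<forall>F. F \<noteq> 0 \<longrightarrow> v (ev F) = real (order c F)) \<longrightarrow>
     poly B \<beta> = 0 \<longrightarrow> valuation.vge v 0 (ev g * \<beta>))"
proof -
  obtain g0 C where C: "g0 \<noteq> 0" "smult (ev g0) B = map_poly ev C" using clear_denominators[OF B(1)] by blast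
  have "C \<noteq> 0" using C B ev_nonzero by auto
  define N where "N = degree C"
  define g where "g = lead_coeff C"
  have g0: "g \<noteq> 0" using \<open>C \<noteq> 0\<close> by (simp add: g_def)
  show ?thesis
  proof (intro exI[of _ g] conjI allI impI g0)
    fix c v \<beta>
    assume val: "valuation v" and v: "\<forall>F. F \<noteq> 0 \<longrightarrow> v (ev F) = real (order c F)" and \<beta>: "poly B \<beta> = 0"
    interpret valuation v by (rule val)
    have vev: "vge 0 (ev F)" for F using v by (cases "F = 0") (auto simp: vge_def)
    have evg: "ev g \<noteq> 0" using g0 ev_nonzero by simp
    have "poly (map_poly ev C) \<beta> = 0" using \<beta> by (simp flip: C(2))
    hence sum0: "(\<Sum>i\<le>N. ev (coeff C i) * \<beta> ^ i) = 0"
      using ev_nonzero by (simp add: poly_altdef degree_map_poly coeff_map_poly N_def)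
    have "N > 0"
    proof (rule ccontr)
      assume "\<not> N > 0"
      hence "ev (coeff C N) = 0" using sum0 by simp
      thus False using evg by (simp add: g_def N_def)
    qed
    show "vge 0 (ev g * \<beta>)"
    proof (rule ccontr)
      assume neg: "\<not> vge 0 (ev g * \<beta>)"
      define w where "w = ev g * \<beta>"
      have w: "w \<noteq> 0" "v w < 0" using neg by (auto simp: vge_def w_def)
      define G where "G = (\<lambda>i. if i = N then w ^ N else ev (coeff C i) * ev g ^ (N - 1 - i) * w ^ i)"
      have "(\<Sum>i\<le>N. G i) = (\<Sum>i\<le>N. ev g ^ (N - 1) * (ev (coeff C i) * \<beta> ^ i))"
      proof (rule sum.cong)
        fix i assume i: "i \<in> {..N}"
        show "G i = ev g ^ (N - 1) * (ev (coeff C i) * \<beta> ^ i)"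
        proof (cases "i = N")
          case True
          have "w ^ N = ev g ^ (N - 1) * (ev g * \<beta> ^ N)"
            using \<open>N > 0\<close> by (cases N) (auto simp: w_def power_mult_distrib mult_ac)
          thus ?thesis using True by (simp add: G_def g_def N_def)
        next
          case False
          hence "N - 1 = (N - 1 - i) + i" using i by auto
          hence "ev g ^ (N - 1) = ev g ^ (N - 1 - i) * ev g ^ i" by (metis power_add)
          thus ?thesis using False by (simp add: G_def w_def power_mult_distrib mult_ac)
        qed
      qed auto
      hence "(\<Sum>i\<le>N. G i) = 0" using sum0 by (simp flip: sum_distrib_left)
      moreover have "(\<Sum>i\<le>N. G i) \<noteq> 0"
      proof (rule sum_dominated(1)[of _ N])
        fix i assume i: "i \<in> {..N}" "i \<noteq> N" "G i \<noteq> 0"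
        have "vge (0 + real (N - 1 - i) * 0 + real i * v w) (ev (coeff C i) * ev g ^ (N - 1 - i) * w ^ i)"
          by (intro vge_mult vge_power vev) simp
        hence "vge (real i * v w) (G i)" using i by (simp add: G_def)
        hence "real i * v w \<le> v (G i)" using i(3) by (rule vgeD)
        moreover have "real N * v w < real i * v w" using i w by (intro mult_strict_right_mono_neg) auto
        ultimately have "real N * v w < v (G i)" by linarith
        moreover have "v (G N) = real N * v w" using w by (simp add: G_def v_power)
        ultimately show "v (G N) < v (G i)" by linarith
      qed (use w in \<open>auto simp: G_def\<close>)
      ultimately show False by simp
    qed
  qed
qed

text \<open>
  For the valuation \<open>v\<close> at infinity, every point \<open>x\<close> of a high level has a code, the root of unity \<open>c\<close> closest to
  \<open>x / u\<close>, and two points with the same codes along \<open>M\<close> steps satisfy \<open>v (x - x') \<ge> M - 1\<close>. By the pigeonhole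
  principle there are \<open>j < j'\<close> such that this holds for \<open>f\<^sup>j(s)\<close> and \<open>f\<^sup>j\<^sup>'(s)\<close> for all roots \<open>s\<close> of \<open>P\<close>
  simultaneously. Up to bounded denominators, the product of the differences is a polynomial in \<open>u\<close>; having
  positive value at infinity, it vanishes.
\<close>

lemma no_bounded_branches:
  assumes q: "q \<ge> 2" and B: "E.minimal_poly \<beta> B"
    and nonper: "\<And>n. n > 0 \<Longrightarrow> (step q ^^ n) \<beta> \<noteq> \<beta>"
  shows "\<exists>n1. \<forall>n\<ge>n1. \<forall>P. poly_over ratfield P \<longrightarrow> degree P > 0 \<longrightarrow>
     (\<forall>s. poly P s = 0 \<longrightarrow> poly B ((step q ^^ n) s) = 0) \<longrightarrow> card {s. poly P s = 0} > D"
proof -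
  define f where "f = step q"
  have f: "f x = x ^ q + (u - u ^ q)" for x by (simp add: f_def step_def)
  have B0: "B \<noteq> 0" "poly_over ratfield B" using B by (auto simp: E.minimal_poly_def)
  \<comment> \<open>Periodicity is a polynomial condition over \<open>ratfield\<close>, so it passes
    between conjugates.\<close>
  have nonper': "(f ^^ n) b \<noteq> b" if b: "poly B b = 0" "n > 0" for b n
  proof
    assume per: "(f ^^ n) b = b"
    define h where "h = poly_iterate (step_poly q) n - [:0, 1:]"
    have h: "poly h x = (f ^^ n) x - x" for x
      by (simp add: h_def poly_iterate_step f_def)
    have "poly_over ratfield h" unfolding h_def
      by (intro E.poly_over_diff poly_over_iterate E.poly_over_pCons) auto
    hence "B dvd h" using E.minimal_poly_root[OF B b(1)] per by (auto simp: E.minimal_poly_def h)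
    hence "poly h \<beta> = 0" using B by (auto simp: E.minimal_poly_def elim!: dvdE)
    thus False using nonper[OF b(2)] by (simp add: h f_def)
  qed
  obtain v where v: "valuation v" "\<And>F. F \<noteq> 0 \<Longrightarrow> v (ev F) = - real (degree F)"
    using valuation_at_infinity by blast
  interpret v: valuation v by (rule v(1))
  have u0: "u \<noteq> 0" using u_notin_range \<kappa>_zero by (metis rangeI)
  have v_u: "v u = - 1" using v(2)[of "[:0, 1:]"] by simp
  have v_\<kappa>: "v (\<kappa> c) = 0" if "c \<noteq> 0" for c using v(2)[of "[:c:]"] that by simp
  obtain L where L: "\<And>b. poly B b = 0 \<Longrightarrow> v.vge (- L) b"
  proof
    fix b assume "poly B b = 0"
    moreover have fin: "finite {b. poly B b = 0}" using B0(1) by (rule poly_roots_finite)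
    ultimately have "Min (v ` {b. poly B b = 0}) \<le> v b" by (intro Min_le) auto
    thus "v.vge (- (- Min (v ` {b. poly B b = 0}))) b" by (simp add: v.vge_def)
  qed
  have vt: "v.vge (- real q) (u - u ^ q)"
  proof (rule v.vge_diff)
    have "real q \<ge> 1" using q by simp
    thus "v.vge (- real q) u" using v_u by (simp add: v.vge_def)
    show "v.vge (- real q) (u ^ q)" using v_u u0 by (simp add: v.vge_def v.v_power)
  qed
  \<comment> \<open>The bound L for the roots of B is divided by q at each level, while t, of value
    at least -q, contributes the limit 1.\<close>
  have bound: "v.vge (- max 1 (L / real q ^ n)) x" if "n > 0" "poly B ((f ^^ n) x) = 0" for n x
    using that
  proof (induction n arbitrary: x)
    case (Suc n)
    have "v.vge (- max (real q) (L / real q ^ n)) (f x)"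
    proof (cases "n = 0")
      case True
      thus ?thesis using Suc.prems L[of "f x"] by (auto elim: v.vge_mono)
    next
      case False
      have "poly B ((f ^^ n) (f x)) = 0" using Suc.prems by (simp add: funpow_swap1)
      hence "v.vge (- max 1 (L / real q ^ n)) (f x)" using Suc.IH False by simp
      thus ?thesis by (rule v.vge_mono) (use q in auto)
    qed
    moreover have "v.vge (- max (real q) (L / real q ^ n)) (u - u ^ q)"
      using vt by (rule v.vge_mono) auto
    ultimately have "v.vge (- max (real q) (L / real q ^ n)) (f x - (u - u ^ q))" by (rule v.vge_diff)
    hence "v.vge (- max (real q) (L / real q ^ n)) (x ^ q)" by (simp add: f)
    moreover have "- max (real q) (L / real q ^ n) = real q * (- max 1 (L / real q ^ Suc n))"
      using q by (simp add: max_def field_simps)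
    ultimately have "v.vge (real q * (- max 1 (L / real q ^ Suc n))) (x ^ q)" by simp
    thus ?case by (rule v.vge_powerD) (use q in simp)
  qed simp
  obtain n2 where n2: "n2 > 0" "\<And>n x. n \<ge> n2 \<Longrightarrow> poly B ((f ^^ n) x) = 0 \<Longrightarrow> v.vge (- 1) x"
  proof -
    obtain k where k: "L < real q ^ k" using real_arch_pow[of "real q" L] q by auto
    have "v.vge (- 1) x" if "n \<ge> Suc k" "poly B ((f ^^ n) x) = 0" for n x
    proof -
      have "real q ^ k \<le> real q ^ n" using that q by (intro power_increasing) auto
      hence "L \<le> real q ^ n" using k by linarith
      hence "L / real q ^ n \<le> 1" using q by (simp add: field_simps)
      thus ?thesis using bound[of n x] that by simp
    qed
    thus ?thesis using that[of "Suc k"] by blast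
  qed
  define Z where "Z = {c :: 'k. c ^ q = 1}"
  define small where "small = (\<lambda>x. x = 0 \<or> v x > 0)"
  have small_0: "small 0" by (simp add: small_def)
  have small_add: "small (x + y)" if "small x" "small y" for x y
    using that v.v_add[of x y] by (cases "x = 0 \<or> y = 0 \<or> x + y = 0") (auto simp: small_def)
  have small_mult: "small (x * y)" if "small x" "v.vge 0 y" for x y
    using that v.v_mult[of x y] by (cases "x = 0 \<or> y = 0") (auto simp: small_def v.vge_def)
  have v\<kappa>0: "v.vge 0 (\<kappa> c)" for c using v_\<kappa>[of c] by (cases "c = 0") (auto simp: v.vge_def)
  define Zpoly :: "'k poly" where "Zpoly = monom 1 q + [:- 1:]"
  have Zpoly: "poly Zpoly c = c ^ q - 1" for c by (simp add: Zpoly_def poly_monom)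
  have "coeff Zpoly q = 1" using q unfolding Zpoly_def by (cases q) auto
  hence Zpoly0: "Zpoly \<noteq> 0" by (metis coeff_0 zero_neq_one)
  have finZ: "finite Z" using poly_roots_finite[OF Zpoly0] by (simp add: Z_def Zpoly)
  \<comment> \<open>With y = x / u, the difference y^q - 1 equals (f x - u) / u^q and has value at
    least q - 1; being the product of y - c over the q-th roots of unity c, it has a factor of
    positive value.\<close>
  have code_ex: "\<exists>c\<in>Z. small (x / u - \<kappa> c)" if x: "n \<ge> Suc n2" "poly B ((f ^^ n) x) = 0" for n x
  proof (rule ccontr)
    assume no: "\<not> ?thesis"
    define y where "y = x / u"
    have "(\<Prod>c\<in>#A. y - \<kappa> c) \<noteq> 0 \<and> v (\<Prod>c\<in>#A. y - \<kappa> c) \<le> 0" if "\<And>c. c \<in># A \<Longrightarrow> c \<in> Z" for A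
      using that
    proof (induction A)
      case (add c A)
      have "\<not> small (y - \<kappa> c)" using no add.prems by (auto simp: y_def)
      thus ?case using add by (auto simp: v.v_mult small_def)
    qed simp
    from this[of "proots Zpoly"] have "ev_at Zpoly y \<noteq> 0 \<and> v (ev_at Zpoly y) \<le> 0"
      using Zpoly0 v_\<kappa>[of "lead_coeff Zpoly"] by (simp add: ev_at_eq_prod v.v_mult Zpoly Z_def)
    moreover have "ev_at Zpoly y = y ^ q - 1"
      by (simp add: Zpoly_def ev_at_add ev_at_def[of "monom 1 q"] map_poly_monom poly_monom \<kappa>_uminus)
    moreover have "v.vge 1 (y ^ q - 1)"
    proof -
      obtain m where m: "n = Suc m" using x by (cases n) auto
      have "poly B ((f ^^ m) (f x)) = 0" using x by (simp add: m funpow_swap1)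
      hence fx: "v.vge (- 1) (f x)" using n2(2)[of m "f x"] x m by simp
      have "v.vge (- 1) (f x - u)" using fx v_u by (intro v.vge_diff) (auto simp: v.vge_def)
      moreover have "v.vge (real q) (inverse (u ^ q))"
        using u0 v_u by (simp add: v.vge_def v.v_inverse v.v_power)
      ultimately have "v.vge (- 1 + real q) ((f x - u) * inverse (u ^ q))" by (rule v.vge_mult)
      moreover have "(f x - u) * inverse (u ^ q) = y ^ q - 1"
        using u0 by (simp add: f y_def power_divide field_simps)
      ultimately show ?thesis using q by (auto elim: v.vge_mono)
    qed
    ultimately show False by (auto simp: v.vge_def)
  qed
  define code where "code = (\<lambda>x. SOME c. c \<in> Z \<and> small (x / u - \<kappa> c))"
  have code: "code x \<in> Z \<and> small (x / u - \<kappa> (code x))" if x: "n \<ge> Suc n2" "poly B ((f ^^ n) x) = 0" for n x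
    unfolding code_def by (rule someI_ex) (use code_ex[OF x] in blast)
  \<comment> \<open>y^q - y'^q is (y - y') times T, and T is close to the nonzero constant q c^(q -
    1), which has value 0 here. So x - x' is f x - f x' divided by u^(q - 1) up to a factor of value
    0, a gain of at least 1.\<close>
  have contract: "v.vge (r + 1) (x - x')"
    if c: "c \<in> Z" "small (x / u - \<kappa> c)" "small (x' / u - \<kappa> c)" and r: "v.vge r (f x - f x')" for x x' c r
  proof -
    define y where "y = x / u"
    define y' where "y' = x' / u"
    have y: "v.vge 0 y" "v.vge 0 y'"
      using v.vge_add[of 0 "y - \<kappa> c" "\<kappa> c"] v.vge_add[of 0 "y' - \<kappa> c" "\<kappa> c"] c v\<kappa>0[of c]
      by (auto simp: y_def y'_def small_def v.vge_def)
    have pow: "small (z ^ i - \<kappa> c ^ i)" if "v.vge 0 z" "small (z - \<kappa> c)" for z i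
    proof (induction i)
      case (Suc i)
      have "z ^ Suc i - \<kappa> c ^ Suc i = (z ^ i - \<kappa> c ^ i) * z + (z - \<kappa> c) * \<kappa> c ^ i"
        by (simp add: algebra_simps)
      moreover have "v.vge 0 (\<kappa> c ^ i)" using v\<kappa>0[of "c ^ i"] by (simp add: \<kappa>_power)
      ultimately show ?case using Suc that by (simp add: small_add small_mult)
    qed (simp add: small_def)
    have vpow: "v.vge 0 (z ^ i)" if "v.vge 0 z" for z i using v.vge_power[OF that, of i] by simp
    have term_small: "small (y' ^ (q - Suc i) * y ^ i - \<kappa> (c ^ (q - 1)))" if "i < q" for i
    proof -
      have "q - 1 = (q - Suc i) + i" using that by simp
      hence "\<kappa> (c ^ (q - 1)) = \<kappa> c ^ (q - Suc i) * \<kappa> c ^ i" by (metis \<kappa>_power power_add)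
      hence "y' ^ (q - Suc i) * y ^ i - \<kappa> (c ^ (q - 1)) =
          (y' ^ (q - Suc i) - \<kappa> c ^ (q - Suc i)) * y ^ i + (y ^ i - \<kappa> c ^ i) * \<kappa> c ^ (q - Suc i)"
        by (simp add: algebra_simps)
      moreover have "v.vge 0 (\<kappa> c ^ (q - Suc i))" using v\<kappa>0[of "c ^ (q - Suc i)"] by (simp add: \<kappa>_power)
      ultimately show ?thesis using c y vpow pow[of y] pow[of y'] by (simp add: small_add small_mult y_def y'_def)
    qed
    define T where "T = (\<Sum>i<q. y' ^ (q - Suc i) * y ^ i)"
    have "small (\<Sum>i<m. y' ^ (q - Suc i) * y ^ i - \<kappa> (c ^ (q - 1)))" if "m \<le> q" for m
      using that by (induction m) (auto simp del: One_nat_def intro!: small_0 small_add term_small)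
    from this[of q] have "small (T - \<kappa> (of_nat q * c ^ (q - 1)))"
      by (simp add: T_def sum_subtractf \<kappa>_mult \<kappa>_of_nat)
    moreover have "c \<noteq> 0" using c q by (auto simp: Z_def zero_power)
    hence nz: "of_nat q * c ^ (q - 1) \<noteq> (0 :: 'k)" using q by simp
    ultimately have T: "T \<noteq> 0" "v T = 0"
      using v.add_dominated[of "\<kappa> (of_nat q * c ^ (q - 1))" "T - \<kappa> (of_nat q * c ^ (q - 1))"] v_\<kappa>[OF nz] \<kappa>_nonzero[OF nz]
      by (auto simp: small_def)
    have "f x - f x' = u ^ q * (y ^ q - y' ^ q)"
      using u0 by (simp add: f y_def y'_def power_divide field_simps)
    also have "\<dots> = u ^ q * ((y - y') * T)" by (simp only: T_def power_diff_sumr2)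
    finally have e1: "f x - f x' = u ^ q * ((y - y') * T)" .
    have e2: "x - x' = u * (y - y')" using u0 by (simp add: y_def y'_def field_simps)
    have "x - x' = (f x - f x') * (u * inverse (u ^ q) * inverse T)"
      unfolding e1 e2 using u0 T by (simp add: field_simps)
    moreover have "v.vge 1 (u * inverse (u ^ q) * inverse T)"
      using u0 T v_u q by (simp add: v.vge_def v.v_mult v.v_inverse v.v_power)
    ultimately show ?thesis using v.vge_mult[OF r, of 1] by simp
  qed
  obtain g where g: "g \<noteq> 0" "\<And>c v \<beta>. valuation v \<Longrightarrow> (\<And>F. F \<noteq> 0 \<Longrightarrow> v (ev F) = real (order c F)) \<Longrightarrow>
     poly B \<beta> = 0 \<Longrightarrow> valuation.vge v 0 (ev g * \<beta>)"
    using clear_root_denominators[OF B0(2,1)] by metis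
  \<comment> \<open>The degree of g plus 2: a difference of value at least M - 1 keeps value at
    least 1 after multiplication by \<open>ev g\<close>.\<close>
  define M where "M = degree g + 2"
  \<comment> \<open>An upper bound for the number of tables of codes of at most D roots over M
    steps.\<close>
  define J where "J = card Z ^ (D * M)"
  have "card Z > 0" using finZ by (auto simp: card_gt_0_iff Z_def intro: exI[of _ 1])
  \<comment> \<open>After fewer than J + M iterations a point still has level at least Suc n2, so
    all codes in the tables are defined.\<close>
  define n1 where "n1 = J + M + Suc n2"
  show ?thesis
  proof (intro exI[of _ n1] allI impI, rule ccontr)
    fix n P
    assume n: "n1 \<le> n" and P: "poly_over ratfield P" "degree P > 0"
      and roots: "\<forall>s. poly P s = 0 \<longrightarrow> poly B ((step q ^^ n) s) = 0"
      and "\<not> card {s. poly P s = 0} > D"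
    hence card: "card {s. poly P s = 0} \<le> D" by simp
    define Rt where "Rt = {s. poly P s = 0}"
    have "P \<noteq> 0" using P by auto
    have finR: "finite Rt" unfolding Rt_def using \<open>P \<noteq> 0\<close> by (rule poly_roots_finite)
    have level: "poly B ((f ^^ (n - j)) ((f ^^ j) s)) = 0" if "s \<in> Rt" "j \<le> n" for s j
      using roots that by (simp add: Rt_def f_def funpow_funpow)
    define W where "W = (\<lambda>j. \<lambda>(s, i)\<in>Rt \<times> {..<M}. code ((f ^^ (i + j)) s))"
    have "W ` {..J} \<subseteq> (Rt \<times> {..<M}) \<rightarrow>\<^sub>E Z"
    proof (intro image_subsetI PiE_I)
      fix j p assume j: "j \<in> {..J}" and "p \<in> Rt \<times> {..<M}"
      then obtain s i where p: "p = (s, i)" "s \<in> Rt" "i < M" by auto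
      have "i + j \<le> n" "Suc n2 \<le> n - (i + j)" using j p n by (auto simp: n1_def)
      hence "code ((f ^^ (i + j)) s) \<in> Z" using code[of "n - (i + j)"] level p by blast
      thus "W j p \<in> Z" using p by (simp add: W_def)
    qed (auto simp: W_def)
    hence "card (W ` {..J}) \<le> card ((Rt \<times> {..<M}) \<rightarrow>\<^sub>E Z)"
      using finR finZ by (intro card_mono finite_PiE) auto
    also have "\<dots> = card Z ^ (card Rt * M)"
      using finR by (simp add: card_PiE card_cartesian_product)
    also have "\<dots> \<le> J" unfolding J_def
      using \<open>card Z > 0\<close> card by (intro power_increasing) (auto simp: Rt_def)
    also have "\<dots> < card {..J}" by simp
    finally have "\<not> inj_on W {..J}" by (rule pigeonhole)
    then obtain j j' where "j \<le> J" "j' \<le> J" "W j = W j'" "j \<noteq> j'" by (auto simp: inj_on_def)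
    then obtain j j' where jj: "j < j'" "j' \<le> J" "W j = W j'" by (metis linorder_neq_iff)
    have same: "code ((f ^^ (i + j)) s) = code ((f ^^ (i + j')) s)" if "s \<in> Rt" "i < M" for s i
      using fun_cong[OF jj(3), of "(s, i)"] that by (simp add: W_def)
    \<comment> \<open>Backwards from i = M, where both points have value at least -1; each earlier
      index gains 1 through \<open>contract\<close>.\<close>
    have close: "v.vge (real M - 1) ((f ^^ j) s - (f ^^ j') s)" if s: "s \<in> Rt" for s
    proof -
      have "v.vge (real (M - i) - 1) ((f ^^ (i + j)) s - (f ^^ (i + j')) s)" if "i \<le> M" for i
        using that
      proof (induction "M - i" arbitrary: i)
        case 0
        hence "i = M" by simp
        have "v.vge (- 1) ((f ^^ (M + l)) s)" if "l \<le> J" for l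
          using n2(2)[OF _ level[OF s, of "M + l"]] that n by (simp add: n1_def)
        thus ?case using jj \<open>i = M\<close> by (intro v.vge_diff) auto
      next
        case (Suc m)
        hence i: "i < M" by simp
        have lv: "Suc n2 \<le> n - (i + j)" "Suc n2 \<le> n - (i + j')" "i + j \<le> n" "i + j' \<le> n"
          using jj i n by (auto simp: n1_def)
        have "v.vge (real (M - Suc i) - 1) ((f ^^ (Suc i + j)) s - (f ^^ (Suc i + j')) s)"
          using Suc by (intro Suc.hyps) auto
        hence "v.vge (real (M - Suc i) - 1 + 1) ((f ^^ (i + j)) s - (f ^^ (i + j')) s)"
          using code[OF lv(1) level[OF s lv(3)]] code[OF lv(2) level[OF s lv(4)]] same[OF s i]
          by (intro contract[of "code ((f ^^ (i + j)) s)"]) auto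
        thus ?case using i by (simp add: of_nat_diff)
      qed
      from this[of 0] show ?thesis by simp
    qed
    define h where "h = poly_iterate (step_poly q) j - poly_iterate (step_poly q) j'"
    have h: "poly h x = (f ^^ j) x - (f ^^ j') x" for x
      by (simp add: h_def poly_iterate_step f_def)
    have "poly_over ratfield h" unfolding h_def by (intro E.poly_over_diff poly_over_iterate)
    define Q where "Q = (\<Prod>s\<in>#proots P. poly (smult (ev g) h) s)"
    have "Q \<in> ratfield" unfolding Q_def
      using \<open>poly_over ratfield h\<close> P \<open>P \<noteq> 0\<close> by (intro E.norm_mem E.poly_over_smult ev_in_ratfield)
    have Rt: "s \<in># proots P \<longleftrightarrow> s \<in> Rt" for s using \<open>P \<noteq> 0\<close> by (simp add: Rt_def)
    \<comment> \<open>From (g x)^q = g^(q - 1) (g f(x)) - g^q t, integrality passes from f(x) to its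
      preimage x with the same g; so one denominator serves every level.\<close>
    have node: "valuation.vge w 0 (ev g * x)"
      if w: "valuation w" "\<And>F. F \<noteq> 0 \<Longrightarrow> w (ev F) = real (order c F)" "poly B ((f ^^ m) x) = 0" for w c x m
    proof -
      interpret w: valuation w by (rule w(1))
      have vev: "w.vge 0 (ev F)" for F using w(2) by (cases "F = 0") (auto simp: w.vge_def)
      have t: "u - u ^ q = ev ([:0, 1:] + smult (- 1) ([:0, 1:] ^ q))"
      proof -
        have "ev ([:0, 1:] ^ k) = u ^ k" for k by (induction k) (simp_all add: ev_at_mult)
        thus ?thesis by (simp only: ev_at_add ev_at_smult) (simp add: \<kappa>_uminus)
      qed
      show ?thesis using w(3)
      proof (induction m arbitrary: x)
        case 0
        thus ?case using g(2)[OF w(1,2), of x] by simp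
      next
        case (Suc m)
        have "poly B ((f ^^ m) (f x)) = 0" using Suc.prems by (simp add: funpow_swap1)
        hence "w.vge 0 (ev g * f x)" by (rule Suc.IH)
        hence "w.vge (real (q - 1) * 0 + 0) (ev g ^ (q - 1) * (ev g * f x))"
          using vev by (intro w.vge_mult w.vge_power)
        moreover have "w.vge (real q * 0 + 0) (ev g ^ q * (u - u ^ q))"
          unfolding t using vev by (intro w.vge_mult w.vge_power)
        ultimately have "w.vge 0 (ev g ^ (q - 1) * (ev g * f x) - ev g ^ q * (u - u ^ q))"
          by (intro w.vge_diff) auto
        moreover have "ev g ^ (q - 1) * (ev g * f x) - ev g ^ q * (u - u ^ q) = (ev g * x) ^ q"
        proof -
          have "ev g ^ q = ev g ^ (q - 1) * ev g" using q by (metis Suc_1 Suc_le_D diff_Suc_1 power_Suc2)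
          thus ?thesis by (simp add: f power_mult_distrib algebra_simps)
        qed
        ultimately have "w.vge (real q * 0) ((ev g * x) ^ q)" by simp
        thus ?case by (rule w.vge_powerD) (use q in simp)
      qed
    qed
    have "\<exists>F. Q = ev F"
    proof (rule integral_at_points_imp_polynomial[OF \<open>Q \<in> ratfield\<close>])
      fix c w assume w: "valuation w" "\<And>F. F \<noteq> 0 \<Longrightarrow> w (ev F) = real (order c F)"
      interpret w: valuation w by (rule w(1))
      have "w.vge 0 (poly (smult (ev g) h) s)" if "s \<in># proots P" for s
      proof -
        have "s \<in> Rt" "j \<le> n" "j' \<le> n" using that Rt jj n by (auto simp: n1_def)
        hence "w.vge 0 (ev g * (f ^^ j) s - ev g * (f ^^ j') s)"
          using node[OF w level] by (intro w.vge_diff) auto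
        thus ?thesis by (simp add: h algebra_simps)
      qed
      hence "w.vge (real (size (proots P)) * 0) Q" unfolding Q_def by (rule w.vge_prod_mset)
      thus "w.vge 0 Q" by simp
    qed
    then obtain F where F: "Q = ev F" by blast
    have "v.vge 1 (poly (smult (ev g) h) s)" if "s \<in># proots P" for s
    proof -
      have "v.vge (- real (degree g) + (real M - 1)) (ev g * ((f ^^ j) s - (f ^^ j') s))"
        using close that Rt v(2)[OF g(1)] by (intro v.vge_mult) (auto simp: v.vge_def)
      thus ?thesis by (simp add: h M_def)
    qed
    hence "v.vge (real (size (proots P)) * 1) Q" unfolding Q_def by (rule v.vge_prod_mset)
    hence "v.vge 1 Q" using size_proots[OF \<open>P \<noteq> 0\<close>] P(2) by (auto elim: v.vge_mono)
    hence "F = 0" using v(2)[of F] ev_nonzero[of F] by (cases "F = 0") (auto simp: F v.vge_def)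
    hence "Q = 0" by (simp add: F)
    then obtain s where s: "s \<in> Rt" "ev g * poly h s = 0" by (auto simp: Q_def prod_mset_zero_iff Rt)
    hence "(f ^^ j) s = (f ^^ j') s" using ev_nonzero[OF g(1)] by (simp add: h)
    moreover have "(f ^^ (j' - j)) ((f ^^ j) s) = (f ^^ j') s"
      using jj(1) by (simp add: funpow_funpow)
    ultimately have per: "(f ^^ (j' - j)) ((f ^^ j) s) = (f ^^ j) s" by simp
    have "j \<le> n" using jj n by (simp add: n1_def)
    \<comment> \<open>\<open>b\<close> is f^n(s), hence a root of B, and it inherits the period from
      f^j(s).\<close>
    define b where "b = (f ^^ (n - j)) ((f ^^ j) s)"
    have "(f ^^ (j' - j)) b = b" unfolding b_def by (subst funpow_commute) (simp only: per)
    thus False using nonper'[of b "j' - j"] level[OF s(1) \<open>j \<le> n\<close>] jj(1) by (simp add: b_def)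
  qed
qed

end

section \<open>Growth of degrees along the backward orbit\<close>

context padic_tree
begin

lemma minimal_poly_ex: "\<exists>P. E.minimal_poly x P"
  using algebraic[of x] E.minimal_poly_exists unfolding algebraic_over_def by blast

lemma step_eq: "step q x = x ^ q + t"
  by (simp add: step_def t_def)

lemma step_minus_u: "step q z - u = (u + (z - u)) ^ q - u ^ q"
  by (simp add: step_eq t_def)

lemma finite_level:
  assumes "B \<noteq> 0"
  shows "finite {x. poly B ((step q ^^ n) x) = 0}"
proof (induction n)
  case 0
  show ?case using poly_roots_finite[OF assms] by simp
next
  case (Suc n)
  have fin: "finite {x. step q x = y}" for y
  proof -
    define P where "P = monom 1 q + [:t - y:]"
    have "coeff P q = 1" using q_ge_2 unfolding P_def by (cases q) auto
    hence "P \<noteq> 0" by (metis coeff_0 zero_neq_one)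
    hence "finite {x. poly P x = 0}" by (rule poly_roots_finite)
    moreover have "{x. step q x = y} = {x. poly P x = 0}"
      by (auto simp: P_def poly_monom step_eq algebra_simps)
    ultimately show ?thesis by simp
  qed
  have "{x. poly B ((step q ^^ Suc n) x) = 0} \<subseteq> (\<Union>y\<in>{y. poly B ((step q ^^ n) y) = 0}. {x. step q x = y})"
    by (auto simp: funpow_swap1)
  thus ?case using Suc fin by (meson finite_UN finite_subset)
qed

text \<open>t is integral, so passing to a preimage divides a negative lower bound by q; from some
  level on the bound -\<epsilon> is reached.\<close>

lemma level_bound:
  assumes "B \<noteq> 0"
  obtains n0 where "\<And>n x. n \<ge> n0 \<Longrightarrow> poly B ((step q ^^ n) x) = 0 \<Longrightarrow> vge (- \<epsilon>) x"
proof -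
  obtain L where L: "\<And>b. poly B b = 0 \<Longrightarrow> vge (- L) b"
  proof
    fix b assume "poly B b = 0"
    hence "Min (v ` {b. poly B b = 0}) \<le> v b"
      using poly_roots_finite[OF assms] by (intro Min_le) auto
    thus "vge (- (- Min (v ` {b. poly B b = 0}))) b" by (simp add: vge_def)
  qed
  have q0: "real q \<ge> 1" "q > 0" using q_ge_2 by auto
  have vt: "vge 0 t"
    unfolding t_def using vge_diff[OF vge_u, of "u ^ q"] vge_power[OF vge_u, of q] by simp
  have *: "vge (- max \<epsilon> (L / real q ^ n)) x" if "poly B ((step q ^^ n) x) = 0" for n x
    using that
  proof (induction n arbitrary: x)
    case 0
    thus ?case using L[of x] by (auto elim: vge_mono)
  next
    case (Suc n)
    define A where "A = max \<epsilon> (L / real q ^ n)"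
    have "A \<ge> 0" using \<epsilon>_pos by (simp add: A_def)
    have "vge (- A) (step q x)" using Suc by (simp add: A_def funpow_swap1)
    moreover have "vge (- A) t" using vt \<open>A \<ge> 0\<close> by (elim vge_mono) auto
    ultimately have "vge (- A) (step q x - t)" by (rule vge_diff)
    hence "vge (real q * (- (A / real q))) (x ^ q)" using q0 by (simp add: step_eq)
    hence "vge (- (A / real q)) x" using q0 by (rule_tac vge_powerD)
    moreover have "A / real q \<le> max \<epsilon> (L / real q ^ Suc n)"
    proof (cases "\<epsilon> \<le> L / real q ^ n")
      case True
      thus ?thesis by (simp add: A_def field_simps)
    next
      case False
      have "\<epsilon> / real q \<le> \<epsilon> / 1" using \<epsilon>_pos q0 by (intro divide_left_mono) auto
      thus ?thesis using False by (simp add: A_def)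
    qed
    ultimately show ?case by (auto elim: vge_mono)
  qed
  obtain k where k: "L / \<epsilon> < real q ^ k" using real_arch_pow[of "real q" "L / \<epsilon>"] q_ge_2 by auto
  have "vge (- \<epsilon>) x" if "n \<ge> k" "poly B ((step q ^^ n) x) = 0" for n x
  proof -
    have "real q ^ k \<le> real q ^ n" using that(1) q0 by (intro power_increasing) auto
    hence "L / \<epsilon> \<le> real q ^ n" using k by linarith
    hence "L / real q ^ n \<le> \<epsilon>" using \<epsilon>_pos q0 by (simp add: field_simps)
    thus ?thesis using *[OF that(2)] by simp
  qed
  thus ?thesis using that by blast
qed

text \<open>Below a good point the values of the distances to constants are divided by \<open>q\<close> at each
  level, so the denominators of their irrational parts force ramification.\<close>

lemma degree_above_good:
  assumes z: "good (z - u)" and node: "\<And>i x. (step q ^^ i) x = z \<Longrightarrow> vge (- \<epsilon>) x"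
  shows "\<exists>c\<ge>0. \<forall>m s P. (step q ^^ m) s = z \<longrightarrow> poly_over ratfield P \<longrightarrow> P \<noteq> 0 \<longrightarrow> poly P s = 0 \<longrightarrow>
     real q ^ m \<le> c * real (degree P)"
proof -
  have q0: "real q > 0" using q_ge_2 by simp
  have vu: "vge (- \<epsilon>) u" using vge_u \<epsilon>_pos by (elim vge_mono) auto
  obtain a0 where a0: "z - u \<noteq> \<kappa> a0" "v (z - u - \<kappa> a0) \<notin> \<rat>" "v (z - u - \<kappa> a0) < \<tau>"
    using z by (auto simp: good_def)
  define w where "w = v (z - u - \<kappa> a0)"
  have above: "\<exists>a. x - u \<noteq> \<kappa> a \<and> v (x - u - \<kappa> a) = w / real q ^ i \<and>
      v (x - u - \<kappa> a) \<notin> \<rat> \<and> v (x - u - \<kappa> a) < \<tau>"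
    if "(step q ^^ i) x = z" for i x
    using that
  proof (induction i arbitrary: x)
    case 0
    thus ?case using a0 by (intro exI[of _ a0]) (auto simp: w_def)
  next
    case (Suc i)
    have eq: "(step q ^^ i) (step q x) = z" using Suc.prems by (simp add: funpow_swap1)
    then obtain a where a: "step q x - u \<noteq> \<kappa> a" "v (step q x - u - \<kappa> a) = w / real q ^ i"
      "v (step q x - u - \<kappa> a) \<notin> \<rat>" "v (step q x - u - \<kappa> a) < \<tau>" using Suc.IH by blast
    have "vge (- \<epsilon>) (step q x - u)" "vge (- \<epsilon>) (x - u)"
      using node[OF eq] node[OF Suc.prems] vu by (auto intro: vge_diff)
    then obtain a1 where a1: "x - u \<noteq> \<kappa> a1" "v (x - u - \<kappa> a1) = v (step q x - u - \<kappa> a) / real q"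
      using good_step[OF step_minus_u _ _ a(1,3,4)] by blast
    have "v (x - u - \<kappa> a1) = w / real q ^ Suc i" using a1 a by simp
    moreover have "v (x - u - \<kappa> a1) \<notin> \<rat>" using a1 irrational_div[OF a(3)] by simp
    moreover have "v (x - u - \<kappa> a1) < \<tau>" using a1 less_\<tau>_div[OF a(4)] by simp
    ultimately show ?case using a1 by blast
  qed
  \<comment> \<open>The coefficient s0 of \<open>v u\<close> is nonzero because w is irrational; m
    levels above z it has become s0 / q^m.\<close>
  obtain r0 s0 where rs: "r0 \<in> \<rat>" "s0 \<in> \<rat>" "w = r0 + s0 * v u"
    using v_form[of "z - u - \<kappa> a0"] a0 by (auto simp: w_def)
  have "s0 \<noteq> 0" using a0(2) rs by (auto simp: w_def)
  show ?thesis
  proof (intro exI[of _ "\<bar>s0\<bar>"] conjI allI impI)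
    fix m s P
    assume s: "(step q ^^ m) s = z" and P: "poly_over ratfield P" "P \<noteq> 0" "poly P s = 0"
    obtain a where a: "s - u \<noteq> \<kappa> a" "v (s - u - \<kappa> a) = w / real q ^ m" using above[OF s] by blast
    define P' where "P' = pcompose P [:u + \<kappa> a, 1:]"
    have P': "poly_over ratfield P'"
      unfolding P'_def using P u_in_ratfield \<kappa>_in_ratfield
      by (intro E.poly_over_pcompose E.poly_over_pCons E.mems) auto
    have deg: "degree P' = degree P" by (simp add: P'_def degree_pcompose)
    have "P' \<noteq> 0" unfolding P'_def using P(2) by (subst pcompose_eq_0_iff) auto
    moreover have "poly P' (s - u - \<kappa> a) = 0" using P by (simp add: P'_def poly_pcompose)
    moreover have "v (s - u - \<kappa> a) = r0 / real q ^ m + (s0 / real q ^ m) * v u"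
      using a rs by (simp add: add_divide_distrib)
    moreover have "r0 / real q ^ m \<in> \<rat>" "s0 / real q ^ m \<in> \<rat>" "s0 / real q ^ m \<noteq> 0"
      using rs \<open>s0 \<noteq> 0\<close> q0 by auto
    moreover have "s - u - \<kappa> a \<noteq> 0" using a by simp
    ultimately have "1 \<le> real (degree P') * \<bar>s0 / real q ^ m\<bar>"
      using degree_lower_bound P' by blast
    thus "real q ^ m \<le> \<bar>s0\<bar> * real (degree P)"
      using q0 by (simp add: deg abs_divide field_simps)
  qed simp
qed

text \<open>The conjugates of f^(n - N)(s) outnumber \<open>Bad N\<close>, so one of them has only
  good preimages, and some conjugate s' of s lies above it. The degree bound for s' is one for s.
  Finitely many good points occur at level N + 1, so one constant suffices.\<close>

theorem degree_growth:
  assumes nonper: "\<And>n. n > 0 \<Longrightarrow> (step q ^^ n) \<beta> \<noteq> \<beta>"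
  shows "\<exists>c. \<forall>n s P. (step q ^^ n) s = \<beta> \<longrightarrow> poly_over ratfield P \<longrightarrow> P \<noteq> 0 \<longrightarrow> poly P s = 0 \<longrightarrow>
     real q ^ n \<le> c * real (degree P)"
proof -
  have q0: "real q \<ge> 1" using q_ge_2 by simp
  obtain B where B: "E.minimal_poly \<beta> B"
    using minimal_poly_ex by blast
  hence B0: "B \<noteq> 0" "poly_over ratfield B" "poly B \<beta> = 0" by (auto simp: E.minimal_poly_def)
  obtain n0 where n0: "\<And>n x. n \<ge> n0 \<Longrightarrow> poly B ((step q ^^ n) x) = 0 \<Longrightarrow> vge (- \<epsilon>) x"
    using level_bound[OF B0(1)] by blast
  have vu: "vge (- \<epsilon>) u" using vge_u \<epsilon>_pos by (elim vge_mono) auto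
  \<comment> \<open>A point is classified by one of its preimages, one level higher: this is the
    form in which \<open>not_good_siblings\<close> compares two points.\<close>
  define Bad where "Bad = (\<lambda>n. {x. poly B ((step q ^^ n) x) = 0 \<and> (\<exists>z. step q z = x \<and> \<not> good (z - u))})"
  have Bad_step: "step q ` Bad (Suc n) \<subseteq> Bad n \<and> inj_on (step q) (Bad (Suc n))" if n: "n \<ge> n0" for n
  proof
    show "step q ` Bad (Suc n) \<subseteq> Bad n"
    proof (rule image_subsetI)
      fix x assume "x \<in> Bad (Suc n)"
      then obtain z where x: "poly B ((step q ^^ Suc n) x) = 0" and z: "step q z = x" "\<not> good (z - u)"
        by (auto simp: Bad_def)
      have "poly B ((step q ^^ Suc (Suc n)) z) = 0" using x z by (simp add: funpow_swap1)
      hence "vge (- \<epsilon>) (z - u)" using n0[of "Suc (Suc n)" z] n vu by (intro vge_diff) auto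
      moreover have "vge (- \<epsilon>) (x - u)" using n0[of "Suc n" x] n vu x by (intro vge_diff) auto
      \<comment> \<open>Goodness passes to preimages, so the image x of the non-good z is non-good,
        and x is the witness placing \<open>step q x\<close> in \<open>Bad n\<close>.\<close>
      ultimately have "\<not> good (x - u)" using good_child[OF step_minus_u[of z]] z by auto
      thus "step q x \<in> Bad n" using x by (auto simp: Bad_def funpow_swap1)
    qed
    show "inj_on (step q) (Bad (Suc n))"
    proof (rule inj_onI, rule ccontr)
      fix x x' assume "x \<in> Bad (Suc n)" "x' \<in> Bad (Suc n)" and eq: "step q x = step q x'" and "x \<noteq> x'"
      then obtain z z' where x: "poly B ((step q ^^ Suc n) x) = 0" and z: "step q z = x" "\<not> good (z - u)"
        and x': "poly B ((step q ^^ Suc n) x') = 0" and z': "step q z' = x'" "\<not> good (z' - u)"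
        by (auto simp: Bad_def)
      have "poly B ((step q ^^ Suc (Suc n)) z) = 0" "poly B ((step q ^^ Suc (Suc n)) z') = 0"
        using x z x' z' by (simp_all add: funpow_swap1)
      hence "vge (- \<epsilon>) z" "vge (- \<epsilon>) z'" using n0[of "Suc (Suc n)"] n by auto
      thus False using not_good_siblings[of x x' z z'] eq \<open>x \<noteq> x'\<close> z z' by (simp add: step_eq)
    qed
  qed
  define D where "D = card (Bad n0)"
  have fin: "finite (Bad n)" for n
    by (rule finite_subset[OF _ finite_level[OF B0(1), of n]]) (auto simp: Bad_def)
  have card_Bad: "card (Bad n) \<le> D" if "n \<ge> n0" for n
    using that
  proof (induction n rule: dec_induct)
    case (step n)
    have "card (Bad (Suc n)) \<le> card (Bad n)"
      using Bad_step[of n] step fin by (intro card_inj_on_le) auto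
    thus ?case using step by simp
  qed (simp add: D_def)
  obtain n1 where n1: "\<And>n P. n \<ge> n1 \<Longrightarrow> poly_over ratfield P \<Longrightarrow> degree P > 0 \<Longrightarrow>
     (\<And>s. poly P s = 0 \<Longrightarrow> poly B ((step q ^^ n) s) = 0) \<Longrightarrow> card {s. poly P s = 0} > D"
    using no_bounded_branches[OF q_ge_2 B nonper, of D] by blast
  define N where "N = max n0 n1"
  have deg_pos: "degree P > 0" if "P \<noteq> 0" "poly P s = 0" for P :: "'a poly" and s
    using that by (auto elim!: degree_eq_zeroE intro: Nat.gr0I)
  have conj: "\<exists>x. poly P' x = 0 \<and> poly B ((step q ^^ N) x) = 0 \<and> (\<forall>z. step q z = x \<longrightarrow> good (z - u))"
    if x0: "poly B ((step q ^^ N) x0) = 0" and P': "E.minimal_poly x0 P'" for x0 P'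
  proof -
    have P0: "poly_over ratfield P'" "P' \<noteq> 0" "poly P' x0 = 0" using P' by (auto simp: E.minimal_poly_def)
    define H where "H = pcompose B (poly_iterate (step_poly q) N)"
    have H: "poly H x = poly B ((step q ^^ N) x)" for x
      by (simp add: H_def poly_pcompose poly_iterate_step)
    have "poly_over ratfield H" unfolding H_def using B0 poly_over_iterate by (intro E.poly_over_pcompose)
    hence "P' dvd H" using P' x0 by (auto simp: E.minimal_poly_def H)
    hence roots: "poly B ((step q ^^ N) x) = 0" if "poly P' x = 0" for x
      using that unfolding H[symmetric] by (auto elim!: dvdE)
    have "card {x. poly P' x = 0} > D"
      using n1[of N P'] P0 deg_pos roots by (auto simp: N_def)
    hence "\<not> {x. poly P' x = 0} \<subseteq> Bad N"
      using card_mono[OF fin, of "{x. poly P' x = 0}" N] card_Bad[of N] by (auto simp: N_def)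
    then obtain x where "poly P' x = 0" "x \<notin> Bad N" by blast
    thus ?thesis using roots by (auto simp: Bad_def)
  qed
  define T where "T = {z. poly B ((step q ^^ Suc N) z) = 0 \<and> good (z - u)}"
  have finT: "finite T"
    by (rule finite_subset[OF _ finite_level[OF B0(1), of "Suc N"]]) (auto simp: T_def)
  have "\<exists>c\<ge>0. \<forall>m s P. (step q ^^ m) s = z \<longrightarrow> poly_over ratfield P \<longrightarrow> P \<noteq> 0 \<longrightarrow> poly P s = 0 \<longrightarrow>
     real q ^ m \<le> c * real (degree P)" if z: "z \<in> T" for z
  proof (rule degree_above_good)
    show "good (z - u)" using z by (simp add: T_def)
    fix i x assume x: "(step q ^^ i) x = z"
    have "(step q ^^ (Suc N + i)) x = (step q ^^ Suc N) z"
      unfolding x[symmetric] by (simp only: funpow_funpow)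
    hence "poly B ((step q ^^ (Suc N + i)) x) = 0" using z unfolding T_def by (simp only: mem_Collect_eq)
    thus "vge (- \<epsilon>) x" using n0[of "Suc N + i" x] by (simp add: N_def)
  qed
  then obtain c where c: "\<And>z. z \<in> T \<Longrightarrow> c z \<ge> 0"
    "\<And>z m s P. z \<in> T \<Longrightarrow> (step q ^^ m) s = z \<Longrightarrow> poly_over ratfield P \<Longrightarrow> P \<noteq> 0 \<Longrightarrow> poly P s = 0 \<Longrightarrow>
     real q ^ m \<le> c z * real (degree P)" by metis
  define c0 where "c0 = sum c T"
  have c0: "c z \<le> c0" if "z \<in> T" for z
    unfolding c0_def using that c(1) finT by (intro member_le_sum) auto
  have c0_ge: "c0 \<ge> 0" unfolding c0_def using c(1) by (intro sum_nonneg)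
  \<comment> \<open>The summand q^N covers n \<le> N, where a degree of at least 1 suffices; the
    factor q^(Suc N) makes up for counting heights from level Suc N.\<close>
  show ?thesis
  proof (intro exI[of _ "real q ^ N + real q ^ Suc N * c0"] allI impI)
    fix n s P
    assume s: "(step q ^^ n) s = \<beta>" and P: "poly_over ratfield P" "P \<noteq> 0" "poly P s = 0"
    have degP: "real (degree P) \<ge> 1" using deg_pos[OF P(2,3)] by simp
    show "real q ^ n \<le> (real q ^ N + real q ^ Suc N * c0) * real (degree P)"
    proof (cases "n \<le> N")
      case True
      have "real q ^ n \<le> real q ^ N * 1" using True q0 by (simp add: power_increasing)
      also have "\<dots> \<le> (real q ^ N + real q ^ Suc N * c0) * real (degree P)"
        using degP c0_ge q0 by (intro mult_mono) auto
      finally show ?thesis .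
    next
      case False
      define m where "m = n - Suc N"
      have n: "n = N + Suc m" using False by (simp add: m_def)
      obtain M where M: "E.minimal_poly s M" using E.minimal_poly_exists[OF P] by blast
      define h where "h = poly_iterate (step_poly q) (Suc m)"
      have h: "poly h x = (step q ^^ Suc m) x" for x by (simp only: h_def poly_iterate_step)
      have "poly B ((step q ^^ N) (poly h s)) = 0"
        unfolding h funpow_funpow n[symmetric] s by (rule B0(3))
      moreover obtain P' where P': "E.minimal_poly (poly h s) P'"
        using minimal_poly_ex by blast
      ultimately obtain x where x: "poly P' x = 0" "poly B ((step q ^^ N) x) = 0"
        "\<And>z. step q z = x \<Longrightarrow> good (z - u)" using conj by blast
      obtain s' where s': "poly M s' = 0" "poly h s' = x"
        using E.minimal_poly_conj_surj[OF M _ P' x(1)] poly_over_iterate by (auto simp: h_def)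
      define z where "z = (step q ^^ m) s'"
      have zx: "step q z = x" using s'(2) by (simp add: h z_def)
      hence "z \<in> T" using x by (auto simp: T_def funpow_swap1)
      moreover have "poly_over ratfield M" "M \<noteq> 0" using M by (auto simp: E.minimal_poly_def)
      ultimately have "real q ^ m \<le> c z * real (degree M)" using c(2) s'(1) z_def by blast
      also have "\<dots> \<le> c0 * real (degree P)"
      proof (intro mult_mono)
        have "M dvd P" using M P by (auto simp: E.minimal_poly_def)
        thus "real (degree M) \<le> real (degree P)" using P(2) by (simp add: dvd_imp_degree_le)
      qed (use c0 \<open>z \<in> T\<close> c0_ge in auto)
      finally have "real q ^ m \<le> c0 * real (degree P)" .
      hence "real q ^ Suc N * real q ^ m \<le> real q ^ Suc N * (c0 * real (degree P))"
        by (intro mult_left_mono) auto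
      also have "\<dots> \<le> real q ^ N * real (degree P) + real q ^ Suc N * (c0 * real (degree P))" by simp
      also have "\<dots> = (real q ^ N + real q ^ Suc N * c0) * real (degree P)" by (simp add: algebra_simps)
      finally show ?thesis by (simp add: n power_add mult.assoc)
    qed
  qed
qed

end

section \<open>Function fields of curves\<close>

lemma mpoly_sum_monomials:
  "P = (\<Sum>m\<in>Poly_Mapping.keys P. Poly_Mapping.single m (Poly_Mapping.lookup P m))"
  by (rule poly_mapping_eqI)
    (auto simp: lookup_sum lookup_single when_def in_keys_iff)

lemma mpeval_superset:
  assumes "f 0 = 0" "finite S" "Poly_Mapping.keys P \<subseteq> S"
  shows "mpeval f x P = (\<Sum>m\<in>S. f (Poly_Mapping.lookup P m) *
    (\<Prod>v\<in>Poly_Mapping.keys m. x v ^ Poly_Mapping.lookup m v))"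
  unfolding mpeval_def using assms
  by (intro sum.mono_neutral_left) (auto simp: in_keys_iff)

lemma monomial_value_mult:
  fixes x :: "'v \<Rightarrow> 'a::comm_semiring_1" and m n :: "'v \<Rightarrow>\<^sub>0 nat"
  shows "(\<Prod>v\<in>Poly_Mapping.keys (m + n). x v ^ Poly_Mapping.lookup (m + n) v) =
    (\<Prod>v\<in>Poly_Mapping.keys m. x v ^ Poly_Mapping.lookup m v) *
    (\<Prod>v\<in>Poly_Mapping.keys n. x v ^ Poly_Mapping.lookup n v)"
proof -
  let ?S = "Poly_Mapping.keys m \<union> Poly_Mapping.keys n"
  have *: "(\<Prod>v\<in>Poly_Mapping.keys l. x v ^ Poly_Mapping.lookup l v) = (\<Prod>v\<in>?S. x v ^ Poly_Mapping.lookup l v)"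
    if "Poly_Mapping.keys l \<subseteq> ?S" for l :: "'v \<Rightarrow>\<^sub>0 nat"
    using that by (intro prod.mono_neutral_left) (auto simp: in_keys_iff)
  show ?thesis
    by (subst (1 2 3) *) (auto simp: lookup_add power_add prod.distrib in_keys_iff dest: keys_add[THEN subsetD])
qed

lemma mpeval_add:
  assumes "f 0 = 0" "\<And>a b. f (a + b) = f a + f b"
  shows "mpeval f x (P + Q) = mpeval f x P + mpeval f x Q"
proof -
  let ?S = "Poly_Mapping.keys P \<union> Poly_Mapping.keys Q"
  show ?thesis
    using assms keys_add[of P Q]
    by (subst (1 2 3) mpeval_superset[of f ?S]) (auto simp: lookup_add distrib_right sum.distrib)
qed

lemma mpeval_single:
  assumes "f 0 = 0"
  shows "mpeval f x (Poly_Mapping.single m c) = f c * (\<Prod>v\<in>Poly_Mapping.keys m. x v ^ Poly_Mapping.lookup m v)"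
  using assms by (subst mpeval_superset[of f "{m}"]) auto

lemma mpeval_sum:
  assumes "f 0 = 0" "\<And>a b. f (a + b) = f a + f b"
  shows "mpeval f x (sum P I) = (\<Sum>i\<in>I. mpeval f x (P i))"
proof (induction I rule: infinite_finite_induct)
  case (insert i I)
  thus ?case by (simp add: mpeval_add[OF assms])
qed (auto simp: mpeval_def)

lemma mpeval_mult:
  fixes f :: "'k::comm_semiring_1 \<Rightarrow> 'a::comm_semiring_1"
  assumes f: "f 0 = 0" "\<And>a b. f (a + b) = f a + f b" "\<And>a b. f (a * b) = f a * f b"
  shows "mpeval f x (P * Q) = mpeval f x P * mpeval f x Q"
proof -
  have single: "mpeval f x (Poly_Mapping.single m a * Poly_Mapping.single n b) =
      mpeval f x (Poly_Mapping.single m a) * mpeval f x (Poly_Mapping.single n b)" for m n a b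
    using f by (simp add: mult_single mpeval_single monomial_value_mult mult_ac)
  have "mpeval f x (Poly_Mapping.single m a * Q) = mpeval f x (Poly_Mapping.single m a) * mpeval f x Q" for m a
    by (subst (1 2) mpoly_sum_monomials[of Q])
      (simp add: sum_distrib_left mpeval_sum[OF f(1,2)] single)
  thus ?thesis
    by (subst (1 2) mpoly_sum_monomials[of P])
      (simp add: sum_distrib_right mpeval_sum[OF f(1,2)])
qed

lemma homogeneous_0: "homogeneous d 0"
  by (simp add: homogeneous_def)

lemma homogeneous_1: "homogeneous 0 1"
  by (simp add: homogeneous_def)

lemma homogeneous_add: "homogeneous d P \<Longrightarrow> homogeneous d Q \<Longrightarrow> homogeneous d (P + Q)"
  using keys_add[of P Q] by (auto simp: homogeneous_def)

lemma total_degree_add: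
  fixes m n :: "'v \<Rightarrow>\<^sub>0 nat"
  shows "(\<Sum>v\<in>Poly_Mapping.keys (m + n). Poly_Mapping.lookup (m + n) v) =
    (\<Sum>v\<in>Poly_Mapping.keys m. Poly_Mapping.lookup m v) + (\<Sum>v\<in>Poly_Mapping.keys n. Poly_Mapping.lookup n v)"
proof -
  let ?S = "Poly_Mapping.keys m \<union> Poly_Mapping.keys n"
  have *: "(\<Sum>v\<in>Poly_Mapping.keys l. Poly_Mapping.lookup l v) = (\<Sum>v\<in>?S. Poly_Mapping.lookup l v)"
    if "Poly_Mapping.keys l \<subseteq> ?S" for l :: "'v \<Rightarrow>\<^sub>0 nat"
    using that by (intro sum.mono_neutral_left) (auto simp: in_keys_iff)
  show ?thesis
    by (subst (1 2 3) *) (auto simp: lookup_add sum.distrib in_keys_iff dest: keys_add[THEN subsetD])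
qed

lemma homogeneous_mult: "homogeneous d P \<Longrightarrow> homogeneous e Q \<Longrightarrow> homogeneous (d + e) (P * Q)"
  using keys_mult[of P Q] by (fastforce simp: homogeneous_def total_degree_add)

lemma homogeneous_single: "(\<Sum>v\<in>Poly_Mapping.keys m. Poly_Mapping.lookup m v) = d \<Longrightarrow>
    homogeneous d (Poly_Mapping.single m c)"
  by (simp add: homogeneous_def)

definition coord :: "'n \<Rightarrow> ('n, 'k::comm_ring_1) mpoly" where
  "coord i = Poly_Mapping.single (Poly_Mapping.single i 1) 1"

lemma homogeneous_coord_power: "homogeneous d (coord i ^ d)"
proof (induction d)
  case (Suc d)
  have "homogeneous 1 (coord i :: ('a, 'b) mpoly)" by (simp add: coord_def homogeneous_single)
  hence "homogeneous (1 + d) (coord i * coord i ^ d :: ('a, 'b) mpoly)" using Suc by (rule homogeneous_mult)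
  thus ?case by simp
qed (simp add: homogeneous_1)

abbreviation mpval :: "'k::comm_ring_1 ^ 'n::finite \<Rightarrow> ('n, 'k) mpoly \<Rightarrow> 'k" where
  "mpval x P \<equiv> mpeval (\<lambda>c. c) (vec_nth x) P"

lemma mpval_mult: "mpval x (P * Q) = mpval x P * mpval x Q"
  by (rule mpeval_mult) auto

lemma mpval_1: "mpval x 1 = 1"
  by (simp add: mpeval_def)

lemma mpval_coord_power: "mpval x (coord i ^ d) = (vec_nth x i) ^ d"
proof (induction d)
  case (Suc d)
  have "mpval x (coord i) = vec_nth x i" by (simp add: coord_def mpeval_single)
  thus ?case using Suc by (simp add: mpval_mult)
qed (simp add: mpval_1)

locale function_field =
  fixes V :: "('k::alg_closed_field ^ 'n::finite) set" and \<iota> :: "'k \<Rightarrow> 'a::field"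
    and \<phi> :: "('n, 'k) mpoly \<times> ('n, 'k) mpoly \<Rightarrow> 'a"
  assumes V_nonempty: "V \<noteq> {}" and V_nonzero: "x \<in> V \<Longrightarrow> x \<noteq> 0"
    and \<phi>_surj: "\<phi> ` rational_fractions V = UNIV"
    and \<phi>_const: "\<phi> (Poly_Mapping.single 0 c, 1) = \<iota> c"
    and \<phi>_eq: "(F, G) \<in> rational_fractions V \<Longrightarrow> (F', G') \<in> rational_fractions V \<Longrightarrow>
      \<phi> (F, G) = \<phi> (F', G') \<longleftrightarrow> vanishes_on (F * G' - F' * G) V"
    and \<phi>_add: "(F, G) \<in> rational_fractions V \<Longrightarrow> (F', G') \<in> rational_fractions V \<Longrightarrow>
      \<phi> (F * G' + F' * G, G * G') = \<phi> (F, G) + \<phi> (F', G')"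
    and \<phi>_mult: "(F, G) \<in> rational_fractions V \<Longrightarrow> (F', G') \<in> rational_fractions V \<Longrightarrow>
      \<phi> (F * F', G * G') = \<phi> (F, G) * \<phi> (F', G')"
begin

lemma fractionI: "homogeneous d F \<Longrightarrow> homogeneous d G \<Longrightarrow> x \<in> V \<Longrightarrow> mpval x G \<noteq> 0 \<Longrightarrow>
    (F, G) \<in> rational_fractions V"
  by (auto simp: rational_fractions_def vanishes_on_def)

lemma const_fraction: "(Poly_Mapping.single 0 c, 1) \<in> rational_fractions V"
proof -
  obtain x where "x \<in> V" using V_nonempty by blast
  thus ?thesis by (intro fractionI[of 0 _ _ x]) (auto simp: homogeneous_single homogeneous_1 mpval_1)
qed

lemma vanishes_on_0: "vanishes_on 0 V"
  by (simp add: vanishes_on_def mpeval_def)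

lemma \<iota>_add: "\<iota> (a + b) = \<iota> a + \<iota> b"
  using \<phi>_add[OF const_fraction[of a] const_fraction[of b]] by (simp add: \<phi>_const flip: single_add)

lemma \<iota>_mult: "\<iota> (a * b) = \<iota> a * \<iota> b"
  using \<phi>_mult[OF const_fraction[of a] const_fraction[of b]] by (simp add: \<phi>_const mult_single)

lemma \<iota>_0: "\<iota> 0 = 0"
  using \<iota>_add[of 0 0] add_left_cancel[of "\<iota> 0" "\<iota> 0" 0] by simp

lemma \<iota>_1: "\<iota> 1 = 1"
proof -
  obtain x where x: "x \<in> V" using V_nonempty by blast
  have "\<not> vanishes_on (Poly_Mapping.single 0 1 * 1 - Poly_Mapping.single 0 0 * 1) V"
    using x by (auto simp: vanishes_on_def mpval_1)
  hence "\<iota> 1 \<noteq> \<iota> 0"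
    using \<phi>_eq[OF const_fraction[of 1] const_fraction[of 0]] by (metis \<phi>_const)
  thus ?thesis using \<iota>_mult[of 1 1] \<iota>_0 by simp
qed

text \<open>At a point where G does not vanish, choose a nonzero coordinate x_j. Then F/G is the
  quotient of F/x_j^d by G/x_j^d, and both are polynomials in the ratios x_i/x_j over the constants.
  So finitely many ratios generate the field.\<close>

lemma generated_by_coordinates:
  assumes const: "\<And>c. \<iota> c \<in> L"
    and gen: "\<And>i j. \<phi> (coord i, coord j) \<in> L"
    and add: "\<And>x y. x \<in> L \<Longrightarrow> y \<in> L \<Longrightarrow> x + y \<in> L"
    and mult: "\<And>x y. x \<in> L \<Longrightarrow> y \<in> L \<Longrightarrow> x * y \<in> L"
    and inv: "\<And>x. x \<in> L \<Longrightarrow> inverse x \<in> L"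
  shows "L = UNIV"
proof -
  have main: "\<phi> (F, coord j ^ d) \<in> L" if x: "x \<in> V" "vec_nth x j \<noteq> 0" and F: "homogeneous d F" for x j d F
  proof -
    have frac: "(G, coord j ^ e) \<in> rational_fractions V" if "homogeneous e G" for G e
      using that x by (intro fractionI[of e _ _ x]) (auto simp: homogeneous_coord_power mpval_coord_power)
    have mono: "\<phi> (Poly_Mapping.single m c, coord j ^ d) \<in> L"
      if "(\<Sum>v\<in>Poly_Mapping.keys m. Poly_Mapping.lookup m v) = d" for m c d
      using that
    proof (induction d arbitrary: m)
      case 0
      hence "\<And>v. v \<in> Poly_Mapping.keys m \<Longrightarrow> Poly_Mapping.lookup m v = 0" by simp
      hence "m = 0" by (metis poly_mapping_eqI lookup_zero in_keys_iff)
      thus ?case using const by (simp add: \<phi>_const)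
    next
      case (Suc d)
      then obtain i where i: "i \<in> Poly_Mapping.keys m" by fastforce
      define n where "n = m - Poly_Mapping.single i 1"
      have m: "m = n + Poly_Mapping.single i 1"
        by (rule poly_mapping_eqI) (use i in \<open>auto simp: n_def lookup_add lookup_minus lookup_single when_def in_keys_iff\<close>)
      have deg: "(\<Sum>v\<in>Poly_Mapping.keys n. Poly_Mapping.lookup n v) = d"
        using Suc.prems unfolding m total_degree_add by simp
      have "homogeneous 1 (coord i :: ('n, 'k) mpoly)" using homogeneous_coord_power[of 1 i] by simp
      hence fr: "(coord i, coord j) \<in> rational_fractions V" using frac[of 1 "coord i"] by simp
      have "\<phi> (Poly_Mapping.single n c, coord j ^ d) * \<phi> (coord i, coord j) \<in> L"
        by (intro mult gen Suc.IH deg)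
      also have "\<phi> (Poly_Mapping.single n c, coord j ^ d) * \<phi> (coord i, coord j) =
          \<phi> (Poly_Mapping.single n c * coord i, coord j ^ d * coord j)"
        using \<phi>_mult[OF frac[OF homogeneous_single[OF deg]] fr] by simp
      also have "Poly_Mapping.single n c * coord i = Poly_Mapping.single m c"
        by (simp add: coord_def mult_single m)
      also have "coord j ^ d * coord j = (coord j ^ Suc d :: ('n, 'k) mpoly)" by (simp add: mult.commute)
      finally show ?case .
    qed
    have "\<phi> (\<Sum>m\<in>S. Poly_Mapping.single m (Poly_Mapping.lookup F m), coord j ^ d) \<in> L \<and>
        homogeneous d (\<Sum>m\<in>S. Poly_Mapping.single m (Poly_Mapping.lookup F m))"
      if "finite S" "S \<subseteq> Poly_Mapping.keys F" for S
      using that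
    proof (induction S)
      case empty
      have "vanishes_on (0 * 1 - Poly_Mapping.single 0 0 * coord j ^ d) V" by (simp add: vanishes_on_0)
      hence "\<phi> (0, coord j ^ d) = \<phi> (Poly_Mapping.single 0 0, 1)"
        using \<phi>_eq[OF frac[OF homogeneous_0] const_fraction] by blast
      thus ?case using const[of 0] \<phi>_const[of 0] by (simp add: homogeneous_0)
    next
      case (insert m S)
      define A where "A = Poly_Mapping.single m (Poly_Mapping.lookup F m)"
      define B where "B = (\<Sum>m\<in>S. Poly_Mapping.single m (Poly_Mapping.lookup F m))"
      have deg: "(\<Sum>v\<in>Poly_Mapping.keys m. Poly_Mapping.lookup m v) = d"
        using F insert by (auto simp: homogeneous_def)
      have A: "homogeneous d A" "\<phi> (A, coord j ^ d) \<in> L"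
        using deg mono by (auto simp: A_def homogeneous_single)
      have B: "homogeneous d B" "\<phi> (B, coord j ^ d) \<in> L" using insert by (auto simp: B_def)
      have AB: "homogeneous d (A + B)" using A B by (intro homogeneous_add)
      let ?X = "coord j ^ d :: ('n, 'k) mpoly"
      have "homogeneous (d + d) (A * ?X + B * ?X)"
        using A B by (intro homogeneous_add homogeneous_mult homogeneous_coord_power)
      hence fr2: "(A * ?X + B * ?X, ?X * ?X) \<in> rational_fractions V"
        using frac[of "d + d"] by (simp add: power_add)
      \<comment> \<open>The rule for sums yields the squared denominator; equality of fractions
        brings it back to x_j^d.\<close>
      have "vanishes_on ((A * ?X + B * ?X) * ?X - (A + B) * (?X * ?X)) V"
        using vanishes_on_0 by (simp add: algebra_simps)
      hence "\<phi> (A + B, ?X) = \<phi> (A * ?X + B * ?X, ?X * ?X)"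
        using \<phi>_eq[OF fr2 frac[OF AB]] by simp
      also have "\<dots> = \<phi> (A, ?X) + \<phi> (B, ?X)" using \<phi>_add[OF frac[OF A(1)] frac[OF B(1)]] .
      finally have "\<phi> (A + B, ?X) \<in> L" using add A B by simp
      thus ?case using insert AB by (simp add: A_def B_def)
    qed
    from this[of "Poly_Mapping.keys F"] show ?thesis by (simp flip: mpoly_sum_monomials)
  qed
  have "z \<in> L" for z
  proof -
    obtain F G where FG: "(F, G) \<in> rational_fractions V" "z = \<phi> (F, G)"
      using \<phi>_surj by (metis UNIV_I image_iff surj_pair)
    then obtain d x where d: "homogeneous d F" "homogeneous d G" and x: "x \<in> V" "mpval x G \<noteq> 0"
      by (auto simp: rational_fractions_def vanishes_on_def)
    obtain j where j: "vec_nth x j \<noteq> 0" using V_nonzero[OF x(1)] by (auto simp: vec_eq_iff)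
    let ?X = "coord j ^ d :: ('n, 'k) mpoly"
    have X: "mpval x ?X \<noteq> 0" using j by (simp add: mpval_coord_power)
    have frG: "(G, ?X) \<in> rational_fractions V" and frF: "(F, ?X) \<in> rational_fractions V"
      using d x X by (auto intro!: fractionI[of d _ _ x] homogeneous_coord_power)
    have frFG: "(F * G, G * ?X) \<in> rational_fractions V"
      using d x X by (intro fractionI[of "d + d" _ _ x] homogeneous_mult homogeneous_coord_power)
        (auto simp: mpval_mult)
    have "vanishes_on (F * G * ?X - F * (G * ?X)) V" using vanishes_on_0 by (simp add: algebra_simps)
    hence eq: "\<phi> (F, ?X) = \<phi> (F, G) * \<phi> (G, ?X)"
      using \<phi>_eq[OF frFG frF] \<phi>_mult[OF FG(1) frG] by simp
    have "\<not> vanishes_on (G * 1 - Poly_Mapping.single 0 0 * ?X) V" using x by (auto simp: vanishes_on_def)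
    hence "\<phi> (G, ?X) \<noteq> 0"
      using \<phi>_eq[OF frG const_fraction[of 0]] \<phi>_const[of 0] \<iota>_0 by metis
    hence "z = \<phi> (F, ?X) * inverse (\<phi> (G, ?X))" using eq FG by simp
    thus ?thesis using main[OF x(1) j] d mult inv by simp
  qed
  thus ?thesis by blast
qed

end

text \<open>Unlike \<open>alg_independent\<close> of a set, a relation of an ordered pair makes
  sense for x = y, where {x, y} would collapse to one element; there X - Y is always a
  relation.\<close>

definition dependent_pair :: "('k::zero \<Rightarrow> 'a::field) \<Rightarrow> 'a \<Rightarrow> 'a \<Rightarrow> bool" where
  "dependent_pair \<iota> x y \<longleftrightarrow> (\<exists>N c. (\<exists>i\<le>N. \<exists>j\<le>N. c i j \<noteq> 0) \<and>
     (\<Sum>i\<le>N. \<Sum>j\<le>N. \<iota> (c i j) * x ^ i * y ^ j) = 0)"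

lemma dependent_pair_refl:
  fixes \<iota> :: "'k::field \<Rightarrow> 'a::field"
  assumes "\<iota> 0 = 0" "\<iota> 1 = 1" "\<iota> (- 1) = - 1"
  shows "dependent_pair \<iota> x x"
  unfolding dependent_pair_def
proof -
  define c where "c = (\<lambda>(i :: nat) (j :: nat). if i = 1 \<and> j = 0 then 1 else if i = 0 \<and> j = 1 then - 1 else (0 :: 'k))"
  have "c 1 0 \<noteq> 0" "(1 :: nat) \<le> 1" "(0 :: nat) \<le> 1" by (auto simp: c_def)
  hence "\<exists>i\<le>1. \<exists>j\<le>1. c i j \<noteq> 0" by blast
  moreover have "(\<Sum>i\<le>1. \<Sum>j\<le>1. \<iota> (c i j) * x ^ i * x ^ j) = 0"
    using assms by (simp add: c_def)
  ultimately show "\<exists>N c. (\<exists>i\<le>N. \<exists>j\<le>N. c i j \<noteq> 0) \<and> (\<Sum>i\<le>N. \<Sum>j\<le>N. \<iota> (c i j) * x ^ i * x ^ j) = 0"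
    by blast
qed

lemma dependent_pair_if_not_independent:
  fixes \<iota> :: "'k::field \<Rightarrow> 'a::field"
  assumes \<iota>: "\<iota> 0 = 0" and dep: "\<not> alg_independent \<iota> {x, y}" and "x \<noteq> y"
  shows "dependent_pair \<iota> x y"
proof -
  obtain P :: "('a, 'k) mpoly" where P: "\<And>m. m \<in> Poly_Mapping.keys P \<Longrightarrow> Poly_Mapping.keys m \<subseteq> {x, y}"
    "mpeval \<iota> (\<lambda>y. y) P = 0" "P \<noteq> 0"
    using dep by (auto simp: alg_independent_def)
  define mon where "mon = (\<lambda>(i, j). Poly_Mapping.single x i + Poly_Mapping.single y j :: 'a \<Rightarrow>\<^sub>0 nat)"
  define e where "e = (\<lambda>m :: 'a \<Rightarrow>\<^sub>0 nat. (Poly_Mapping.lookup m x, Poly_Mapping.lookup m y))"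
  have e_mon: "e (mon p) = p" for p
    using \<open>x \<noteq> y\<close> by (cases p) (auto simp: e_def mon_def lookup_add lookup_single_not_eq)
  have mon_e: "mon (e m) = m" if "m \<in> Poly_Mapping.keys P" for m
  proof (rule poly_mapping_eqI)
    fix k
    show "Poly_Mapping.lookup (mon (e m)) k = Poly_Mapping.lookup m k"
      using P(1)[OF that] \<open>x \<noteq> y\<close> by (cases "k \<in> {x, y}")
        (auto simp: e_def mon_def lookup_add lookup_single when_def in_keys_iff)
  qed
  define c where "c = (\<lambda>i j. Poly_Mapping.lookup P (mon (i, j)))"
  define N where "N = Max ((\<lambda>m. max (fst (e m)) (snd (e m))) ` Poly_Mapping.keys P)"
  have N: "fst (e m) \<le> N \<and> snd (e m) \<le> N" if "m \<in> Poly_Mapping.keys P" for m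
  proof -
    have "max (fst (e m)) (snd (e m)) \<le> N" unfolding N_def using that by (intro Max_ge) auto
    thus ?thesis by simp
  qed
  have "mpeval \<iota> (\<lambda>y. y) P = (\<Sum>m\<in>Poly_Mapping.keys P. \<iota> (Poly_Mapping.lookup P m) * x ^ fst (e m) * y ^ snd (e m))"
    unfolding mpeval_def
  proof (rule sum.cong)
    fix m assume m: "m \<in> Poly_Mapping.keys P"
    have "(\<Prod>v\<in>Poly_Mapping.keys m. v ^ Poly_Mapping.lookup m v) = (\<Prod>v\<in>{x, y}. v ^ Poly_Mapping.lookup m v)"
      using P(1)[OF m] by (intro prod.mono_neutral_left) (auto simp: in_keys_iff)
    thus "\<iota> (Poly_Mapping.lookup P m) * (\<Prod>v\<in>Poly_Mapping.keys m. v ^ Poly_Mapping.lookup m v) =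
        \<iota> (Poly_Mapping.lookup P m) * x ^ fst (e m) * y ^ snd (e m)"
      using \<open>x \<noteq> y\<close> by (simp add: e_def)
  qed auto
  also have "\<dots> = (\<Sum>(i, j)\<in>e ` Poly_Mapping.keys P. \<iota> (c i j) * x ^ i * y ^ j)"
  proof (subst sum.reindex)
    show "inj_on e (Poly_Mapping.keys P)" using mon_e by (metis inj_on_inverseI)
    show "(\<Sum>m\<in>Poly_Mapping.keys P. \<iota> (Poly_Mapping.lookup P m) * x ^ fst (e m) * y ^ snd (e m)) =
      sum ((\<lambda>(i, j). \<iota> (c i j) * x ^ i * y ^ j) \<circ> e) (Poly_Mapping.keys P)"
      using mon_e by (intro sum.cong) (auto simp: c_def case_prod_beta)
  qed
  also have "\<dots> = (\<Sum>(i, j)\<in>{..N} \<times> {..N}. \<iota> (c i j) * x ^ i * y ^ j)"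
  proof (rule sum.mono_neutral_left)
    show "e ` Poly_Mapping.keys P \<subseteq> {..N} \<times> {..N}" using N by (intro image_subsetI) (simp add: mem_Times_iff)
    show "\<forall>p\<in>{..N} \<times> {..N} - e ` Poly_Mapping.keys P. (case p of (i, j) \<Rightarrow> \<iota> (c i j) * x ^ i * y ^ j) = 0"
    proof
      fix p assume p: "p \<in> {..N} \<times> {..N} - e ` Poly_Mapping.keys P"
      have "mon p \<notin> Poly_Mapping.keys P" using p e_mon by (metis Diff_iff image_eqI)
      thus "(case p of (i, j) \<Rightarrow> \<iota> (c i j) * x ^ i * y ^ j) = 0"
        using \<iota> by (auto simp: c_def in_keys_iff split: prod.splits)
    qed
  qed auto
  also have "\<dots> = (\<Sum>i\<le>N. \<Sum>j\<le>N. \<iota> (c i j) * x ^ i * y ^ j)"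
    by (simp add: sum.cartesian_product)
  finally have sum0: "(\<Sum>i\<le>N. \<Sum>j\<le>N. \<iota> (c i j) * x ^ i * y ^ j) = 0" using P(2) by simp
  obtain m where m: "m \<in> Poly_Mapping.keys P" using P(3) by fastforce
  have "c (fst (e m)) (snd (e m)) \<noteq> 0" using mon_e[OF m] m by (simp add: c_def in_keys_iff)
  thus ?thesis unfolding dependent_pair_def using N[OF m] sum0 by blast
qed

text \<open>The element b of a one-element basis is not a constant c, as X - c would be a relation;
  maximality of {b} makes it dependent with every z.\<close>

lemma transcendence_degree_1:
  fixes \<iota> :: "'k::field \<Rightarrow> 'a::field"
  assumes \<iota>: "\<iota> 0 = 0" "\<iota> 1 = 1" "\<And>a. \<iota> (- a) = - \<iota> a"
    and deg: "has_transcendence_degree \<iota> 1"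
  obtains b where "b \<notin> range \<iota>" "\<And>z. dependent_pair \<iota> b z"
proof -
  obtain b where b: "alg_independent \<iota> {b}" and max: "\<And>B. alg_independent \<iota> B \<Longrightarrow> {b} \<subseteq> B \<Longrightarrow> B = {b}"
    using deg by (auto simp: has_transcendence_degree_def transcendence_basis_def card_1_singleton_iff)
  have "b \<notin> range \<iota>"
  proof
    assume "b \<in> range \<iota>"
    then obtain c where c: "b = \<iota> c" by blast
    define m :: "'a \<Rightarrow>\<^sub>0 nat" where "m = Poly_Mapping.single b 1"
    define P :: "('a, 'k) mpoly" where "P = Poly_Mapping.single m 1 + Poly_Mapping.single 0 (- c)"
    have "m \<noteq> 0" by (metis m_def lookup_single_eq lookup_zero one_neq_zero)
    have keys: "Poly_Mapping.keys P \<subseteq> {m, 0}"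
      unfolding P_def using keys_add[of "Poly_Mapping.single m 1" "Poly_Mapping.single 0 (- c)"]
      by (auto split: if_splits)
    have lookups: "Poly_Mapping.lookup P m = 1" "Poly_Mapping.lookup P 0 = - c"
      using \<open>m \<noteq> 0\<close> by (auto simp: P_def lookup_add lookup_single_not_eq)
    have "mpeval \<iota> (\<lambda>y. y) P = \<iota> 1 * (\<Prod>v\<in>Poly_Mapping.keys m. v ^ Poly_Mapping.lookup m v) + \<iota> (- c)"
      using \<open>m \<noteq> 0\<close> by (subst mpeval_superset[of \<iota> "{m, 0}"]) (use keys \<iota>(1) in \<open>auto simp: lookups\<close>)
    also have "\<dots> = 0" using \<iota> c by (simp add: m_def)
    finally have "mpeval \<iota> (\<lambda>y. y) P = 0" .
    moreover have "\<forall>m\<in>Poly_Mapping.keys P. Poly_Mapping.keys m \<subseteq> {b}"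
      using keys by (auto simp: m_def split: if_splits)
    ultimately have "P = 0" using b by (auto simp: alg_independent_def)
    thus False using lookups by simp
  qed
  moreover have "dependent_pair \<iota> b z" for z
  proof (cases "z = b")
    case True
    thus ?thesis using dependent_pair_refl[of \<iota> b] \<iota> by simp
  next
    case False
    hence "\<not> alg_independent \<iota> {b, z}" using max[of "{b, z}"] by blast
    thus ?thesis using dependent_pair_if_not_independent[of \<iota> b z] \<iota> False by simp
  qed
  ultimately show ?thesis using that by blast
qed

section \<open>Towers of subfields\<close>

lemma poly_over_mono: "poly_over E P \<Longrightarrow> E \<subseteq> L \<Longrightarrow> poly_over L P"
  by (auto simp: poly_over_def)

text \<open>Plays the role of a finite extension: instead of a dimension it records that an element
  of degree d over L has degree at most e d over E. The factors multiply in towers.\<close>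

definition bounded_extension :: "'a::alg_closed_field set \<Rightarrow> 'a set \<Rightarrow> bool" where
  "bounded_extension E L \<longleftrightarrow> infinite_subfield L \<and> E \<subseteq> L \<and>
     (\<exists>e. \<forall>g s. poly_over L g \<longrightarrow> g \<noteq> 0 \<longrightarrow> poly g s = 0 \<longrightarrow>
        (\<exists>g'. poly_over E g' \<and> g' \<noteq> 0 \<and> poly g' s = 0 \<and> degree g' \<le> e * degree g))"

lemma bounded_extension_refl: "infinite_subfield E \<Longrightarrow> bounded_extension E E"
  unfolding bounded_extension_def by (metis mult_1 order_refl)

lemma bounded_extension_trans:
  assumes "bounded_extension E L" "bounded_extension L M"
  shows "bounded_extension E M"
proof -
  obtain e where e: "\<And>g s. poly_over L g \<Longrightarrow> g \<noteq> 0 \<Longrightarrow> poly g s = 0 \<Longrightarrow>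
      \<exists>g'. poly_over E g' \<and> g' \<noteq> 0 \<and> poly g' s = 0 \<and> degree g' \<le> e * degree g"
    using assms(1) unfolding bounded_extension_def by blast
  obtain e' where e': "\<And>g s. poly_over M g \<Longrightarrow> g \<noteq> 0 \<Longrightarrow> poly g s = 0 \<Longrightarrow>
      \<exists>g'. poly_over L g' \<and> g' \<noteq> 0 \<and> poly g' s = 0 \<and> degree g' \<le> e' * degree g"
    using assms(2) unfolding bounded_extension_def by blast
  have "\<exists>g'. poly_over E g' \<and> g' \<noteq> 0 \<and> poly g' s = 0 \<and> degree g' \<le> (e * e') * degree g"
    if g: "poly_over M g" "g \<noteq> 0" "poly g s = 0" for g s
  proof -
    obtain g1 where g1: "poly_over L g1" "g1 \<noteq> 0" "poly g1 s = 0" "degree g1 \<le> e' * degree g"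
      using e'[OF g] by blast
    obtain g2 where g2: "poly_over E g2" "g2 \<noteq> 0" "poly g2 s = 0" "degree g2 \<le> e * degree g1"
      using e[OF g1(1-3)] by blast
    have "degree g2 \<le> e * (e' * degree g)" using g2(4) g1(4) by (meson le_trans mult_le_mono2)
    thus ?thesis using g2 by (auto simp: mult.assoc)
  qed
  moreover have "infinite_subfield M" "E \<subseteq> M" using assms by (auto simp: bounded_extension_def)
  ultimately show ?thesis unfolding bounded_extension_def by blast
qed

lemma bounded_extension_adjoin:
  assumes E: "infinite_subfield E" and P: "poly_over E P" "P \<noteq> 0" "poly P z = 0"
  shows "\<exists>L. bounded_extension E L \<and> z \<in> L"
proof -
  interpret infinite_subfield E by (rule E)
  define L where "L = {poly h z |h. poly_over E h}"
  have "infinite_subfield L" unfolding L_def by (rule adjoin_subfield[OF P])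
  moreover have "E \<subseteq> L"
  proof
    fix c assume "c \<in> E"
    thus "c \<in> L" unfolding L_def by (intro CollectI exI[of _ "[:c:]"]) (auto intro: poly_over_const)
  qed
  moreover have "z \<in> L" unfolding L_def
    by (intro CollectI exI[of _ "[:0, 1:]"]) (auto intro!: poly_over_pCons)
  ultimately show ?thesis
    using adjoin_degree[OF P] unfolding bounded_extension_def poly_over_def L_def by blast
qed

lemma bounded_extension_adjoin_finite:
  assumes E: "infinite_subfield E" and "finite Z"
    and alg: "\<And>z. z \<in> Z \<Longrightarrow> \<exists>P. poly_over E P \<and> P \<noteq> 0 \<and> poly P z = 0"
  shows "\<exists>L. bounded_extension E L \<and> Z \<subseteq> L"
  using assms(2,3)
proof (induction Z)
  case empty
  thus ?case using bounded_extension_refl[OF E] by blast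
next
  case (insert z Z)
  then obtain L where L: "bounded_extension E L" "Z \<subseteq> L" by auto
  obtain P where P: "poly_over E P" "P \<noteq> 0" "poly P z = 0" using insert.prems by blast
  have "infinite_subfield L" "E \<subseteq> L" using L(1) by (auto simp: bounded_extension_def)
  then obtain M where M: "bounded_extension L M" "z \<in> M"
    using bounded_extension_adjoin[of L P z] poly_over_mono[OF P(1)] P by blast
  have "L \<subseteq> M" using M(1) by (auto simp: bounded_extension_def)
  thus ?case using bounded_extension_trans[OF L(1) M(1)] L(2) M(2) by blast
qed

text \<open>Regroup the relation by powers of y. The coefficient at j0 is a nonzero polynomial over
  the constants evaluated at the non-constant x, so it does not vanish.\<close>

lemma (in transcendental_element) algebraic_from_relation:
  assumes L: "infinite_subfield L" "range \<kappa> \<subseteq> L" "x \<in> L" "x \<notin> range \<kappa>"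
    and c: "c i0 j0 \<noteq> 0" "i0 \<le> N" "j0 \<le> N"
    and rel: "(\<Sum>i\<le>N. \<Sum>j\<le>N. \<kappa> (c i j) * x ^ i * y ^ j) = 0"
  shows "\<exists>P. poly_over L P \<and> P \<noteq> 0 \<and> poly P y = 0"
proof -
  interpret L: infinite_subfield L by (rule L(1))
  define a where "a = (\<lambda>j. \<Sum>i\<le>N. \<kappa> (c i j) * x ^ i)"
  define P where "P = (\<Sum>j\<le>N. monom (a j) j)"
  have "poly_over L P"
    unfolding P_def a_def using L
    by (intro L.poly_over_sum L.poly_over_monom L.sum_mem L.mult_mem L.power_mem) auto
  moreover have "poly P y = 0"
  proof -
    have "poly P y = (\<Sum>j\<le>N. \<Sum>i\<le>N. \<kappa> (c i j) * x ^ i * y ^ j)"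
      by (simp add: P_def poly_sum poly_monom a_def sum_distrib_right)
    also have "\<dots> = (\<Sum>i\<le>N. \<Sum>j\<le>N. \<kappa> (c i j) * x ^ i * y ^ j)" by (rule sum.swap)
    finally show ?thesis using rel by simp
  qed
  moreover have "P \<noteq> 0"
  proof
    assume "P = 0"
    hence "coeff P j0 = 0" by simp
    moreover have "coeff P j0 = a j0" using c by (simp add: P_def coeff_sum)
    ultimately have "a j0 = 0" by simp
    define F where "F = (\<Sum>i\<le>N. monom (c i j0) i)"
    have "ev_at (\<Sum>i\<le>n. monom (c i j0) i) x = (\<Sum>i\<le>n. \<kappa> (c i j0) * x ^ i)" for n
      by (induction n) (simp_all add: ev_at_add ev_at_def[of "monom _ _"] map_poly_monom poly_monom)
    hence "ev_at F x = a j0" by (simp add: F_def a_def)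
    moreover have "coeff F i0 \<noteq> 0" using c by (simp add: F_def coeff_sum)
    hence "F \<noteq> 0" by auto
    ultimately show False using ev_at_eq_0D[of F x] \<open>a j0 = 0\<close> L(4) by simp
  qed
  ultimately show ?thesis by blast
qed

section \<open>Eventual stability\<close>

lemma irreducible_factorization_exists:
  fixes P :: "'a::field poly"
  assumes "P \<noteq> 0"
  shows "\<exists>A. is_irreducible_factorization P A"
  using assms
proof (induction "degree P" arbitrary: P rule: less_induct)
  case less
  consider "degree P = 0" | "Factorial_Ring.irreducible P"
    | Q R where "P = Q * R" "degree Q > 0" "degree R > 0"
  proof (cases "degree P = 0 \<or> Factorial_Ring.irreducible P")
    case False
    hence "\<not> P dvd 1" using less.prems by (simp add: is_unit_iff_degree)
    then obtain Q R where "P = Q * R" "\<not> Q dvd 1" "\<not> R dvd 1"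
      using False less.prems by (auto simp: Factorial_Ring.irreducible_def)
    moreover have "Q \<noteq> 0" "R \<noteq> 0" using calculation less.prems by auto
    ultimately show ?thesis using that(3) by (auto simp: is_unit_iff_degree)
  qed (use that(1,2) in blast)
  thus ?case
  proof cases
    case 1
    then obtain c where "P = [:c:]" by (elim degree_eq_zeroE)
    thus ?thesis using less.prems
      by (intro exI[of _ "{#}"]) (auto simp: is_irreducible_factorization_def intro!: exI[of _ c])
  next
    case 2
    thus ?thesis using less.prems
      by (intro exI[of _ "{#P#}"]) (auto simp: is_irreducible_factorization_def intro!: exI[of _ 1])
  next
    case (3 Q R)
    hence nz: "Q \<noteq> 0" "R \<noteq> 0" using less.prems by auto
    hence "degree Q < degree P" "degree R < degree P" using 3 by (auto simp: degree_mult_eq)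
    then obtain A B where "is_irreducible_factorization Q A" "is_irreducible_factorization R B"
      using less.hyps nz by blast
    then obtain c d where "Q = smult c (prod_mset A)" "R = smult d (prod_mset B)"
      "\<forall>g\<in>#A. Factorial_Ring.irreducible g" "\<forall>g\<in>#B. Factorial_Ring.irreducible g"
      by (auto simp: is_irreducible_factorization_def)
    thus ?thesis using 3(1) less.prems
      by (intro exI[of _ "A + B"]) (auto simp: is_irreducible_factorization_def intro!: exI[of _ "d * c"])
  qed
qed

text \<open>The degrees of the factors add up to the degree of P, and each of them is at least a
  fraction 1/c of it.\<close>

lemma size_irreducible_factorization:
  fixes P :: "'a::field poly"
  assumes A: "is_irreducible_factorization P A"
    and deg: "\<And>g. Factorial_Ring.irreducible g \<Longrightarrow> g dvd P \<Longrightarrow> real (degree P) \<le> c * real (degree g)"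
    and P: "degree P > 0"
  shows "real (size A) \<le> c"
proof -
  obtain a where a: "P = smult a (prod_mset A)" "P \<noteq> 0" and irr: "\<And>g. g \<in># A \<Longrightarrow> Factorial_Ring.irreducible g"
    using A by (auto simp: is_irreducible_factorization_def)
  have "a \<noteq> 0" using a by auto
  have sum: "degree (prod_mset B) = (\<Sum>g\<in>#B. degree g)" if "0 \<notin># B" for B :: "'a poly multiset"
    using that by (induction B) (auto simp: degree_mult_eq prod_mset_zero_iff)
  have "0 \<notin># A" using irr by fastforce
  hence degP: "degree P = (\<Sum>g\<in>#A. degree g)" using a \<open>a \<noteq> 0\<close> sum by simp
  have "real (size B) * real (degree P) \<le> c * real (\<Sum>g\<in>#B. degree g)" if "B \<subseteq># A" for B
    using that
  proof (induction B)
    case (add g B)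
    have "g \<in># A" using mset_subset_eq_insertD[OF add.prems] by simp
    moreover from this have "g dvd P" using a(1) by (simp add: dvd_prod_mset dvd_smult)
    ultimately have "real (degree P) \<le> c * real (degree g)" using deg irr by blast
    moreover have "B \<subseteq># A"
      using mset_subset_eq_insertD[OF add.prems] by (auto simp: subset_mset.less_imp_le)
    ultimately show ?case using add.IH by (simp add: algebra_simps)
  qed simp
  from this[of A] have "real (size A) * real (degree P) \<le> c * real (degree P)" by (simp add: degP)
  thus ?thesis using P by simp
qed

section \<open>Polynomials over K evaluated in the algebraic closure\<close>

abbreviation ac_eval :: "'a::field poly \<Rightarrow> 'a alg_closure \<Rightarrow> 'a alg_closure" where
  "ac_eval F x \<equiv> poly (map_poly to_ac F) x"

lemma ac_eval_add: "ac_eval (F + G) x = ac_eval F x + ac_eval G x"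
  by (induction F G rule: poly_induct2) (auto simp: map_poly_pCons algebra_simps)

lemma ac_eval_smult: "ac_eval (smult c F) x = to_ac c * ac_eval F x"
  by (induction F) (auto simp: map_poly_pCons algebra_simps)

lemma ac_eval_mult: "ac_eval (F * G) x = ac_eval F x * ac_eval G x"
  by (induction F) (auto simp: map_poly_pCons ac_eval_add ac_eval_smult algebra_simps)

lemma ac_eval_pcompose: "ac_eval (pcompose F G) x = ac_eval F (ac_eval G x)"
  by (induction F) (auto simp: map_poly_pCons pcompose_pCons ac_eval_add ac_eval_mult algebra_simps)

lemma ac_eval_poly_iterate: "ac_eval (poly_iterate f n) x = (ac_eval f ^^ n) x"
  by (induction n) (auto simp: poly_iterate_def ac_eval_pcompose map_poly_pCons)

lemma ac_eval_to_ac: "ac_eval F (to_ac x) = to_ac (poly F x)"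
  by (induction F) (auto simp: map_poly_pCons)

lemma degree_poly_iterate: "degree (poly_iterate f n) = degree f ^ n" for f :: "'a::idom poly"
  by (induction n) (auto simp: poly_iterate_def degree_pcompose)

text \<open>Exchange: t is a non-constant element of k(u), so its relation with b makes b algebraic
  over k(u). Over the extension containing b every element of K is algebraic, and adjoining the
  finitely many coordinate ratios captures K.\<close>

lemma function_field_bounded_extension:
  fixes \<iota> :: "Qbar \<Rightarrow> 'K::field" and V :: "(Qbar ^ 'n::finite) set"
  assumes ff: "function_field V \<iota> \<phi>" and deg: "has_transcendence_degree \<iota> 1"
    and trans: "transcendental_element (to_ac \<circ> \<iota>) u" and t: "t \<notin> range \<iota>"
    and tE: "to_ac t \<in> transcendental_element.ratfield (to_ac \<circ> \<iota>) u"
  shows "\<exists>L. bounded_extension (transcendental_element.ratfield (to_ac \<circ> \<iota>) u) L \<and> range to_ac \<subseteq> L"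
proof -
  interpret function_field V \<iota> \<phi> by (rule ff)
  interpret transcendental_element "to_ac \<circ> \<iota>" u by (rule trans)
  let ?\<kappa> = "to_ac \<circ> \<iota>"
  have \<iota>_minus: "\<iota> (- a) = - \<iota> a" for a
    using \<iota>_add[of a "- a"] \<iota>_0 by (simp add: eq_neg_iff_add_eq_0 add.commute)
  obtain b where b: "b \<notin> range \<iota>" "\<And>z. dependent_pair \<iota> b z"
    using transcendence_degree_1[OF \<iota>_0 \<iota>_1 \<iota>_minus deg] by blast
  have not_const: "to_ac x \<notin> range ?\<kappa>" if "x \<notin> range \<iota>" for x
    using that by auto
  have rel: "\<exists>N c i0 j0. c i0 j0 \<noteq> 0 \<and> i0 \<le> N \<and> j0 \<le> N \<and>
      (\<Sum>i\<le>N. \<Sum>j\<le>N. ?\<kappa> (c i j) * to_ac b ^ i * to_ac z ^ j) = 0" for z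
  proof -
    obtain N c where c: "\<exists>i\<le>N. \<exists>j\<le>N. c i j \<noteq> 0" "(\<Sum>i\<le>N. \<Sum>j\<le>N. \<iota> (c i j) * b ^ i * z ^ j) = 0"
      using b(2)[of z] unfolding dependent_pair_def by blast
    have "to_ac (\<Sum>i\<le>N. \<Sum>j\<le>N. \<iota> (c i j) * b ^ i * z ^ j) = 0" by (simp only: c to_ac_0)
    hence "(\<Sum>i\<le>N. \<Sum>j\<le>N. ?\<kappa> (c i j) * to_ac b ^ i * to_ac z ^ j) = 0"
      by (simp add: to_ac_sum)
    thus ?thesis using c(1) by blast
  qed
  have "range ?\<kappa> \<subseteq> ratfield" using \<kappa>_in_ratfield by auto
  have "\<exists>P. poly_over ratfield P \<and> P \<noteq> 0 \<and> poly P (to_ac b) = 0"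
  proof -
    obtain N c i0 j0 where c: "c i0 j0 \<noteq> 0" "i0 \<le> N" "j0 \<le> N"
      "(\<Sum>i\<le>N. \<Sum>j\<le>N. ?\<kappa> (c i j) * to_ac b ^ i * to_ac t ^ j) = 0" using rel[of t] by blast
    \<comment> \<open>The variables change roles: t is the element already available, b the one to
      be shown algebraic.\<close>
    have "(\<Sum>j\<le>N. \<Sum>i\<le>N. ?\<kappa> (c i j) * to_ac t ^ j * to_ac b ^ i) = 0"
      using c(4) by (subst sum.swap) (simp add: mult_ac)
    thus ?thesis
      using algebraic_from_relation[of ratfield "to_ac t" "\<lambda>j i. c i j" j0 i0 N "to_ac b"]
        E.infinite_subfield_axioms \<open>range ?\<kappa> \<subseteq> ratfield\<close> tE not_const[OF t] c by blast
  qed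
  then obtain L1 where L1: "bounded_extension ratfield L1" "to_ac b \<in> L1"
    using bounded_extension_adjoin[OF E.infinite_subfield_axioms] by blast
  have L1': "infinite_subfield L1" "range ?\<kappa> \<subseteq> L1"
    using L1 \<open>range ?\<kappa> \<subseteq> ratfield\<close> by (auto simp: bounded_extension_def)
  have alg: "\<exists>P. poly_over L1 P \<and> P \<noteq> 0 \<and> poly P (to_ac z) = 0" for z
  proof -
    obtain N c i0 j0 where c: "c i0 j0 \<noteq> 0" "i0 \<le> N" "j0 \<le> N"
      "(\<Sum>i\<le>N. \<Sum>j\<le>N. ?\<kappa> (c i j) * to_ac b ^ i * to_ac z ^ j) = 0" using rel[of z] by blast
    show ?thesis by (rule algebraic_from_relation[OF L1' L1(2) not_const[OF b(1)] c])
  qed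
  define Z where "Z = (\<lambda>(i, j). to_ac (\<phi> (coord i, coord j))) ` (UNIV :: ('n \<times> 'n) set)"
  have "finite Z" by (simp add: Z_def)
  have "\<exists>P. poly_over L1 P \<and> P \<noteq> 0 \<and> poly P z = 0" if "z \<in> Z" for z
    using that alg by (auto simp: Z_def)
  then obtain L where L: "bounded_extension L1 L" "Z \<subseteq> L"
    using bounded_extension_adjoin_finite[OF L1'(1) \<open>finite Z\<close>] by blast
  interpret L: infinite_subfield L using L(1) by (simp add: bounded_extension_def)
  have "{z. to_ac z \<in> L} = UNIV"
  proof (rule generated_by_coordinates)
    show "\<iota> c \<in> {z. to_ac z \<in> L}" for c
      using L1'(2) L(1) by (auto simp: bounded_extension_def)
    show "\<phi> (coord i, coord j) \<in> {z. to_ac z \<in> L}" for i j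
      using L(2) by (auto simp: Z_def)
  qed (auto intro: L.mems)
  thus ?thesis using bounded_extension_trans[OF L1(1) L(1)] by blast
qed

theorem theorem1p3:
  fixes \<iota> :: "Qbar \<Rightarrow> 'K::field"
    and V :: "(Qbar ^ 'n::finite) set"
    and p r q :: nat
    and f :: "'K poly"
    and t \<beta> :: 'K
  assumes "is_function_field_of_smooth_projective_curve \<iota> V"
    and "prime p" and "r \<ge> 1" and "q = p ^ r"
    and "f = Polynomial.monom 1 q + [:t:]"
    and "t \<notin> range \<iota>"
    and "\<not> periodic_point f \<beta>"
  shows "eventually_stable f \<beta>"
proof -
  obtain \<phi> where ff: "function_field V \<iota> \<phi>"
  proof -
    have V: "projective_variety V" "is_function_field \<iota> V"
      using assms(1) by (auto simp: is_function_field_of_smooth_projective_curve_def)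
    then obtain \<phi> where \<phi>: "\<phi> ` rational_fractions V = UNIV" "\<forall>c. \<phi> (Poly_Mapping.single 0 c, 1) = \<iota> c"
      "\<forall>F G F' G'. (F, G) \<in> rational_fractions V \<longrightarrow> (F', G') \<in> rational_fractions V \<longrightarrow>
           (\<phi> (F, G) = \<phi> (F', G') \<longleftrightarrow> vanishes_on (F * G' - F' * G) V) \<and>
           \<phi> (F * G' + F' * G, G * G') = \<phi> (F, G) + \<phi> (F', G') \<and>
           \<phi> (F * F', G * G') = \<phi> (F, G) * \<phi> (F', G')"
      unfolding is_function_field_def by blast
    have "V \<noteq> {}" "\<And>x. x \<in> V \<Longrightarrow> x \<noteq> 0"
      using V(1) by (auto simp: projective_variety_def projective_algebraic_set_def)
    with \<phi> have "function_field V \<iota> \<phi>" by unfold_locales blast+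
    thus ?thesis using that by blast
  qed
  interpret ff: function_field V \<iota> \<phi> by (rule ff)
  have deg: "has_transcendence_degree \<iota> 1"
    using assms(1) by (auto simp: is_function_field_of_smooth_projective_curve_def)
  have q2: "q \<ge> 2"
  proof -
    have "p ^ 1 \<le> p ^ r" using assms(2,3) by (intro power_increasing) (auto dest: prime_gt_0_nat)
    thus ?thesis using prime_ge_2_nat[OF assms(2)] assms(4) by simp
  qed
  define \<kappa> where "\<kappa> = to_ac \<circ> \<iota>"
  \<comment> \<open>The polynomial is f(X) - X, so u is a fixed point of f.\<close>
  obtain u where "poly (monom 1 q + [:to_ac t, - 1:]) u = 0"
  proof -
    have "degree (monom 1 q + [:to_ac t, - 1:]) = q"
      using q2 by (subst degree_add_eq_left) (auto simp: degree_monom_eq)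
    thus ?thesis using alg_closed_imp_poly_has_root that q2 by (metis gr0I not_numeral_le_zero)
  qed
  hence u: "u - u ^ q = to_ac t" by (simp add: poly_monom algebra_simps)
  have trans: "transcendental_element \<kappa> u"
  proof
    show "u \<notin> range \<kappa>"
    proof
      assume "u \<in> range \<kappa>"
      then obtain c where c: "u = to_ac (\<iota> c)" by (auto simp: \<kappa>_def)
      have \<iota>_power: "\<iota> (c ^ n) = \<iota> c ^ n" for n by (induction n) (auto simp: ff.\<iota>_1 ff.\<iota>_mult)
      have "to_ac t = to_ac (\<iota> c - \<iota> (c ^ q))" by (simp add: \<iota>_power flip: u c)
      hence "t = \<iota> c - \<iota> (c ^ q)" by (simp only: to_ac_eq_iff)
      moreover have "\<iota> c = \<iota> (c - c ^ q) + \<iota> (c ^ q)" by (simp flip: ff.\<iota>_add)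
      ultimately have "t = \<iota> (c - c ^ q)" by simp
      thus False using assms(6) by blast
    qed
  qed (auto simp: \<kappa>_def ff.\<iota>_1 ff.\<iota>_add ff.\<iota>_mult)
  interpret transcendental_element \<kappa> u by (rule trans)
  have "to_ac t \<in> ratfield" unfolding u[symmetric] using u_in_ratfield by (intro E.mems)
  then obtain L where L: "bounded_extension ratfield L" "range to_ac \<subseteq> L"
    using function_field_bounded_extension[OF ff deg trans[unfolded \<kappa>_def] assms(6)]
    unfolding \<kappa>_def by blast
  obtain e where e: "\<And>g s. poly_over L g \<Longrightarrow> g \<noteq> 0 \<Longrightarrow> poly g s = 0 \<Longrightarrow>
      \<exists>g'. poly_over ratfield g' \<and> g' \<noteq> 0 \<and> poly g' s = 0 \<and> degree g' \<le> e * degree g"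
    using L(1) unfolding bounded_extension_def by blast
  have over_L: "poly_over L (map_poly to_ac g)" for g
    using L(2) by (auto simp: poly_over_def coeff_map_poly)
  have map_nz: "map_poly to_ac g \<noteq> 0" if "g \<noteq> 0" for g :: "'K poly"
    using that by (subst map_poly_eq_0_iff) auto
  interpret algebraic_extension \<kappa> u
  proof
    fix x
    obtain g :: "'K poly" where "g \<noteq> 0" "poly (map_poly to_ac g) x = 0" by (rule alg_closure_algebraic)
    thus "algebraic_over x" using e[OF over_L map_nz] unfolding algebraic_over_def by blast
  qed
  obtain vk :: "Qbar \<Rightarrow> real" where vk: "valuation vk" "vk (of_nat p) = 1" "\<And>x. x \<noteq> 0 \<Longrightarrow> vk x \<in> \<rat>"
    by (rule padic_valuation_alg_closure_rat[OF assms(2)]) (rule that)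
  \<comment> \<open>A nonempty open interval is not exhausted by the countably many rationals; its
    end points are the bounds that \<open>padic_tree\<close> puts on \<open>v u\<close>.\<close>
  obtain \<gamma> :: real where \<gamma>: "\<gamma> \<in> {0<..<1 / (2 * real q ^ 2)}" "\<gamma> \<notin> \<rat>"
    using open_minus_countable[OF countable_rat, of "{0<..<1 / (2 * real q ^ 2)}"] q2 by auto
  obtain v where v: "valuation v" "\<And>a. a \<noteq> 0 \<Longrightarrow> v (\<kappa> a) = vk a" "v u = \<gamma>"
    by (rule gauss_valuation[OF vk(1,3) \<gamma>(2)]) (assumption, rule that)
  interpret padic_tree \<kappa> u v p r q
  proof -
    interpret valuation v by (rule v(1))
    have "v (of_nat p) = 1"
      using v(2)[of "of_nat p"] vk(2) prime_gt_0_nat[OF assms(2)] by (simp add: \<kappa>_of_nat)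
    thus "padic_tree \<kappa> u v p r q"
      using v(2,3) vk(3) \<gamma> assms by unfold_locales auto
  qed
  have step: "step q = ac_eval f"
    unfolding step_def u
    by (auto simp: assms(5) ac_eval_add map_poly_monom poly_monom map_poly_pCons)
  have ac_iter: "(step q ^^ n) (to_ac x) = to_ac (poly (poly_iterate f n) x)" for n x
    unfolding step by (simp flip: ac_eval_poly_iterate add: ac_eval_to_ac)
  have "(step q ^^ n) (to_ac \<beta>) \<noteq> to_ac \<beta>" if "n > 0" for n
    using assms(7) that unfolding ac_iter by (auto simp: periodic_point_def)
  then obtain c where c: "\<And>n s P. (step q ^^ n) s = to_ac \<beta> \<Longrightarrow> poly_over ratfield P \<Longrightarrow> P \<noteq> 0 \<Longrightarrow>
     poly P s = 0 \<Longrightarrow> real q ^ n \<le> c * real (degree P)"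
    using degree_growth[of "to_ac \<beta>"] by blast
  have degf: "degree f = q"
    unfolding assms(5) using q2 by (subst degree_add_eq_left) (auto simp: degree_monom_eq)
  \<comment> \<open>c compares q^n with degrees over k(u), and e converts these into degrees over K;
    the absolute value spares a discussion of the sign of c.\<close>
  have "\<exists>A. is_irreducible_factorization (poly_iterate f n - [:\<beta>:]) A \<and> size A \<le> nat \<lceil>\<bar>c\<bar> * real e\<rceil>" for n
  proof -
    define P where "P = poly_iterate f n - [:\<beta>:]"
    have degP: "degree P = q ^ n"
    proof -
      have "degree (poly_iterate f n + [:- \<beta>:]) = degree (poly_iterate f n)"
        using q2 by (intro degree_add_eq_left) (simp add: degree_poly_iterate degf)
      moreover have "P = poly_iterate f n + [:- \<beta>:]"
        by (rule poly_eqI) (simp add: P_def coeff_pCons split: nat.splits)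
      ultimately show ?thesis by (simp add: degree_poly_iterate degf)
    qed
    hence "degree P > 0" "P \<noteq> 0" using q2 by auto
    obtain A where A: "is_irreducible_factorization P A"
      using irreducible_factorization_exists[OF \<open>P \<noteq> 0\<close>] by blast
    have "real (size A) \<le> \<bar>c\<bar> * real e"
    proof (rule size_irreducible_factorization[OF A _ \<open>degree P > 0\<close>])
      fix g assume g: "Factorial_Ring.irreducible g" "g dvd P"
      have "g \<noteq> 0" "degree g > 0"
        using g(1) by (auto simp: Factorial_Ring.irreducible_def is_unit_iff_degree intro: Nat.gr0I)
      hence "degree (map_poly to_ac g) > 0" by (subst degree_map_poly) auto
      then obtain s where s: "ac_eval g s = 0" using alg_closed_imp_poly_has_root by blast
      have "ac_eval P s = 0" using g(2) s by (auto simp: ac_eval_mult elim!: dvdE)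
      moreover have "ac_eval (poly_iterate f n) s = ac_eval (P + [:\<beta>:]) s" by (simp add: P_def)
      ultimately have "ac_eval (poly_iterate f n) s = to_ac \<beta>" by (simp add: ac_eval_add map_poly_pCons)
      hence s_node: "(step q ^^ n) s = to_ac \<beta>" by (simp add: step ac_eval_poly_iterate)
      obtain g' where g': "poly_over ratfield g'" "g' \<noteq> 0" "poly g' s = 0"
        "degree g' \<le> e * degree (map_poly to_ac g)"
        using e[OF over_L map_nz[OF \<open>g \<noteq> 0\<close>] s] by blast
      have "real (degree P) \<le> c * real (degree g')" using c[OF s_node g'(1-3)] by (simp add: degP)
      also have "\<dots> \<le> \<bar>c\<bar> * real (degree g')" by (intro mult_right_mono) auto
      also have "\<dots> \<le> \<bar>c\<bar> * (real e * real (degree g))"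
      proof (intro mult_left_mono)
        have "degree (map_poly to_ac g) = degree g" by (rule degree_map_poly) auto
        hence "real (degree g') \<le> real (e * degree g)" using g'(4) by (simp only: of_nat_le_iff)
        thus "real (degree g') \<le> real e * real (degree g)" by (simp only: of_nat_mult)
      qed simp
      finally show "real (degree P) \<le> \<bar>c\<bar> * real e * real (degree g)" by (simp add: mult.assoc)
    qed
    hence "size A \<le> nat \<lceil>\<bar>c\<bar> * real e\<rceil>" by linarith
    thus ?thesis using A unfolding P_def by blast
  qed
  thus ?thesis unfolding eventually_stable_def by blast
qed

end
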